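(* Suppose that conditions (A3), (B1), (B2), (B3) and (B4) listed in the context hold and that $\log a_{k,n}(\hat\theta_n)=\log a_{k,n}(\theta_0)+o_p(1)$ for $k=1,\dots,K$. Let $$\mathrm{QBIC}_n^{\sharp}=-2\mathbb{H}_n(\hat\theta_n)+\log\big|-\partial_\theta^2\mathbb{H}_n(\hat\theta_n)\big|-2\log\pi_n(\hat\theta_n)-p\log2\pi .$$ Then $$\lim_{n\to\infty}\mathbb{E}\bigg\{\bigg|-2\log\Big(\int_\Theta e^{\mathbb{H}_n(\theta)}\pi_n(\theta)\,d\theta\Big)-\mathrm{QBIC}_n^{\sharp}\bigg|\bigg\}=0 .$$ In particular, $\mathrm{QBIC}_n^\sharp$ is an asymptotically unbiased estimator of $-2$ times the logarithm of the quasi-marginal likelihood, i.e. $\mathbb{E}\big\{\mathrm{QBIC}_n^\sharp+2\log\int_\Theta e^{\mathbb{H}_n(\theta)}\pi_n(\theta)d\theta\big\}\to0$.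
   Context: Setting. $\Theta=\prod_{k=1}^K\Theta_k\subset\mathbb{R}^p$, where each $\Theta_k\subset\mathbb{R}^{p_k}$ is a bounded convex domain and $p=\sum_{k=1}^Kp_k$. For each $n$, $\mathbb{H}_n(\theta)=\mathbb{H}_n(\mathbf{X}_n|\theta)$ is a real random function on $\Theta$ (the quasi-log likelihood, a function of the data $\mathbf{X}_n$ defined on a probability space $(\Omega,\mathcal{F},\mathbb{P})$), a.s. continuous on the compact set $\bar\Theta$. The QMLE $\hat\theta_n$ is any maximizer of $\mathbb{H}_n$ over $\bar\Theta$. $\pi_n:\Theta\to(0,\infty)$ is a probability density (the prior). $\theta_0\in\Theta$ is a constant. The rate matrix is $A_n(\theta_0)=\mathrm{diag}(a_{1,n}(\theta_0)I_{p_1},\dots,a_{K,n}(\theta_0)I_{p_K})$, where the $a_{k,n}(\theta)>0$ are deterministic functions of $\theta$ with $a_{k,n}(\theta_0)\to0$ (decreasing in $n$) and $a_{i,n}(\theta_0)/a_{j,n}(\theta_0)\to0$ for $i<j$. $\theta^i$ is the $i$th coordinate of $\theta$, $|A|=\det A$ for a square matrix $A$ inside a logarithm, $\lambda_{\min}$ denotes the smallest eigenvalue. Put $\Delta_n=A_n(\theta_0)\partial_\theta\mathbb{H}_n(\theta_0)$, $\Gamma_n(\theta)=-A_n(\theta_0)\partial_\theta^2\mathbb{H}_n(\theta)A_n(\theta_0)$, $\hat u_n=A_n(\theta_0)^{-1}(\hat\theta_n-\theta_0)$, $\mathbb{U}_n(\theta_0)=\{u\in\mathbb{R}^p:\theta_0+A_n(\theta_0)u\in\Theta\}$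 and $\mathbb{Z}_n(u)=\exp\{\mathbb{H}_n(\theta_0+A_n(\theta_0)u)-\mathbb{H}_n(\theta_0)\}$ for $u\in\mathbb{U}_n(\theta_0)$. (A3) For any $\epsilon>0$ there exist $M>0$ and $N$ such that $\sup_{n\ge N}\mathbb{P}\big(\int_{\mathbb{U}_n(\theta_0)\cap\{|u|\ge M\}}\mathbb{Z}_n(u)\,du>\epsilon\big)<\epsilon$. (B1) $\mathbb{H}_n$ is a.s. of class $\mathcal{C}^3(\Theta)$ and for every $r>0$, $$\sup_n\mathbb{E}\Big(|\Delta_n|^r+\sup_\theta|\Gamma_n(\theta)|^r+\sum_{i=1}^p\sup_\theta\big|A_n(\theta_0)\,\partial_{\theta^i}\partial_\theta^2\mathbb{H}_n(\theta)\,A_n(\theta_0)\big|^r\Big)<\infty$$ (here $|\cdot|$ is a norm). (B2) $\pi_n(\theta_0)>0$ for all $n$; $\sup_{|u|<M}|\pi_n(\theta_0+A_n(\theta_0)u)-\pi_n(\theta_0)|\to0$ as $n\to\infty$ for each $M>0$; and $0<\inf_{n,\theta}\pi_n(\theta)\le\sup_{n,\theta}\pi_n(\theta)<\infty$. (B3) There exists an a.s. positive definite random matrix $\Gamma_0$ such that $\Gamma_n(\theta_0)\to\Gamma_0$ in probability, and for some $q>3p$, $\limsup_n\mathbb{E}\big(\sup_\theta\lambda_{\min}^{-q}(\Gamma_n(\theta))\big)<\infty$. (B4) $\sup_n\mathbb{E}(|\hat u_n|^r)<\infty$ for some $r>3$. *)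

theory Defs
  imports "HOL-Probability.Probability"
begin

section \<open>Derivatives\<close>

definition pdiff :: "'n::finite \<Rightarrow> (real^'n \<Rightarrow> real) \<Rightarrow> real^'n \<Rightarrow> real" where
  "pdiff i f x = frechet_derivative f (at x) (axis i 1)"

text \<open>Meant for open sets only. Differentiability at each level together with continuity of
  all partial derivatives of the last order is the usual class of \<open>k\<close> times continuously
  differentiable functions.\<close>

primrec Ck_on :: "nat \<Rightarrow> (real^'n::finite \<Rightarrow> real) \<Rightarrow> (real^'n) set \<Rightarrow> bool" where
  "Ck_on 0 f S \<longleftrightarrow> continuous_on S f"
| "Ck_on (Suc k) f S \<longleftrightarrow> f differentiable_on S \<and> (\<forall>i. Ck_on k (pdiff i f) S)"

definition grad :: "(real^'n::finite \<Rightarrow> real) \<Rightarrow> real^'n \<Rightarrow> real^'n" where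
  "grad f x = (\<chi> i. pdiff i f x)"

definition hess :: "(real^'n::finite \<Rightarrow> real) \<Rightarrow> real^'n \<Rightarrow> real^'n^'n" where
  "hess f x = (\<chi> i j. pdiff i (pdiff j f) x)"

definition dhess :: "'n::finite \<Rightarrow> (real^'n \<Rightarrow> real) \<Rightarrow> real^'n \<Rightarrow> real^'n^'n" where
  "dhess i f x = (\<chi> j k. pdiff i (pdiff j (pdiff k f)) x)"

text \<open>The maximizer of the quasi-likelihood may lie on the boundary of the open set \<open>S\<close>, where the
  Hessian is understood as its continuous extension from \<open>S\<close>. The extension exists when \<open>S\<close> is
  convex and the third derivatives are bounded on \<open>S\<close>.\<close>

definition hess_cl :: "(real^'n::finite) set \<Rightarrow> (real^'n \<Rightarrow> real) \<Rightarrow> real^'n \<Rightarrow> real^'n^'n" where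
  "hess_cl S f x = (if x \<in> S then hess f x else Lim (at x within S) (hess f))"

section \<open>Symmetric matrices\<close>

definition pos_def_mat :: "real^'n^'n::finite \<Rightarrow> bool" where
  "pos_def_mat B \<longleftrightarrow> transpose B = B \<and> (\<forall>v. v \<noteq> 0 \<longrightarrow> 0 < v \<bullet> (B *v v))"

definition lambda_min :: "real^'n^'n::finite \<Rightarrow> real" where
  "lambda_min B = (LEAST l. \<exists>v. v \<noteq> 0 \<and> B *v v = l *\<^sub>R v)"

text \<open>The power \<open>x\<close> to the \<open>-q\<close> as an extended nonnegative number; it is infinite for \<open>x \<le> 0\<close>.
  (For \<open>x \<le> 0\<close> the real-valued \<open>powr\<close> would return meaningless finite values.)\<close>

definition neg_powr :: "real \<Rightarrow> real \<Rightarrow> ennreal" where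
  "neg_powr x q = (if 0 < x then ennreal (x powr (- q)) else \<infinity>)"

section \<open>Parameter space and rate matrix\<close>

text \<open>The \<open>p\<close> coordinates are indexed by the finite type \<open>'p\<close> and \<open>blk\<close> assigns to each
  coordinate its block, so that the \<open>k\<close>-th block has \<open>card {i. blk i = k}\<close> coordinates. The
  Euclidean space of the \<open>k\<close>-th block is represented by the coordinate subspace \<open>block_space blk k\<close>,
  and a domain in it by a relatively open subset of this subspace.\<close>

definition block_space :: "('p::finite \<Rightarrow> nat) \<Rightarrow> nat \<Rightarrow> (real^'p) set" where
  "block_space blk k = {x. \<forall>i. blk i \<noteq> k \<longrightarrow> x $ i = 0}"

definition block_proj :: "('p::finite \<Rightarrow> nat) \<Rightarrow> nat \<Rightarrow> real^'p \<Rightarrow> real^'p" where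
  "block_proj blk k x = (\<chi> i. if blk i = k then x $ i else 0)"

definition product_domain ::
  "('p::finite \<Rightarrow> nat) \<Rightarrow> nat \<Rightarrow> (nat \<Rightarrow> (real^'p) set) \<Rightarrow> (real^'p) set \<Rightarrow> bool" where
  "product_domain blk K T \<Theta> \<longleftrightarrow>
     blk ` UNIV = {1..K} \<and>
     (\<forall>k\<in>{1..K}. T k \<noteq> {} \<and> openin (top_of_set (block_space blk k)) (T k) \<and>
        convex (T k) \<and> bounded (T k)) \<and>
     \<Theta> = {\<theta>. \<forall>k\<in>{1..K}. block_proj blk k \<theta> \<in> T k}"

definition rate_matrix ::
  "('p::finite \<Rightarrow> nat) \<Rightarrow> (nat \<Rightarrow> nat \<Rightarrow> real^'p \<Rightarrow> real) \<Rightarrow> real^'p \<Rightarrow> nat \<Rightarrow> real^'p^'p" where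
  "rate_matrix blk a \<theta>0 n = (\<chi> i j. if i = j then a (blk i) n \<theta>0 else 0)"

definition rates ::
  "nat \<Rightarrow> (real^'p::finite) set \<Rightarrow> real^'p \<Rightarrow> (nat \<Rightarrow> nat \<Rightarrow> real^'p \<Rightarrow> real) \<Rightarrow> bool" where
  "rates K \<Theta> \<theta>0 a \<longleftrightarrow>
     (\<forall>k\<in>{1..K}. (\<forall>n. \<forall>\<theta>\<in>closure \<Theta>. 0 < a k n \<theta>) \<and>
        decseq (\<lambda>n. a k n \<theta>0) \<and> (\<lambda>n. a k n \<theta>0) \<longlonglongrightarrow> 0) \<and>
     (\<forall>i\<in>{1..K}. \<forall>j\<in>{1..K}. i < j \<longrightarrow> (\<lambda>n. a i n \<theta>0 / a j n \<theta>0) \<longlonglongrightarrow> 0)"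

section \<open>Quasi-likelihood, maximizer and prior\<close>

text \<open>\<open>H n \<omega> \<theta>\<close> is the quasi-log likelihood at \<open>\<theta>\<close>, evaluated at the data of stage \<open>n\<close>
  observed under the outcome \<open>\<omega>\<close>. Only its values for \<open>\<theta> \<in> closure \<Theta>\<close> matter.\<close>

definition quasi_loglik ::
  "'w measure \<Rightarrow> (real^'p::finite) set \<Rightarrow> (nat \<Rightarrow> 'w \<Rightarrow> real^'p \<Rightarrow> real) \<Rightarrow> bool" where
  "quasi_loglik M \<Theta> H \<longleftrightarrow>
     (\<forall>n. (\<forall>\<theta>\<in>\<Theta>. (\<lambda>\<omega>. H n \<omega> \<theta>) \<in> borel_measurable M) \<and>
          (AE \<omega> in M. continuous_on (closure \<Theta>) (H n \<omega>)))"

definition is_qmle ::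
  "'w measure \<Rightarrow> (real^'p::finite) set \<Rightarrow> (nat \<Rightarrow> 'w \<Rightarrow> real^'p \<Rightarrow> real) \<Rightarrow>
     (nat \<Rightarrow> 'w \<Rightarrow> real^'p) \<Rightarrow> bool" where
  "is_qmle M \<Theta> H \<theta>hat \<longleftrightarrow>
     (\<forall>n. \<theta>hat n \<in> borel_measurable M \<and>
          (AE \<omega> in M. is_arg_max (H n \<omega>) (\<lambda>\<theta>. \<theta> \<in> closure \<Theta>) (\<theta>hat n \<omega>)))"

text \<open>The prior is a density on \<open>\<Theta>\<close>, but it gets evaluated at the maximizer, which ranges
  over \<open>closure \<Theta>\<close>; hence it is taken to be given, measurable and positive there.\<close>

definition prior_density :: "(real^'p::finite) set \<Rightarrow> (nat \<Rightarrow> real^'p \<Rightarrow> real) \<Rightarrow> bool" where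
  "prior_density \<Theta> \<pi> \<longleftrightarrow>
     (\<forall>n. \<pi> n \<in> borel_measurable (restrict_space borel (closure \<Theta>)) \<and>
          (\<forall>\<theta>\<in>closure \<Theta>. 0 < \<pi> n \<theta>) \<and>
          (\<integral>\<^sup>+\<theta>\<in>\<Theta>. ennreal (\<pi> n \<theta>) \<partial>lborel) = 1)"

section \<open>Normalized quantities\<close>

definition Delta ::
  "(nat \<Rightarrow> real^'p^'p::finite) \<Rightarrow> (nat \<Rightarrow> 'w \<Rightarrow> real^'p \<Rightarrow> real) \<Rightarrow> real^'p \<Rightarrow> nat \<Rightarrow> 'w \<Rightarrow> real^'p" where
  "Delta A H \<theta>0 n \<omega> = A n *v grad (H n \<omega>) \<theta>0"

definition Gamma_mat ::
  "(nat \<Rightarrow> real^'p^'p::finite) \<Rightarrow> (nat \<Rightarrow> 'w \<Rightarrow> real^'p \<Rightarrow> real) \<Rightarrow> nat \<Rightarrow> 'w \<Rightarrow> real^'p \<Rightarrow> real^'p^'p" where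
  "Gamma_mat A H n \<omega> \<theta> = - (A n ** hess (H n \<omega>) \<theta> ** A n)"

definition u_hat ::
  "(nat \<Rightarrow> real^'p^'p::finite) \<Rightarrow> (nat \<Rightarrow> 'w \<Rightarrow> real^'p) \<Rightarrow> real^'p \<Rightarrow> nat \<Rightarrow> 'w \<Rightarrow> real^'p" where
  "u_hat A \<theta>hat \<theta>0 n \<omega> = matrix_inv (A n) *v (\<theta>hat n \<omega> - \<theta>0)"

definition local_space ::
  "(nat \<Rightarrow> real^'p^'p::finite) \<Rightarrow> (real^'p) set \<Rightarrow> real^'p \<Rightarrow> nat \<Rightarrow> (real^'p) set" where
  "local_space A \<Theta> \<theta>0 n = {u. \<theta>0 + A n *v u \<in> \<Theta>}"

definition Z_field ::
  "(nat \<Rightarrow> real^'p^'p::finite) \<Rightarrow> (nat \<Rightarrow> 'w \<Rightarrow> real^'p \<Rightarrow> real) \<Rightarrow> real^'p \<Rightarrow> nat \<Rightarrow> 'w \<Rightarrow> real^'p \<Rightarrow> real" where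
  "Z_field A H \<theta>0 n \<omega> u = exp (H n \<omega> (\<theta>0 + A n *v u) - H n \<omega> \<theta>0)"

section \<open>Conditions\<close>

text \<open>In the following, \<open>P\<close> is meant to be the completion of the underlying probability measure.
  Path properties of the quasi-likelihood hold only almost surely, so that the random variables and
  events derived from its paths are in general measurable only for the completion; the measure
  of a nonmeasurable set and the Bochner integral of a nonmeasurable function would be \<open>0\<close>.\<close>

definition conv_in_prob ::
  "'w measure \<Rightarrow> (nat \<Rightarrow> 'w \<Rightarrow> 'b::metric_space) \<Rightarrow> ('w \<Rightarrow> 'b) \<Rightarrow> bool" where
  "conv_in_prob P X Y \<longleftrightarrow>
     (\<forall>n. X n \<in> borel_measurable P) \<and> Y \<in> borel_measurable P \<and>
     (\<forall>\<epsilon>>0. (\<lambda>n. measure P {\<omega> \<in> space P. \<epsilon> < dist (X n \<omega>) (Y \<omega>)}) \<longlonglongrightarrow> 0)"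

definition cond_A3 ::
  "'w measure \<Rightarrow> (nat \<Rightarrow> real^'p^'p::finite) \<Rightarrow> (real^'p) set \<Rightarrow> (nat \<Rightarrow> 'w \<Rightarrow> real^'p \<Rightarrow> real) \<Rightarrow>
     real^'p \<Rightarrow> bool" where
  "cond_A3 P A \<Theta> H \<theta>0 \<longleftrightarrow>
     (\<forall>\<epsilon>>0. \<exists>R>0. \<exists>N. 
        (SUP n\<in>{N..}. measure P {\<omega> \<in> space P.
            ennreal \<epsilon> < (\<integral>\<^sup>+u\<in>local_space A \<Theta> \<theta>0 n \<inter> {u. R \<le> norm u}.
                           ennreal (Z_field A H \<theta>0 n \<omega> u) \<partial>lborel)}) < \<epsilon>)"

definition cond_B1 ::
  "'w measure \<Rightarrow> (nat \<Rightarrow> real^'p^'p::finite) \<Rightarrow> (real^'p) set \<Rightarrow> (nat \<Rightarrow> 'w \<Rightarrow> real^'p \<Rightarrow> real) \<Rightarrow>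
     real^'p \<Rightarrow> bool" where
  "cond_B1 P A \<Theta> H \<theta>0 \<longleftrightarrow>
     (\<forall>n. AE \<omega> in P. Ck_on 3 (H n \<omega>) \<Theta>) \<and>
     (\<forall>r>0. (SUP n. \<integral>\<^sup>+\<omega>. 
         ennreal (norm (Delta A H \<theta>0 n \<omega>) powr r)
         + (SUP \<theta>\<in>\<Theta>. ennreal (norm (Gamma_mat A H n \<omega> \<theta>) powr r))
         + (\<Sum>i\<in>UNIV. SUP \<theta>\<in>\<Theta>. ennreal (norm (A n ** dhess i (H n \<omega>) \<theta> ** A n) powr r))
       \<partial>P) < \<infinity>)"

definition cond_B2 ::
  "(nat \<Rightarrow> real^'p^'p::finite) \<Rightarrow> (real^'p) set \<Rightarrow> (nat \<Rightarrow> real^'p \<Rightarrow> real) \<Rightarrow> real^'p \<Rightarrow> bool" where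
  "cond_B2 A \<Theta> \<pi> \<theta>0 \<longleftrightarrow>
     (\<forall>n. 0 < \<pi> n \<theta>0) \<and>
     (\<forall>R>0. (\<lambda>n. SUP u\<in>local_space A \<Theta> \<theta>0 n \<inter> {u. norm u < R}.
                ennreal \<bar>\<pi> n (\<theta>0 + A n *v u) - \<pi> n \<theta>0\<bar>) \<longlonglongrightarrow> 0) \<and>
     0 < (INF n. INF \<theta>\<in>closure \<Theta>. ennreal (\<pi> n \<theta>)) \<and>
     (SUP n. SUP \<theta>\<in>closure \<Theta>. ennreal (\<pi> n \<theta>)) < \<infinity>"

definition cond_B3 ::
  "'w measure \<Rightarrow> (nat \<Rightarrow> real^'p^'p::finite) \<Rightarrow> (real^'p) set \<Rightarrow> (nat \<Rightarrow> 'w \<Rightarrow> real^'p \<Rightarrow> real) \<Rightarrow>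
     real^'p \<Rightarrow> bool" where
  "cond_B3 P A \<Theta> H \<theta>0 \<longleftrightarrow>
     (\<exists>\<Gamma>0. (AE \<omega> in P. pos_def_mat (\<Gamma>0 \<omega>)) \<and>
        conv_in_prob P (\<lambda>n \<omega>. Gamma_mat A H n \<omega> \<theta>0) \<Gamma>0) \<and>
     (\<exists>q. 3 * real CARD('p) < q \<and>
        limsup (\<lambda>n. \<integral>\<^sup>+\<omega>. (SUP \<theta>\<in>\<Theta>. neg_powr (lambda_min (Gamma_mat A H n \<omega> \<theta>)) q) \<partial>P) < \<infinity>)"

definition cond_B4 ::
  "'w measure \<Rightarrow> (nat \<Rightarrow> real^'p^'p::finite) \<Rightarrow> (nat \<Rightarrow> 'w \<Rightarrow> real^'p) \<Rightarrow> real^'p \<Rightarrow> bool" where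
  "cond_B4 P A \<theta>hat \<theta>0 \<longleftrightarrow>
     (\<exists>r>3. (SUP n. \<integral>\<^sup>+\<omega>. ennreal (norm (u_hat A \<theta>hat \<theta>0 n \<omega>) powr r) \<partial>P) < \<infinity>)"

section \<open>Quasi-marginal likelihood and information criterion\<close>

definition quasi_marginal ::
  "(real^'p::finite) set \<Rightarrow> (nat \<Rightarrow> 'w \<Rightarrow> real^'p \<Rightarrow> real) \<Rightarrow> (nat \<Rightarrow> real^'p \<Rightarrow> real) \<Rightarrow>
     nat \<Rightarrow> 'w \<Rightarrow> real" where
  "quasi_marginal \<Theta> H \<pi> n \<omega> = (LINT \<theta>:\<Theta>|lborel. exp (H n \<omega> \<theta>) * \<pi> n \<theta>)"

definition QBIC_sharp ::
  "(real^'p::finite) set \<Rightarrow> (nat \<Rightarrow> 'w \<Rightarrow> real^'p \<Rightarrow> real) \<Rightarrow> (nat \<Rightarrow> real^'p \<Rightarrow> real) \<Rightarrow>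
     (nat \<Rightarrow> 'w \<Rightarrow> real^'p) \<Rightarrow> nat \<Rightarrow> 'w \<Rightarrow> real" where
  "QBIC_sharp \<Theta> H \<pi> \<theta>hat n \<omega> =
     - 2 * H n \<omega> (\<theta>hat n \<omega>)
     + ln (det (- hess_cl \<Theta> (H n \<omega>) (\<theta>hat n \<omega>)))
     - 2 * ln (\<pi> n (\<theta>hat n \<omega>))
     - real CARD('p) * ln (2 * pi)"

end

theory Submission
  imports Defs
begin

text \<open>Put \<open>\<theta> = \<theta>hat + A u\<close> in the marginal likelihood. The determinant of the rate matrix cancels against
  the one in the Hessian term, and the difference in the theorem becomes \<open>- 2 ln J - ln (det Ghat)
  + 2 ln (\<pi> \<theta>hat) + p ln (2 pi)\<close>, where \<open>Ghat\<close> is the normalized Hessian at the maximizer and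
  \<open>J\<close> the rescaled integral. Fix bounds \<open>d\<close>, \<open>S\<close>, \<open>\<tau>\<close> for the normalized derivatives of order
  one, two and three, and a lower bound \<open>l\<close> for the eigenvalues of the normalized negative Hessian.
  Strong concavity makes \<open>J\<close> at most a Gaussian integral, even when the maximizer lies on the boundary,
  and a quadratic minorant at \<open>\<theta>0\<close> bounds it below; so the difference is
  \<open>O(1 + d + S + d\<^sup>2 / l + 1 / l)\<close>. Dominated convergence (Laplace's method) shows that it tends to zero
  uniformly as long as \<open>d\<close>, \<open>S\<close>, \<open>\<tau>\<close> and \<open>1 / l\<close> stay bounded. The moment conditions provide
  a random variable \<open>X\<close> with bounded expectation for which these bounds are small powers of \<open>X\<close>, and
  the difference is \<open>O(sqrt X)\<close>: on \<open>X \<le> m\<close> it is uniformly small, and on \<open>X > m\<close> it is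
  \<open>O(X / sqrt m)\<close>, which has small expectation.\<close>

section \<open>Linear change of variables\<close>

text \<open>The analysis is deterministic: a likelihood function enters only through
  \<open>d\<close>, \<open>S\<close>, \<open>\<tau>\<close> and \<open>l\<close>, and randomness
  returns only through \<open>X\<close>. Uniformity of the Laplace step comes by contradiction:
  functions violating it at ever later stages form a sequence to which dominated convergence
  applies.

  The exponents are dictated by the term \<open>d\<^sup>2 / l\<close>. With \<open>d\<close> the
  12th root and \<open>1 / l\<close> the \<open>q\<close>-th root of \<open>X \<ge> 1\<close>, where
  \<open>q \<ge> 3\<close>, it is at most X to the power 1/6 + 1/3 = 1/2.

  At a maximizer on the boundary the gradient need not vanish and the Hessian is only a limit.
  Global upper bounds therefore use concavity along segments entering the domain, and the Hessian is
  extended by Lipschitz continuity. The Taylor expansion at the maximizer is used only where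
  \<open>X\<close> is bounded: there the normalized maximizer is at most \<open>2 * d / l\<close>,
  so vanishing rates eventually push the maximizer into the open domain.

  Suprema over the uncountable domain are replaced by suprema over a countable dense subset, which
  are measurable and carry the same bounds by continuity.\<close>

lemma nn_integral_lborel_translate:
  fixes f :: "'a::euclidean_space \<Rightarrow> ennreal"
  assumes [measurable]: "f \<in> borel_measurable borel"
  shows "(\<integral>\<^sup>+x. f (c + x) \<partial>lborel) = (\<integral>\<^sup>+x. f x \<partial>lborel)"
proof -
  have "(\<integral>\<^sup>+x. f x \<partial>lborel) = (\<integral>\<^sup>+x. f x \<partial>distr lborel borel ((+) c))"
    by (simp add: lborel_distr_plus)
  also have "\<dots> = (\<integral>\<^sup>+x. f (c + x) \<partial>lborel)"
    by (subst nn_integral_distr) auto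
  finally show ?thesis ..
qed

text \<open>Fubini with the coordinate along \<open>b\<close> innermost: the coordinate along
  \<open>c\<close> is then fixed, so the shear acts on the inner integral as a translation by
  \<open>y c\<close>.\<close>

lemma nn_integral_lborel_shear:
  fixes f :: "'a::euclidean_space \<Rightarrow> ennreal"
  assumes [measurable]: "f \<in> borel_measurable borel" and b: "b \<in> Basis" and c: "c \<in> Basis" and bc: "b \<noteq> c"
  shows "(\<integral>\<^sup>+x. f (x + (x \<bullet> c) *\<^sub>R b) \<partial>lborel) = (\<integral>\<^sup>+x. f x \<partial>lborel)"
proof -
  interpret product_sigma_finite "\<lambda>_::'a. lborel :: real measure" ..
  define I where "I = (Basis - {b} :: 'a set)"
  have I: "finite I" "b \<notin> I" "c \<in> I" "insert b I = Basis"
    using b c bc by (auto simp: I_def)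
  have P: "(\<integral>\<^sup>+x. g x \<partial>lborel) =
      (\<integral>\<^sup>+y. (\<integral>\<^sup>+s. g (s *\<^sub>R b + (\<Sum>i\<in>I. y i *\<^sub>R i)) \<partial>lborel) \<partial>(\<Pi>\<^sub>M i\<in>I. lborel))"
    if [measurable]: "g \<in> borel_measurable borel" for g :: "'a \<Rightarrow> ennreal"
  proof -
    have "(\<integral>\<^sup>+x. g x \<partial>lborel) = (\<integral>\<^sup>+y. g (\<Sum>i\<in>insert b I. y i *\<^sub>R i) \<partial>(\<Pi>\<^sub>M i\<in>insert b I. lborel))"
      by (subst lborel_eq, subst nn_integral_distr) (simp_all add: I)
    also have "\<dots> = (\<integral>\<^sup>+y. (\<integral>\<^sup>+s. g (\<Sum>i\<in>insert b I. (y(b:=s)) i *\<^sub>R i) \<partial>lborel) \<partial>(\<Pi>\<^sub>M i\<in>I. lborel))"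
      using I by (subst product_nn_integral_insert) simp_all
    also have "\<dots> = (\<integral>\<^sup>+y. (\<integral>\<^sup>+s. g (s *\<^sub>R b + (\<Sum>i\<in>I. y i *\<^sub>R i)) \<partial>lborel) \<partial>(\<Pi>\<^sub>M i\<in>I. lborel))"
    proof -
      have "(\<Sum>i\<in>insert b I. (y(b:=s)) i *\<^sub>R i) = s *\<^sub>R b + (\<Sum>i\<in>I. y i *\<^sub>R i)" for y s
      unfolding sum.insert[OF I(1,2)] by (auto intro!: sum.cong simp: I(2))
      then show ?thesis by (simp only:)
    qed
    finally show ?thesis .
  qed
  have eq: "(s *\<^sub>R b + (\<Sum>i\<in>I. y i *\<^sub>R i)) + ((s *\<^sub>R b + (\<Sum>i\<in>I. y i *\<^sub>R i)) \<bullet> c) *\<^sub>R b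
      = (y c + s) *\<^sub>R b + (\<Sum>i\<in>I. y i *\<^sub>R i)" for s y
  proof -
    have "(\<Sum>i\<in>I. y i *\<^sub>R i) \<bullet> c = (\<Sum>i\<in>I. if i = c then y c else 0)"
      unfolding inner_sum_left
      by (rule sum.cong) (use c in \<open>auto simp: inner_Basis I_def\<close>)
    also have "\<dots> = y c" using I by simp
    finally show ?thesis using b c bc by (simp add: inner_left_distrib inner_Basis algebra_simps)
  qed
  show ?thesis
    apply (subst P)
     apply measurable
    apply (subst eq)
    apply (subst P)
     apply measurable
    apply (rule nn_integral_cong)
    subgoal for y
      by (rule nn_integral_lborel_translate[of "\<lambda>s. f (s *\<^sub>R b + (\<Sum>i\<in>I. y i *\<^sub>R i))" "y c"]) measurable
    done
qed

lemma borel_measurable_matrix_vector_mult [measurable]: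
  "(\<lambda>x. A *v x :: real^'n::finite) \<in> borel_measurable (borel :: (real^'m::finite) measure)"
  by (intro borel_measurable_continuous_onI linear_continuous_on matrix_vector_mul_bounded_linear)

text \<open>The change of variables theorems of the library need a well-ordered index type.\<close>

lemma nn_integral_lborel_linear:
  fixes A :: "real^'n^'n::finite" and f :: "real^'n \<Rightarrow> ennreal"
  assumes "det A \<noteq> 0" and "f \<in> borel_measurable borel"
  shows "ennreal \<bar>det A\<bar> * (\<integral>\<^sup>+x. f (A *v x) \<partial>lborel) = (\<integral>\<^sup>+x. f x \<partial>lborel)"
proof -
  \<comment> \<open>Keeping \<open>det A \<noteq> 0\<close> inside the property makes the zero-row
    case vacuous; quantifying over \<open>f\<close> lets the product case use the hypothesis for
    \<open>B\<close> on the function \<open>f\<close> composed with \<open>A\<close>.\<close>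
  have "det A \<noteq> 0 \<longrightarrow> (\<forall>f \<in> borel_measurable borel.
      ennreal \<bar>det A\<bar> * (\<integral>\<^sup>+x. f (A *v x) \<partial>lborel) = (\<integral>\<^sup>+x. f x \<partial>lborel))" (is "?P A")
  proof (rule induct_matrix_elementary_alt)
    fix A B :: "real^'n^'n"
    assume A: "?P A" and B: "?P B"
    show "?P (A ** B)"
    proof (intro impI ballI)
      fix f :: "real^'n \<Rightarrow> ennreal" assume [measurable]: "f \<in> borel_measurable borel" and d: "det (A ** B) \<noteq> 0"
      have "ennreal \<bar>det (A ** B)\<bar> * (\<integral>\<^sup>+x. f ((A ** B) *v x) \<partial>lborel) =
        ennreal \<bar>det A\<bar> * (ennreal \<bar>det B\<bar> * (\<integral>\<^sup>+x. (\<lambda>y. f (A *v y)) (B *v x) \<partial>lborel))"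
        by (simp add: det_mul abs_mult ennreal_mult mult.assoc matrix_vector_mul_assoc)
      also have "ennreal \<bar>det B\<bar> * (\<integral>\<^sup>+x. (\<lambda>y. f (A *v y)) (B *v x) \<partial>lborel) = (\<integral>\<^sup>+x. f (A *v x) \<partial>lborel)"
        using B d by (auto simp: det_mul)
      finally show "ennreal \<bar>det (A ** B)\<bar> * (\<integral>\<^sup>+x. f ((A ** B) *v x) \<partial>lborel) = (\<integral>\<^sup>+x. f x \<partial>lborel)"
        using A d by (auto simp: det_mul)
    qed
  next
    fix A :: "real^'n^'n" and i
    assume "row i A = 0"
    then show "?P A" by (simp add: det_zero_row)
  next
    fix A :: "real^'n^'n" assume A: "\<And>i j. i \<noteq> j \<Longrightarrow> A $ i $ j = 0"
    show "?P A"
    proof (intro impI ballI)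
      fix f :: "real^'n \<Rightarrow> ennreal" assume f [measurable]: "f \<in> borel_measurable borel" and d: "det A \<noteq> 0"
      define c where "c j = A $ (axis_index j) $ (axis_index j)" for j :: "real^'n"
      have dA: "det A = (\<Prod>i\<in>UNIV. A $ i $ i)" using A by (rule det_diagonal)
      have bij: "bij_betw (\<lambda>i. axis i (1::real)) (UNIV::'n set) Basis"
        by (auto simp: bij_betw_def inj_on_def axis_eq_axis Basis_vec_def)
      have pc: "(\<Prod>j\<in>Basis. \<bar>c j\<bar>) = \<bar>det A\<bar>"
        unfolding prod.reindex_bij_betw[OF bij, symmetric]
        by (simp add: c_def axis_index_axis dA abs_prod)
      \<comment> \<open>The leading \<open>0\<close> is the translation part of
        \<open>lborel_affine_euclidean\<close>, taken with \<open>t=0\<close>.\<close>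
      have Ax: "0 + (\<Sum>j\<in>Basis. (c j * (x \<bullet> j)) *\<^sub>R j) = A *v x" for x
      proof -
        have "(\<Sum>j\<in>Basis. (c j * (x \<bullet> j)) *\<^sub>R j) = (\<Sum>i\<in>UNIV. (A $ i $ i * x $ i) *\<^sub>R axis i 1)"
          unfolding sum.reindex_bij_betw[OF bij, symmetric]
          by (simp add: c_def axis_index_axis inner_axis)
        also have "\<dots> = A *v x"
        proof (simp add: vec_eq_iff matrix_vector_mult_def axis_def, intro allI)
          fix i show "(\<Sum>ia\<in>UNIV. A $ ia $ ia * x $ ia * (if i = ia then 1 else 0)) = (\<Sum>j\<in>UNIV. A $ i $ j * x $ j)"
            by (rule sum.cong) (use A in auto)
        qed
        finally show ?thesis by simp
      qed
      have nz: "c j \<noteq> 0" if "j \<in> Basis" for j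
      proof
        assume "c j = 0"
        with that have "(\<Prod>j\<in>Basis. \<bar>c j\<bar>) = 0" by (intro prod_zero) auto
        with pc d show False by simp
      qed
      have "(lborel :: (real^'n) measure) = density (distr lborel borel (\<lambda>x. A *v x)) (\<lambda>_. (\<Prod>j\<in>Basis. \<bar>c j\<bar>))"
        using lborel_affine_euclidean[where c=c and t=0, OF nz] unfolding Ax by simp
      then have "(\<integral>\<^sup>+x. f x \<partial>lborel) = (\<integral>\<^sup>+x. f x \<partial>density (distr lborel borel (\<lambda>x. A *v x)) (\<lambda>_. (\<Prod>j\<in>Basis. \<bar>c j\<bar>)))"
        by simp
      also have "\<dots> = ennreal \<bar>det A\<bar> * (\<integral>\<^sup>+x. f (A *v x) \<partial>lborel)"
        unfolding pc by (subst nn_integral_density) (simp_all add: nn_integral_distr nn_integral_cmult)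
      finally show "ennreal \<bar>det A\<bar> * (\<integral>\<^sup>+x. f (A *v x) \<partial>lborel) = (\<integral>\<^sup>+x. f x \<partial>lborel)" ..
    qed
  next
    fix m n :: 'n assume mn: "m \<noteq> n"
    let ?t = "Transposition.transpose m n"
    let ?A = "(\<chi> i j. mat 1 $ i $ ?t j) :: real^'n^'n"
    have Ax: "?A *v x = (\<chi> i. x $ ?t i)" for x
    proof (simp add: vec_eq_iff matrix_vector_mult_def mat_def, intro allI)
      fix i
      have "(\<Sum>j\<in>UNIV. (if i = ?t j then 1 else 0) * x $ j) = (\<Sum>j\<in>UNIV. if j = ?t i then x $ ?t i else 0)"
        by (rule sum.cong) (auto simp: transpose_eq_iff)
      then show "(\<Sum>j\<in>UNIV. (if i = ?t j then 1 else 0) * x $ j) = x $ ?t i" by simp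
    qed
    have dA: "\<bar>det ?A\<bar> = 1"
      by (subst det_permute_columns) (auto simp: permutes_swap_id sign_def)
    have [measurable]: "(\<lambda>x::real^'n. \<chi> i. x $ ?t i) \<in> borel_measurable borel"
    proof -
      have "(\<lambda>x. ?A *v x) \<in> borel_measurable borel" by (rule borel_measurable_matrix_vector_mult)
      then show ?thesis by (simp only: Ax)
    qed
    \<comment> \<open>Lebesgue measure is determined by its values on boxes, and permuting
      coordinates turns a box into one with the same side lengths in another order.\<close>
    have "(lborel :: (real^'n) measure) = distr lborel borel (\<lambda>x. \<chi> i. x $ ?t i)"
    proof (rule lborel_eqI)
      fix l u :: "real^'n" assume le: "\<And>b. b \<in> Basis \<Longrightarrow> l \<bullet> b \<le> u \<bullet> b"
      have le': "l $ i \<le> u $ i" for i using le[of "axis i 1"] by (simp add: inner_axis)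
      have eq: "(\<lambda>x. \<chi> i. x $ ?t i) -` box l u = box (\<chi> i. l $ ?t i) (\<chi> i. u $ ?t i)"
      proof (rule set_eqI)
        fix x :: "real^'n"
        have all: "(\<forall>i. Q i) \<longleftrightarrow> (\<forall>i. Q (?t i))" for Q :: "'n \<Rightarrow> bool"
          by (metis transpose_involutory)
        show "x \<in> (\<lambda>x. \<chi> i. x $ ?t i) -` box l u \<longleftrightarrow> x \<in> box (\<chi> i. l $ ?t i) (\<chi> i. u $ ?t i)"
          unfolding vimage_eq mem_box_cart vec_lambda_beta
          by (subst all) (simp only: transpose_involutory)
      qed
      have bij: "bij_betw (\<lambda>i. axis i (1::real)) (UNIV::'n set) Basis"
        by (auto simp: bij_betw_def inj_on_def axis_eq_axis Basis_vec_def)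
      have pr: "(\<Prod>b\<in>Basis. v \<bullet> b) = (\<Prod>i\<in>UNIV. v $ i)" for v :: "real^'n"
        unfolding prod.reindex_bij_betw[OF bij, symmetric] by (simp add: inner_axis)
      have "emeasure (distr lborel borel (\<lambda>x. \<chi> i. x $ ?t i)) (box l u) = emeasure lborel (box (\<chi> i. l $ ?t i) (\<chi> i. u $ ?t i))"
        by (subst emeasure_distr) (simp_all add: eq)
      also have "\<dots> = ennreal (\<Prod>b\<in>Basis. ((\<chi> i. u $ ?t i) - (\<chi> i. l $ ?t i)) \<bullet> b)"
        by (rule emeasure_lborel_box) (auto simp: Basis_vec_def inner_axis le')
      also have "(\<Prod>b\<in>Basis. ((\<chi> i. u $ ?t i) - (\<chi> i. l $ ?t i)) \<bullet> b) = (\<Prod>i\<in>UNIV. (u - l) $ ?t i)"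
        unfolding pr by simp
      also have "\<dots> = (\<Prod>i\<in>UNIV. (u - l) $ i)"
        by (rule prod.reindex_bij_betw) (rule bij_transpose)
      finally show "emeasure (distr lborel borel (\<lambda>x. \<chi> i. x $ ?t i)) (box l u) = (\<Prod>b\<in>Basis. (u - l) \<bullet> b)"
        unfolding pr .
    qed simp
    then have L: "(\<integral>\<^sup>+x. f x \<partial>lborel) = (\<integral>\<^sup>+x. f x \<partial>distr lborel borel (\<lambda>x::real^'n. \<chi> i. x $ ?t i))" for f :: "real^'n \<Rightarrow> ennreal"
      by simp
    show "?P ?A"
    proof (intro impI ballI)
      fix f :: "real^'n \<Rightarrow> ennreal" assume [measurable]: "f \<in> borel_measurable borel"
      have "(\<integral>\<^sup>+x. f x \<partial>lborel) = (\<integral>\<^sup>+x. f (?A *v x) \<partial>lborel)"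
        unfolding Ax by (subst L) (simp add: nn_integral_distr)
      then show "ennreal \<bar>det ?A\<bar> * (\<integral>\<^sup>+x. f (?A *v x) \<partial>lborel) = (\<integral>\<^sup>+x. f x \<partial>lborel)"
        unfolding dA by simp
    qed
  next
    fix m n :: 'n assume mn: "m \<noteq> n"
    let ?A = "(\<chi> i j. of_bool (i = m \<and> j = n \<or> i = j)) :: real^'n^'n"
    have Ax: "?A *v x = x + (x \<bullet> axis n 1) *\<^sub>R axis m 1" for x
    proof -
      have "(\<Sum>j\<in>UNIV. of_bool (i = m \<and> j = n \<or> i = j) * x $ j) = x $ i + (if i = m then x $ n else 0)" for i
      proof -
        have "(\<Sum>j\<in>UNIV. of_bool (i = m \<and> j = n \<or> i = j) * x $ j) =
          (\<Sum>j\<in>UNIV. (if j = i then x $ j else 0) + (if j = n then (if i = m then x $ j else 0) else 0))"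
          by (rule sum.cong) (use mn in auto)
        then show ?thesis by (simp add: sum.distrib)
      qed
      moreover have "x \<bullet> axis n 1 = x $ n" by (simp add: inner_axis)
      ultimately show ?thesis
        by (simp add: vec_eq_iff matrix_vector_mult_def axis_def)
    qed
    have "?A = (\<chi> k. if k = m then row m (mat 1) + 1 *s row n (mat 1) else row k (mat 1))"
      using mn by (auto simp: vec_eq_iff row_def mat_def)
    then have dA: "det ?A = 1"
      using det_row_operation[OF mn, of "mat 1" "1::real"] by simp
    show "?P ?A"
      unfolding dA unfolding Ax
      using mn by (auto simp: axis_eq_axis intro!: nn_integral_lborel_shear)
  qed
  with assms show ?thesis by blast
qed

text \<open>The measure form of the substitution rule also transfers Bochner integrals; the shift
  \<open>c\<close> will be the maximizer.\<close>

lemma lborel_linear: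
  fixes A :: "real^'n^'n::finite"
  assumes "det A \<noteq> 0"
  shows "lborel = density (distr lborel borel (\<lambda>x. c + A *v x)) (\<lambda>_. ennreal \<bar>det A\<bar>)" (is "_ = ?D")
proof (rule measure_eqI)
  fix X :: "(real^'n) set" assume "X \<in> sets lborel"
  then have [measurable]: "X \<in> sets borel" by simp
  have "emeasure lborel X = (\<integral>\<^sup>+x. indicator X x \<partial>lborel)" by simp
  also have "\<dots> = (\<integral>\<^sup>+x. indicator X (c + x) \<partial>lborel)"
    by (rule nn_integral_lborel_translate[symmetric]) simp
  also have "\<dots> = ennreal \<bar>det A\<bar> * (\<integral>\<^sup>+x. indicator X (c + A *v x) \<partial>lborel)"
    by (rule nn_integral_lborel_linear[OF assms, symmetric]) measurable
  also have "\<dots> = emeasure ?D X"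
    by (subst emeasure_density) (simp_all add: nn_integral_cmult nn_integral_distr flip: nn_integral_indicator)
  finally show "emeasure lborel X = emeasure ?D X" .
qed simp

section \<open>Quadratic forms and Gaussian integrals\<close>

text \<open>The norm of a matrix as a vector of rows is the Frobenius norm, so Cauchy-Schwarz in
  each row suffices.\<close>

lemma norm_matrix_vector_le:
  fixes B :: "real^'n^'m"
  shows "norm (B *v u) \<le> norm B * norm u"
proof -
  have "norm (B *v u) = L2_set (\<lambda>i. \<bar>B $ i \<bullet> u\<bar>) UNIV"
    by (simp add: norm_vec_def matrix_vector_mul_component)
  also have "\<dots> \<le> L2_set (\<lambda>i. norm (B $ i) * norm u) UNIV"
    by (rule L2_set_mono) (auto intro: Cauchy_Schwarz_ineq2)
  also have "\<dots> = norm B * norm u"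
    by (simp add: norm_vec_def L2_set_left_distrib)
  finally show ?thesis .
qed

lemma quadratic_form_le_norm:
  fixes B :: "real^'n^'n"
  shows "\<bar>u \<bullet> (B *v v)\<bar> \<le> norm B * norm u * norm v"
proof -
  have "\<bar>u \<bullet> (B *v v)\<bar> \<le> norm u * norm (B *v v)" by (rule Cauchy_Schwarz_ineq2)
  also have "\<dots> \<le> norm u * (norm B * norm v)" by (intro mult_left_mono norm_matrix_vector_le) simp
  finally show ?thesis by (simp add: mult_ac)
qed

lemma inner_matrix_sym:
  fixes B :: "real^'n^'n"
  assumes "transpose B = B"
  shows "u \<bullet> (B *v v) = v \<bullet> (B *v u)"
  using dot_lmul_matrix[of u B v] transpose_matrix_vector[of B u] assms by (simp add: inner_commute)

text \<open>The \<open>LEAST\<close> in \<open>lambda_min\<close> is informative only once a least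
  eigenvalue is known to exist. The minimum \<open>m\<close> of the quadratic form on the unit
  sphere is one: the shifted form given by \<open>C\<close> is nonnegative and vanishes at the
  minimizer \<open>v0\<close>, and a small step from \<open>v0\<close> against \<open>C v0\<close>
  would make it negative unless \<open>C v0 = 0\<close>.\<close>

lemma lambda_min_props:
  fixes B :: "real^'n::finite^'n"
  assumes sym: "transpose B = B"
  shows lambda_min_quadratic_form: "lambda_min B * (norm v)\<^sup>2 \<le> v \<bullet> (B *v v)"
    and lambda_min_greatest: "(\<And>v. c * (norm v)\<^sup>2 \<le> v \<bullet> (B *v v)) \<Longrightarrow> c \<le> lambda_min B"
proof -
  have cont: "continuous_on (sphere 0 1) (\<lambda>v. v \<bullet> (B *v v))"
    by (intro continuous_intros linear_continuous_on matrix_vector_mul_bounded_linear)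
  have ne: "sphere (0::real^'n) 1 \<noteq> {}" by simp
  obtain v0 where v0: "norm v0 = 1" and min: "\<And>v. norm v = 1 \<Longrightarrow> v0 \<bullet> (B *v v0) \<le> v \<bullet> (B *v v)"
    using continuous_attains_inf[OF compact_sphere ne cont] by auto
  define m where "m = v0 \<bullet> (B *v v0)"
  have quad: "m * (norm v)\<^sup>2 \<le> v \<bullet> (B *v v)" for v
  proof (cases "v = 0")
    case False
    have "m \<le> (v /\<^sub>R norm v) \<bullet> (B *v (v /\<^sub>R norm v))"
      unfolding m_def using False by (intro min) simp
    then show ?thesis
      using False by (simp add: matrix_vector_mult_scaleR field_simps power2_eq_square)
  qed simp
  define C where "C v = B *v v - m *\<^sub>R v" for v
  have Cadd: "C (x + t *\<^sub>R y) = C x + t *\<^sub>R C y" for x y t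
    by (simp add: C_def matrix_vector_mult_scaleR matrix_vector_right_distrib algebra_simps)
  have Csym: "x \<bullet> C y = y \<bullet> C x" for x y
    by (simp add: C_def inner_diff_right inner_matrix_sym[OF sym, of x y] inner_commute)
  have Cpos: "0 \<le> x \<bullet> C x" for x
    using quad[of x] by (simp only: C_def inner_diff_right power2_norm_eq_inner inner_scaleR_right diff_ge_0_iff_ge)
  have C0: "v0 \<bullet> C v0 = 0"
    using v0 power2_norm_eq_inner[of v0] by (simp add: C_def inner_diff_right m_def)
  have "C v0 = 0"
  proof (rule ccontr)
    assume "C v0 \<noteq> 0"
    define w where "w = C v0"
    define a where "a = w \<bullet> w"
    define b where "b = w \<bullet> C w"
    have a: "a > 0" using \<open>C v0 \<noteq> 0\<close> by (simp add: a_def w_def)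
    have b: "b \<ge> 0" using Cpos by (simp add: b_def)
    \<comment> \<open>This step width gives \<open>s * b < a\<close>, against the inequality
      \<open>2 * a \<le> s * b\<close> derived below; the added one covers
      \<open>b = 0\<close>.\<close>
    define s where "s = a / (b + 1)"
    have s: "s > 0" using a b by (simp add: s_def)
    have "0 \<le> (v0 + (- s) *\<^sub>R w) \<bullet> C (v0 + (- s) *\<^sub>R w)" by (rule Cpos)
    also have "\<dots> = v0 \<bullet> C v0 - s * (v0 \<bullet> C w + w \<bullet> C v0) + s * s * (w \<bullet> C w)"
      unfolding Cadd by (simp add: inner_add_left inner_add_right inner_diff_left inner_diff_right algebra_simps)
    also have "\<dots> = s * (s * b - 2 * a)"
      using Csym[of v0 w] by (simp add: C0 a_def b_def algebra_simps w_def)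
    finally have "2 * a \<le> s * b" using s by (simp add: zero_le_mult_iff)
    then have "2 * a * (b + 1) \<le> a * b" using b by (simp add: s_def field_simps)
    then have "a * (b + 2) \<le> 0" by (simp add: algebra_simps)
    then show False using a b by (simp add: mult_le_0_iff)
  qed
  then have ev: "\<exists>v. v \<noteq> 0 \<and> B *v v = m *\<^sub>R v"
    using v0 by (intro exI[of _ v0]) (auto simp: C_def)
  have "lambda_min B = m"
    unfolding lambda_min_def
  proof (rule Least_equality)
    fix l assume "\<exists>v. v \<noteq> 0 \<and> B *v v = l *\<^sub>R v"
    then obtain v where v: "v \<noteq> 0" "B *v v = l *\<^sub>R v" by auto
    have "m * (norm v)\<^sup>2 \<le> l * (norm v)\<^sup>2"
      using quad[of v] v by (simp add: power2_norm_eq_inner)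
    then show "m \<le> l" using v by simp
  qed (rule ev)
  then show "lambda_min B * (norm v)\<^sup>2 \<le> v \<bullet> (B *v v)" using quad by simp
  assume "\<And>v. c * (norm v)\<^sup>2 \<le> v \<bullet> (B *v v)"
  from this[of v0] show "c \<le> lambda_min B" using v0 \<open>lambda_min B = m\<close> by (simp add: m_def)
qed

text \<open>Gram-Schmidt for the inner product given by \<open>B\<close>, one coordinate at a time.
  The support condition ensures that the next axis vector keeps its coordinate \<open>k\<close>
  equal to one after the projections are subtracted, so it does not vanish.\<close>

lemma pos_def_orthonormal_family:
  fixes B :: "real^'n::finite^'n"
  assumes sym: "transpose B = B" and pos: "\<And>v. v \<noteq> 0 \<Longrightarrow> 0 < v \<bullet> (B *v v)" and "finite S"
  shows "\<exists>w::'n \<Rightarrow> real^'n. (\<forall>i\<in>S. \<forall>j\<in>S. w i \<bullet> (B *v w j) = of_bool (i = j)) \<and> (\<forall>i\<in>S. \<forall>k. k \<notin> S \<longrightarrow> w i $ k = 0)"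
  using \<open>finite S\<close>
proof (induction S)
  case (insert k S)
  from insert.IH obtain w :: "'n \<Rightarrow> real^'n"
    where w: "\<And>i j. i \<in> S \<Longrightarrow> j \<in> S \<Longrightarrow> w i \<bullet> (B *v w j) = of_bool (i = j)"
      and w0: "\<And>i k. i \<in> S \<Longrightarrow> k \<notin> S \<Longrightarrow> w i $ k = 0" by blast
  define e where "e = (axis k 1 :: real^'n)"
  define v where "v = e - (\<Sum>i\<in>S. (w i \<bullet> (B *v e)) *\<^sub>R w i)"
  have vk: "v $ k = 1" using insert.hyps w0 by (simp add: v_def e_def)
  then have "v \<noteq> 0" by auto
  define c where "c = v \<bullet> (B *v v)"
  have c: "c > 0" unfolding c_def using \<open>v \<noteq> 0\<close> by (rule pos)
  have orth: "w j \<bullet> (B *v v) = 0" if "j \<in> S" for j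
  proof -
    have "w j \<bullet> (B *v v) = w j \<bullet> (B *v e) - (\<Sum>i\<in>S. (w i \<bullet> (B *v e)) * (w j \<bullet> (B *v w i)))"
      by (simp add: v_def matrix_vector_mult_diff_distrib vec.sum inner_diff_right inner_sum_right
          matrix_vector_mult_scaleR sum_distrib_left linear_sum[OF matrix_vector_mul_linear])
    also have "(\<Sum>i\<in>S. (w i \<bullet> (B *v e)) * (w j \<bullet> (B *v w i))) = (\<Sum>i\<in>S. if i = j then w i \<bullet> (B *v e) else 0)"
      by (rule sum.cong) (use that w in auto)
    also have "\<dots> = w j \<bullet> (B *v e)" using insert.hyps that by simp
    finally show ?thesis by simp
  qed
  have orth': "v \<bullet> (B *v w j) = 0" if "j \<in> S" for j
    using orth[OF that] inner_matrix_sym[OF sym] by metis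
  define w' where "w' = w(k := v /\<^sub>R sqrt c)"
  have 1: "w' i \<bullet> (B *v w' j) = of_bool (i = j)" if "i \<in> insert k S" "j \<in> insert k S" for i j
  proof -
    have "(v /\<^sub>R sqrt c) \<bullet> (B *v (v /\<^sub>R sqrt c)) = inverse (sqrt c) * inverse (sqrt c) * c"
      by (simp add: matrix_vector_mult_scaleR c_def)
    also have "\<dots> = 1" using c by (simp add: field_simps)
    finally show ?thesis
      using that insert.hyps w orth orth' by (auto simp: w'_def matrix_vector_mult_scaleR)
  qed
  have 2: "w' i $ l = 0" if "i \<in> insert k S" "l \<notin> insert k S" for i l
  proof -
    have "v $ l = 0" using that w0 by (auto simp: v_def e_def axis_def)
    then show ?thesis using that w0 by (auto simp: w'_def)
  qed
  from 1 2 show ?case by blast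
qed simp

text \<open>The orthonormal family supplies the columns of \<open>W\<close>; this takes the place of
  a diagonalization of \<open>B\<close>.\<close>

lemma pos_def_normal_form:
  fixes B :: "real^'n::finite^'n"
  assumes sym: "transpose B = B" and pos: "\<And>v. v \<noteq> 0 \<Longrightarrow> 0 < v \<bullet> (B *v v)"
  obtains W :: "real^'n^'n" where "transpose W ** B ** W = mat 1" and "(det W)\<^sup>2 * det B = 1"
    and "\<And>x. (W *v x) \<bullet> (B *v (W *v x)) = x \<bullet> x"
proof -
  obtain w :: "'n \<Rightarrow> real^'n" where w: "\<And>i j. w i \<bullet> (B *v w j) = of_bool (i = j)"
    using pos_def_orthonormal_family[OF sym pos finite_class.finite_UNIV] by auto
  define W where "W = (\<chi> i j. w j $ i)"
  have col: "column j W = w j" for j by (simp add: W_def column_def vec_eq_iff)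
  have "(transpose W ** B ** W) $ i $ j = mat 1 $ i $ j" for i j
  proof -
    have "(transpose W ** B ** W) $ i $ j = (transpose W ** (B ** W)) $ i $ j"
      by (simp add: matrix_mul_assoc)
    also have "\<dots> = row i (transpose W) \<bullet> column j (B ** W)"
      by (simp add: matrix_matrix_mult_def inner_vec_def row_def column_def)
    also have "column j (B ** W) = B *v column j W"
      by (simp add: matrix_matrix_mult_def matrix_vector_mult_def column_def vec_eq_iff)
    finally show ?thesis using w by (simp add: col row_transpose mat_def of_bool_def)
  qed
  then have 1: "transpose W ** B ** W = mat 1" by (simp add: vec_eq_iff)
  then have "det (transpose W ** B ** W) = 1" by simp
  then have 2: "(det W)\<^sup>2 * det B = 1" by (simp add: det_mul power2_eq_square mult_ac)
  have 3: "(W *v x) \<bullet> (B *v (W *v x)) = x \<bullet> x" for x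
  proof -
    have "x \<bullet> x = x \<bullet> ((transpose W ** B ** W) *v x)" by (simp add: 1)
    also have "\<dots> = x \<bullet> (transpose W *v (B *v (W *v x)))"
      by (simp add: matrix_vector_mul_assoc matrix_mul_assoc)
    also have "\<dots> = (W *v x) \<bullet> (B *v (W *v x))"
      using dot_lmul_matrix[of x "transpose W" "B *v (W *v x)"] by (simp only: vector_transpose_matrix)
    finally show ?thesis ..
  qed
  from 1 2 3 show ?thesis by (rule that)
qed

lemma nn_integral_gaussian_real: "(\<integral>\<^sup>+x. ennreal (exp (- (x\<^sup>2) / 2)) \<partial>lborel) = ennreal (sqrt (2 * pi))"
proof -
  have "(\<integral>\<^sup>+x. ennreal (exp (- (x\<^sup>2) / 2)) \<partial>lborel)
      = (\<integral>\<^sup>+x. ennreal (sqrt (2 * pi)) * ennreal (std_normal_density x) \<partial>lborel)"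
    by (intro nn_integral_cong) (simp add: std_normal_density_def flip: ennreal_mult)
  also have "\<dots> = ennreal (sqrt (2 * pi)) * (\<integral>\<^sup>+x. ennreal (std_normal_density x) \<partial>lborel)"
    by (rule nn_integral_cmult) simp
  also have "(\<integral>\<^sup>+x. ennreal (std_normal_density x) \<partial>lborel) = 1"
    by (subst nn_integral_eq_integral) (auto simp: integrable_normal_density)
  finally show ?thesis by simp
qed

lemma nn_integral_gaussian_std:
  "(\<integral>\<^sup>+x. ennreal (exp (- ((norm x)\<^sup>2) / 2)) \<partial>(lborel :: 'a::euclidean_space measure))
    = ennreal (sqrt (2 * pi) ^ DIM('a))"
proof -
  interpret product_sigma_finite "\<lambda>_::'a. lborel :: real measure" ..
  have n: "(norm (\<Sum>b\<in>Basis. f b *\<^sub>R b :: 'a))\<^sup>2 = (\<Sum>b\<in>Basis. (f b)\<^sup>2)" for f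
    unfolding power2_norm_eq_inner
    by (subst euclidean_inner) (simp add: power2_eq_square)
  have "(\<integral>\<^sup>+x. ennreal (exp (- ((norm x)\<^sup>2) / 2)) \<partial>(lborel :: 'a::euclidean_space measure))
     = (\<integral>\<^sup>+f. ennreal (exp (- (\<Sum>b\<in>Basis. (f b)\<^sup>2) / 2)) \<partial>(\<Pi>\<^sub>M b\<in>(Basis::'a set). lborel))"
    by (subst lborel_eq, subst nn_integral_distr) (simp_all add: n)
  also have "\<dots> = (\<integral>\<^sup>+f. (\<Prod>b\<in>Basis. ennreal (exp (- ((f b)\<^sup>2) / 2))) \<partial>(\<Pi>\<^sub>M b\<in>(Basis::'a set). lborel))"
  proof (rule nn_integral_cong)
    fix f :: "'a \<Rightarrow> real"
    have "exp (- (\<Sum>b\<in>Basis. (f b)\<^sup>2) / 2) = (\<Prod>b\<in>(Basis::'a set). exp (- ((f b)\<^sup>2) / 2))"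
      by (simp add: exp_sum[symmetric] sum_negf sum_divide_distrib)
    then show "ennreal (exp (- (\<Sum>b\<in>Basis. (f b)\<^sup>2) / 2)) = (\<Prod>b\<in>(Basis::'a set). ennreal (exp (- ((f b)\<^sup>2) / 2)))"
      by (simp add: prod_ennreal)
  qed
  also have "\<dots> = (\<Prod>b\<in>(Basis::'a set). (\<integral>\<^sup>+x. ennreal (exp (- (x\<^sup>2) / 2)) \<partial>lborel))"
    by (rule product_nn_integral_prod) auto
  also have "\<dots> = ennreal (sqrt (2 * pi) ^ DIM('a))"
    unfolding nn_integral_gaussian_real by (simp add: ennreal_power)
  finally show ?thesis .
qed

lemma pos_def_det_pos:
  fixes B :: "real^'n::finite^'n"
  assumes sym: "transpose B = B" and pos: "\<And>v. v \<noteq> 0 \<Longrightarrow> 0 < v \<bullet> (B *v v)"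
  shows "det B > 0"
proof -
  obtain W :: "real^'n^'n" where W: "(det W)\<^sup>2 * det B = 1"
    using pos_def_normal_form[OF sym pos] by metis
  then have "0 < (det W)\<^sup>2 * det B" by simp
  then show ?thesis by (simp add: zero_less_mult_iff)
qed

text \<open>Substituting \<open>W\<close> turns the form into the squared norm, and the Jacobian
  \<open>\<bar>det W\<bar>\<close> equals \<open>1 / sqrt (det B)\<close>.\<close>

lemma has_bochner_integral_gaussian:
  fixes B :: "real^'n::finite^'n"
  assumes sym: "transpose B = B" and pos: "\<And>v. v \<noteq> 0 \<Longrightarrow> 0 < v \<bullet> (B *v v)"
  shows "has_bochner_integral lborel (\<lambda>x. exp (- (x \<bullet> (B *v x)) / 2)) (sqrt (2 * pi) ^ CARD('n) / sqrt (det B))"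
proof (rule has_bochner_integral_nn_integral)
  obtain W :: "real^'n^'n" where W: "(det W)\<^sup>2 * det B = 1"
    and Wq: "\<And>x. (W *v x) \<bullet> (B *v (W *v x)) = x \<bullet> x"
    using pos_def_normal_form[OF sym pos] by metis
  have "(sqrt (det B) * \<bar>det W\<bar>)\<^sup>2 = 1"
    using W pos_def_det_pos[OF sym pos] by (simp add: power_mult_distrib mult.commute)
  moreover have "0 \<le> sqrt (det B) * \<bar>det W\<bar>"
    using pos_def_det_pos[OF sym pos] by simp
  ultimately have "sqrt (det B) * \<bar>det W\<bar> = 1"
    using power2_eq_iff_nonneg[of "sqrt (det B) * \<bar>det W\<bar>" 1] by simp
  then have dW: "\<bar>det W\<bar> = 1 / sqrt (det B)"
    using pos_def_det_pos[OF sym pos] by (simp add: eq_divide_eq mult.commute)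
  have dW0: "det W \<noteq> 0" using W by auto
  have "(\<integral>\<^sup>+x. ennreal (exp (- (x \<bullet> (B *v x)) / 2)) \<partial>lborel)
     = ennreal \<bar>det W\<bar> * (\<integral>\<^sup>+x. ennreal (exp (- ((W *v x) \<bullet> (B *v (W *v x))) / 2)) \<partial>lborel)"
    by (rule nn_integral_lborel_linear[OF dW0, symmetric]) measurable
  also have "\<dots> = ennreal \<bar>det W\<bar> * ennreal (sqrt (2 * pi) ^ CARD('n))"
    using nn_integral_gaussian_std[where 'a="real^'n"] by (simp add: Wq power2_norm_eq_inner)
  also have "\<dots> = ennreal (sqrt (2 * pi) ^ CARD('n) / sqrt (det B))"
    using pos_def_det_pos[OF sym pos] by (subst ennreal_mult[symmetric]) (auto simp: dW less_imp_le)
  finally show "(\<integral>\<^sup>+x. ennreal (exp (- (x \<bullet> (B *v x)) / 2)) \<partial>lborel) = ennreal (sqrt (2 * pi) ^ CARD('n) / sqrt (det B))" .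
  show "0 \<le> sqrt (2 * pi) ^ CARD('n) / sqrt (det B)"
    using pos_def_det_pos[OF sym pos] by simp
  show "(\<lambda>x. exp (- (x \<bullet> (B *v x)) / 2)) \<in> borel_measurable lborel" by measurable
qed simp

lemma has_bochner_integral_gaussian_iso:
  assumes "l > 0"
  shows "has_bochner_integral lborel (\<lambda>x::real^'n::finite. exp (- (l * (norm x)\<^sup>2) / 2)) (sqrt (2 * pi) ^ CARD('n) / sqrt (l ^ CARD('n)))"
proof -
  have v: "mat l *v x = l *\<^sub>R x" for x :: "real^'n"
  proof -
    have "(mat l *v x) $ i = l * x $ i" for i
    proof -
      have "(\<Sum>j\<in>UNIV. (if i = j then l else 0) * x $ j) = (\<Sum>j\<in>UNIV. if j = i then l * x $ j else 0)"
        by (rule sum.cong) auto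
      then show ?thesis by (simp add: mat_def matrix_vector_mult_def)
    qed
    then show ?thesis by (simp add: vec_eq_iff)
  qed
  have d: "det (mat l :: real^'n^'n) = l ^ CARD('n)"
    by (subst det_diagonal) (simp_all add: mat_def)
  have "has_bochner_integral lborel (\<lambda>x. exp (- (x \<bullet> ((mat l :: real^'n^'n) *v x)) / 2)) (sqrt (2 * pi) ^ CARD('n) / sqrt (det (mat l :: real^'n^'n)))"
    by (rule has_bochner_integral_gaussian)
      (use assms in \<open>auto simp: transpose_mat v\<close>)
  then show ?thesis by (simp add: v d power2_norm_eq_inner)
qed

text \<open>The determinant is read off from the Gaussian integral instead of from eigenvalues: a
  larger form has a smaller integral and hence a larger determinant.\<close>

lemma quadratic_form_det_bounds:
  fixes B :: "real^'n::finite^'n"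
  assumes sym: "transpose B = B" and l: "l > 0" and lb: "\<And>v. l * (norm v)\<^sup>2 \<le> v \<bullet> (B *v v)"
  shows det_ge_quadratic_form: "l ^ CARD('n) \<le> det B"
    and det_le_quadratic_form: "(\<And>v. v \<bullet> (B *v v) \<le> s * (norm v)\<^sup>2) \<Longrightarrow> det B \<le> s ^ CARD('n)"
proof -
  have pos: "0 < v \<bullet> (B *v v)" if "v \<noteq> 0" for v
    by (rule less_le_trans[OF _ lb]) (use l that in simp)
  note d = pos_def_det_pos[OF sym pos]
  note G = has_bochner_integral_gaussian[OF sym pos]
  have mono: "d1 \<le> d2" if "sqrt (2 * pi) ^ CARD('n) / sqrt d2 \<le> sqrt (2 * pi) ^ CARD('n) / sqrt d1" "d1 > 0" "d2 > 0" for d1 d2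
  proof (rule ccontr)
    assume "\<not> d1 \<le> d2"
    then have "sqrt (2 * pi) ^ CARD('n) / sqrt d1 < sqrt (2 * pi) ^ CARD('n) / sqrt d2"
      using that(2,3) by (intro divide_strict_left_mono) auto
    with that(1) show False by simp
  qed
  have int_mono: "c \<le> c'"
    if "has_bochner_integral lborel f c" "has_bochner_integral lborel g c'" "\<And>x. f x \<le> g x" for f g :: "real^'n \<Rightarrow> real" and c c'
    using integral_mono[of lborel f g] that by (auto simp: has_bochner_integral_iff)
  show "l ^ CARD('n) \<le> det B"
  proof (rule mono)
    show "sqrt (2 * pi) ^ CARD('n) / sqrt (det B) \<le> sqrt (2 * pi) ^ CARD('n) / sqrt (l ^ CARD('n))"
      by (rule int_mono[OF G has_bochner_integral_gaussian_iso[OF l]]) (use lb in auto)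
  qed (use d l in auto)
  assume ub: "\<And>v. v \<bullet> (B *v v) \<le> s * (norm v)\<^sup>2"
  \<comment> \<open>Testing both bounds on a unit vector makes \<open>s\<close> positive, so that
    the Gaussian with parameter \<open>s\<close> is available for comparison.\<close>
  have "l \<le> s"
    using order_trans[OF lb[of "axis undefined 1"] ub[of "axis undefined 1"]] by simp
  with l have s: "s > 0" by simp
  show "det B \<le> s ^ CARD('n)"
  proof (rule mono)
    show "sqrt (2 * pi) ^ CARD('n) / sqrt (s ^ CARD('n)) \<le> sqrt (2 * pi) ^ CARD('n) / sqrt (det B)"
      by (rule int_mono[OF has_bochner_integral_gaussian_iso[OF s] G]) (use ub in auto)
  qed (use d s in auto)
qed

section \<open>Partial derivatives and Taylor expansions\<close>

lemma has_derivative_pdiff: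
  fixes f :: "real^'n::finite \<Rightarrow> real"
  assumes "f differentiable (at x)"
  shows "(f has_derivative (\<lambda>v. \<Sum>i\<in>UNIV. v $ i * pdiff i f x)) (at x)"
proof -
  let ?D = "frechet_derivative f (at x)"
  have D: "(f has_derivative ?D) (at x)" using assms by (simp add: frechet_derivative_works)
  then have lin: "linear ?D" by (rule has_derivative_linear)
  have "?D v = (\<Sum>i\<in>UNIV. v $ i * pdiff i f x)" for v
  proof -
    have "?D v = ?D (\<Sum>i\<in>UNIV. v $ i *\<^sub>R axis i 1)"
      using basis_expansion[of v] by (simp add: scalar_mult_eq_scaleR)
    also have "\<dots> = (\<Sum>i\<in>UNIV. v $ i * pdiff i f x)"
      by (simp add: linear_sum[OF lin] linear_scale[OF lin] pdiff_def)
    finally show ?thesis .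
  qed
  then have "?D = (\<lambda>v. \<Sum>i\<in>UNIV. v $ i * pdiff i f x)" by (rule ext)
  with D show ?thesis by simp
qed

lemma DERIV_along_line:
  fixes f :: "real^'n::finite \<Rightarrow> real"
  assumes "f differentiable (at (x + t *\<^sub>R v))"
  shows "((\<lambda>t. f (x + t *\<^sub>R v)) has_real_derivative (\<Sum>i\<in>UNIV. v $ i * pdiff i f (x + t *\<^sub>R v))) (at t)"
proof -
  have "((\<lambda>t. x + t *\<^sub>R v) has_derivative (\<lambda>s. s *\<^sub>R v)) (at t)"
    by (auto intro!: derivative_eq_intros)
  from has_derivative_compose[OF this has_derivative_pdiff[OF assms]]
  moreover have "(\<lambda>s. \<Sum>i\<in>UNIV. (s *\<^sub>R v) $ i * pdiff i f (x + t *\<^sub>R v))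
      = (*) (\<Sum>i\<in>UNIV. v $ i * pdiff i f (x + t *\<^sub>R v))"
    by (auto simp: fun_eq_iff sum_distrib_left sum_distrib_right mult_ac)
  ultimately show ?thesis by (simp add: has_field_derivative_def)
qed

lemma DERIV_along_axis:
  fixes f :: "real^'n::finite \<Rightarrow> real"
  assumes "f differentiable (at (x + t *\<^sub>R axis i 1))"
  shows "((\<lambda>t. f (x + t *\<^sub>R axis i 1)) has_real_derivative pdiff i f (x + t *\<^sub>R axis i 1)) (at t)"
proof -
  have "(\<Sum>k\<in>UNIV. axis i 1 $ k * pdiff k f y) = (\<Sum>k\<in>UNIV. if k = i then pdiff i f y else 0)" for y
    by (rule sum.cong) (auto simp: axis_def)
  with DERIV_along_line[OF assms] show ?thesis by simp
qed

lemma Ck_on_Suc_D: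
  assumes "Ck_on (Suc k) f S" "open S" "x \<in> S"
  shows "f differentiable (at x)" "Ck_on k (pdiff i f) S"
  using assms by (auto simp: differentiable_on_eq_differentiable_at)

text \<open>Serves the replacement of the likelihood by zero on an exceptional null set.\<close>

lemma Ck_on_const_0 [simp]: "Ck_on k (\<lambda>_. 0) S"
proof -
  have "pdiff i (\<lambda>_. 0) = (\<lambda>_. 0)" for i :: 'a
    by (auto simp: pdiff_def fun_eq_iff)
  then show ?thesis by (induction k) auto
qed

text \<open>The mean value theorem applied twice: along axis \<open>i\<close> to the increment of
  \<open>f\<close> over a step along \<open>j\<close>, then along axis \<open>j\<close> to
  \<open>pdiff i f\<close>.\<close>

lemma second_difference_mean_value:
  fixes f :: "real^'n::finite \<Rightarrow> real"
  assumes h: "0 < h"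
    and S: "\<And>s t. 0 \<le> s \<Longrightarrow> s \<le> h \<Longrightarrow> 0 \<le> t \<Longrightarrow> t \<le> h \<Longrightarrow> x + s *\<^sub>R axis i 1 + t *\<^sub>R axis j 1 \<in> S"
    and f: "\<And>y. y \<in> S \<Longrightarrow> f differentiable (at y)"
    and f': "\<And>y. y \<in> S \<Longrightarrow> pdiff i f differentiable (at y)"
  shows "\<exists>s t. 0 \<le> s \<and> s \<le> h \<and> 0 \<le> t \<and> t \<le> h \<and>
     f (x + h *\<^sub>R axis i 1 + h *\<^sub>R axis j 1) - f (x + h *\<^sub>R axis i 1) - f (x + h *\<^sub>R axis j 1) + f x
      = h * h * pdiff j (pdiff i f) (x + s *\<^sub>R axis i 1 + t *\<^sub>R axis j 1)"
proof -
  define g where "g s = f ((x + h *\<^sub>R axis j 1) + s *\<^sub>R axis i 1) - f (x + s *\<^sub>R axis i 1)" for s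
  define g' where "g' s = pdiff i f ((x + h *\<^sub>R axis j 1) + s *\<^sub>R axis i 1) - pdiff i f (x + s *\<^sub>R axis i 1)" for s
  have dg: "(g has_real_derivative g' s) (at s)" if "0 \<le> s" "s \<le> h" for s
    unfolding g_def g'_def
    using S[of s h] S[of s 0] that h
    by (intro DERIV_diff DERIV_along_axis f) (auto simp: algebra_simps)
  from MVT2[OF h, of g g'] dg obtain s where s: "0 < s" "s < h" "g h - g 0 = h * g' s" by auto
  define k where "k t = pdiff i f ((x + s *\<^sub>R axis i 1) + t *\<^sub>R axis j 1)" for t
  have dk: "(k has_real_derivative pdiff j (pdiff i f) ((x + s *\<^sub>R axis i 1) + t *\<^sub>R axis j 1)) (at t)"
    if "0 \<le> t" "t \<le> h" for t
    unfolding k_def using S[of s t] that s by (intro DERIV_along_axis f') auto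
  from MVT2[OF h, of k, OF dk] obtain t where t: "0 < t" "t < h"
      "k h - k 0 = h * pdiff j (pdiff i f) ((x + s *\<^sub>R axis i 1) + t *\<^sub>R axis j 1)" by auto
  have "f (x + h *\<^sub>R axis i 1 + h *\<^sub>R axis j 1) - f (x + h *\<^sub>R axis i 1) - f (x + h *\<^sub>R axis j 1) + f x = g h - g 0"
    by (simp add: g_def algebra_simps)
  also have "\<dots> = h * (k h - k 0)" using s by (simp add: g'_def k_def algebra_simps)
  finally show ?thesis using s t by (intro exI[of _ s] exI[of _ t]) auto
qed

text \<open>The second difference over a small square is symmetric in the two directions and equals
  \<open>h * h\<close> times either mixed derivative at some point of the square. Continuity brings
  both points back to \<open>x\<close>.\<close>

lemma pdiff_commute:
  fixes f :: "real^'n::finite \<Rightarrow> real"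
  assumes S: "open S" "x \<in> S" and C2: "Ck_on 2 f S"
  shows "pdiff i (pdiff j f) x = pdiff j (pdiff i f) x"
proof (rule ccontr)
  assume ne: "pdiff i (pdiff j f) x \<noteq> pdiff j (pdiff i f) x"
  define e where "e = \<bar>pdiff i (pdiff j f) x - pdiff j (pdiff i f) x\<bar> / 2"
  have e: "e > 0" using ne by (simp add: e_def)
  have C2': "Ck_on (Suc (Suc 0)) f S" using C2 by (simp add: numeral_2_eq_2)
  have f: "f differentiable (at y)" and f': "pdiff k f differentiable (at y)"
    and c: "continuous_on S (pdiff l (pdiff k f))" if "y \<in> S" for y k l
    using Ck_on_Suc_D(1)[OF C2' S(1) that] Ck_on_Suc_D(1)[OF Ck_on_Suc_D(2)[OF C2' S(1) that] S(1) that]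
      Ck_on_Suc_D(2)[OF Ck_on_Suc_D(2)[OF C2' S(1) that] S(1) that] by (auto simp: numeral_2_eq_2)
  obtain r where r: "r > 0" "\<And>y. dist y x < r \<Longrightarrow> y \<in> S"
    using S by (auto simp: open_dist)
  have near: "\<exists>d>0. \<forall>y. dist y x < d \<longrightarrow> dist (pdiff l (pdiff k f) y) (pdiff l (pdiff k f) x) < e" for k l
  proof -
    have "isCont (pdiff l (pdiff k f)) x"
      using c[OF S(2)] S by (simp add: continuous_on_eq_continuous_at)
    then show ?thesis using e by (auto simp: continuous_at_eps_delta)
  qed
  obtain d1 where d1: "d1 > 0" "\<And>y. dist y x < d1 \<Longrightarrow> dist (pdiff j (pdiff i f) y) (pdiff j (pdiff i f) x) < e"
    using near by blast
  obtain d2 where d2: "d2 > 0" "\<And>y. dist y x < d2 \<Longrightarrow> dist (pdiff i (pdiff j f) y) (pdiff i (pdiff j f) x) < e"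
    using near by blast
  \<comment> \<open>Points of the square are at distance at most \<open>2 * h\<close> from
    \<open>x\<close>, so the square lies inside all three neighbourhoods.\<close>
  define h where "h = min r (min d1 d2) / 3"
  have h: "h > 0" "3 * h \<le> r" "3 * h \<le> d1" "3 * h \<le> d2" using r d1 d2 by (auto simp: h_def)
  have close: "dist (x + s *\<^sub>R axis k 1 + t *\<^sub>R axis l 1) x < 3 * h" if "0 \<le> s" "s \<le> h" "0 \<le> t" "t \<le> h" for s t k l
  proof -
    have "dist (x + s *\<^sub>R axis k 1 + t *\<^sub>R axis l 1) x = norm (s *\<^sub>R axis k 1 + t *\<^sub>R axis l (1::real))"
      by (simp add: dist_norm algebra_simps)
    also have "\<dots> \<le> norm (s *\<^sub>R axis k (1::real)) + norm (t *\<^sub>R axis l (1::real))" by (rule norm_triangle_ineq)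
    also have "\<dots> = s + t" using that by simp
    also have "\<dots> < 3 * h" using that h by linarith
    finally show ?thesis .
  qed
  have inS: "x + s *\<^sub>R axis k 1 + t *\<^sub>R axis l 1 \<in> S" if "0 \<le> s" "s \<le> h" "0 \<le> t" "t \<le> h" for s t k l
    using close[OF that, of k l] h by (intro r(2)) simp
  obtain s t where st: "0 \<le> s" "s \<le> h" "0 \<le> t" "t \<le> h"
    "f (x + h *\<^sub>R axis i 1 + h *\<^sub>R axis j 1) - f (x + h *\<^sub>R axis i 1) - f (x + h *\<^sub>R axis j 1) + f x
      = h * h * pdiff j (pdiff i f) (x + s *\<^sub>R axis i 1 + t *\<^sub>R axis j 1)"
    using second_difference_mean_value[OF h(1) inS f f', of i j] by blast
  obtain s' t' where st': "0 \<le> s'" "s' \<le> h" "0 \<le> t'" "t' \<le> h"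
    "f (x + h *\<^sub>R axis j 1 + h *\<^sub>R axis i 1) - f (x + h *\<^sub>R axis j 1) - f (x + h *\<^sub>R axis i 1) + f x
      = h * h * pdiff i (pdiff j f) (x + s' *\<^sub>R axis j 1 + t' *\<^sub>R axis i 1)"
    using second_difference_mean_value[OF h(1) inS f f', of j i] by blast
  have "x + h *\<^sub>R axis j 1 + h *\<^sub>R axis i 1 = x + h *\<^sub>R axis i 1 + h *\<^sub>R axis j (1::real)"
    by (simp add: add_ac)
  with st(5) st'(5) have "h * h * pdiff j (pdiff i f) (x + s *\<^sub>R axis i 1 + t *\<^sub>R axis j 1)
      = h * h * pdiff i (pdiff j f) (x + s' *\<^sub>R axis j 1 + t' *\<^sub>R axis i 1)"
    by (simp only:)
  then have eq: "pdiff j (pdiff i f) (x + s *\<^sub>R axis i 1 + t *\<^sub>R axis j 1)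
      = pdiff i (pdiff j f) (x + s' *\<^sub>R axis j 1 + t' *\<^sub>R axis i 1)" using h by simp
  have "dist (pdiff j (pdiff i f) (x + s *\<^sub>R axis i 1 + t *\<^sub>R axis j 1)) (pdiff j (pdiff i f) x) < e"
    using close[OF st(1-4), of i j] h by (intro d1(2)) simp
  moreover have "dist (pdiff i (pdiff j f) (x + s' *\<^sub>R axis j 1 + t' *\<^sub>R axis i 1)) (pdiff i (pdiff j f) x) < e"
    using close[OF st'(1-4), of j i] h by (intro d2(2)) simp
  ultimately have "\<bar>pdiff i (pdiff j f) x - pdiff j (pdiff i f) x\<bar> < 2 * e"
    unfolding eq dist_real_def by linarith
  then show False by (simp add: e_def)
qed

lemma Ck_on_3_differentiable:
  assumes S: "open S" "x \<in> S" and f: "Ck_on 3 f S"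
  shows "f differentiable (at x)" "pdiff i f differentiable (at x)"
    "pdiff i (pdiff j f) differentiable (at x)"
    and Ck_on_3_continuous: "continuous_on S (pdiff i (pdiff j (pdiff k f)))"
proof -
  have C: "Ck_on (Suc (Suc (Suc 0))) f S" using f by (simp add: numeral_3_eq_3)
  note D = Ck_on_Suc_D[OF _ S]
  show "f differentiable (at x)" by (rule D(1)[OF C])
  show "pdiff i f differentiable (at x)" by (rule D(1)[OF D(2)[OF C]])
  show "pdiff i (pdiff j f) differentiable (at x)" by (rule D(1)[OF D(2)[OF D(2)[OF C]]])
  show "continuous_on S (pdiff i (pdiff j (pdiff k f)))"
    using D(2)[OF D(2)[OF D(2)[OF C]]] by simp
qed

lemma transpose_hess:
  assumes "open S" "x \<in> S" "Ck_on 3 f S"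
  shows "transpose (hess f x) = hess f x"
proof -
  have "Ck_on (Suc 2) f S" using assms(3) by (simp add: eval_nat_numeral)
  moreover have "g differentiable_on S \<Longrightarrow> continuous_on S g" for g :: "real^'a \<Rightarrow> real"
    by (rule differentiable_imp_continuous_on)
  ultimately have "Ck_on 2 f S" by (auto simp: numeral_2_eq_2)
  from pdiff_commute[OF assms(1,2) this] show ?thesis
    by (simp add: transpose_def hess_def vec_eq_iff)
qed

section \<open>Taylor formulas and strong concavity on the unit interval\<close>

lemma taylor2_01:
  fixes \<phi> \<phi>' \<phi>'' :: "real \<Rightarrow> real"
  assumes "\<And>t. 0 \<le> t \<Longrightarrow> t \<le> 1 \<Longrightarrow> (\<phi> has_real_derivative \<phi>' t) (at t)"
    and "\<And>t. 0 \<le> t \<Longrightarrow> t \<le> 1 \<Longrightarrow> (\<phi>' has_real_derivative \<phi>'' t) (at t)"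
  shows "\<exists>t. 0 < t \<and> t < 1 \<and> \<phi> 1 = \<phi> 0 + \<phi>' 0 + \<phi>'' t / 2"
proof -
  define D where "D m = (if m = 0 then \<phi> else if m = 1 then \<phi>' else \<phi>'')" for m :: nat
  have "\<exists>t>0. t < 1 \<and> \<phi> 1 = (\<Sum>m<2. D m 0 / fact m * 1 ^ m) + D 2 t / fact 2 * 1 ^ 2"
    by (rule Maclaurin) (use assms in \<open>auto simp: D_def less_2_cases_iff\<close>)
  then show ?thesis by (simp add: D_def numeral_2_eq_2)
qed

lemma taylor3_01:
  fixes \<phi> \<phi>' \<phi>'' :: "real \<Rightarrow> real"
  assumes "\<And>t. 0 \<le> t \<Longrightarrow> t \<le> 1 \<Longrightarrow> (\<phi> has_real_derivative \<phi>' t) (at t)"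
    and "\<And>t. 0 \<le> t \<Longrightarrow> t \<le> 1 \<Longrightarrow> (\<phi>' has_real_derivative \<phi>'' t) (at t)"
    and "\<And>t. 0 \<le> t \<Longrightarrow> t \<le> 1 \<Longrightarrow> (\<phi>'' has_real_derivative \<phi>''' t) (at t)"
  shows "\<exists>t. 0 < t \<and> t < 1 \<and> \<phi> 1 = \<phi> 0 + \<phi>' 0 + \<phi>'' 0 / 2 + \<phi>''' t / 6"
proof -
  define D where "D m = (if m = 0 then \<phi> else if m = 1 then \<phi>' else if m = 2 then \<phi>'' else \<phi>''')" for m :: nat
  have "m < 3 \<longleftrightarrow> m = 0 \<or> m = 1 \<or> m = 2" for m :: nat by auto
  then have "\<exists>t>0. t < 1 \<and> \<phi> 1 = (\<Sum>m<3. D m 0 / fact m * 1 ^ m) + D 3 t / fact 3 * 1 ^ 3"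
    by (intro Maclaurin) (use assms in \<open>auto simp: D_def\<close>)
  then show ?thesis by (simp add: D_def numeral_2_eq_2 numeral_3_eq_3)
qed

text \<open>At the left end point the function need not be differentiable: this covers maximizers on the
  boundary of the domain, where the slope can be negative.\<close>

lemma strongly_concave_max_drop:
  fixes \<phi> \<phi>' \<phi>'' :: "real \<Rightarrow> real"
  assumes cont: "continuous_on {0..1} \<phi>"
    and d1: "\<And>t. 0 < t \<Longrightarrow> t \<le> 1 \<Longrightarrow> (\<phi> has_real_derivative \<phi>' t) (at t)"
    and d2: "\<And>t. 0 < t \<Longrightarrow> t \<le> 1 \<Longrightarrow> (\<phi>' has_real_derivative \<phi>'' t) (at t)"
    and le: "\<And>t. 0 < t \<Longrightarrow> t \<le> 1 \<Longrightarrow> \<phi>'' t \<le> - c"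
    and max: "\<And>t. 0 < t \<Longrightarrow> t \<le> 1 \<Longrightarrow> \<phi> t \<le> \<phi> 0" and c: "c \<ge> 0"
  shows "\<phi> 1 \<le> \<phi> 0 - c / 2"
proof -
  \<comment> \<open>Since \<open>\<phi> s \<le> \<phi> 0\<close>, the mean value theorem gives a
    point \<open>z < s\<close> of nonpositive slope. From \<open>z\<close> on, the function is twice
    differentiable and Taylor's formula yields a drop below \<open>\<phi> z \<le> \<phi> 0\<close>.
    Letting \<open>s\<close> tend to zero afterwards restores the full constant
    \<open>c / 2\<close>.\<close>
  have *: "\<phi> 1 \<le> \<phi> 0 - c / 2 * (1 - s)\<^sup>2" if s: "0 < s" "s < 1" for s
  proof -
    have "\<exists>l z. 0 < z \<and> z < s \<and> DERIV \<phi> z :> l \<and> \<phi> s - \<phi> 0 = (s - 0) * l"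
    proof (rule MVT)
      fix x assume "0 < x" "x < s"
      then show "\<phi> differentiable (at x)"
        using d1[of x] s unfolding real_differentiable_def by auto
    qed (use s in \<open>auto intro!: continuous_on_subset[OF cont]\<close>)
    then obtain l z where z: "0 < z" "z < s" "DERIV \<phi> z :> l" "\<phi> s - \<phi> 0 = s * l" by auto
    have "l = \<phi>' z" using DERIV_unique[OF z(3) d1[of z]] z s by simp
    have "s * l \<le> 0" using z max[of s] s by simp
    then have l: "\<phi>' z \<le> 0" using s \<open>l = \<phi>' z\<close> by (simp add: mult_le_0_iff)
    define g where "g t = \<phi> (z + t * (1 - z))" for t
    define g' where "g' t = (1 - z) * \<phi>' (z + t * (1 - z))" for t
    define g'' where "g'' t = (1 - z)\<^sup>2 * \<phi>'' (z + t * (1 - z))" for t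
    have rng: "0 < z + t * (1 - z)" "z + t * (1 - z) \<le> 1" if "0 \<le> t" "t \<le> 1" for t
    proof -
      show "0 < z + t * (1 - z)" using that z s by (intro add_pos_nonneg mult_nonneg_nonneg) auto
      have "t * (1 - z) \<le> 1 * (1 - z)" using that z s by (intro mult_right_mono) auto
      then show "z + t * (1 - z) \<le> 1" by simp
    qed
    have "\<exists>t. 0 < t \<and> t < 1 \<and> g 1 = g 0 + g' 0 + g'' t / 2"
    proof (rule taylor2_01)
      fix t :: real assume t: "0 \<le> t" "t \<le> 1"
      have lin: "((\<lambda>t. z + t * (1 - z)) has_real_derivative (1 - z)) (at t)"
        by (auto intro!: derivative_eq_intros)
      show "(g has_real_derivative g' t) (at t)"
        unfolding g_def g'_def
        by (rule DERIV_chain2[where g="\<lambda>t. z + t * (1 - z)", OF d1[OF rng[OF t]] lin, THEN DERIV_cong]) simp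
      show "(g' has_real_derivative g'' t) (at t)"
        unfolding g'_def g''_def
        by (rule DERIV_cmult[OF DERIV_chain2[where g="\<lambda>t. z + t * (1 - z)", OF d2[OF rng[OF t]] lin], THEN DERIV_cong])
          (simp add: power2_eq_square)
    qed
    then obtain t where t: "0 < t" "t < 1" "g 1 = g 0 + g' 0 + g'' t / 2" by auto
    have "g'' t \<le> (1 - z)\<^sup>2 * - c"
      unfolding g''_def using rng[of t] t by (intro mult_left_mono le) auto
    moreover have "g' 0 \<le> 0" using l z s by (simp add: g'_def mult_le_0_iff)
    moreover have "g 0 \<le> \<phi> 0" using max[of z] z s by (simp add: g_def)
    ultimately have "\<phi> 1 \<le> \<phi> 0 - c / 2 * (1 - z)\<^sup>2" using t(3) by (simp add: g_def field_simps)
    also have "\<dots> \<le> \<phi> 0 - c / 2 * (1 - s)\<^sup>2"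
      using z s c by (intro diff_left_mono mult_left_mono power_mono) auto
    finally show ?thesis .
  qed
  have "((\<lambda>s. \<phi> 0 - c / 2 * (1 - s)\<^sup>2) \<longlongrightarrow> \<phi> 0 - c / 2 * (1 - 0)\<^sup>2) (at_right 0)"
    by (intro tendsto_intros)
  then have "\<phi> 1 \<le> \<phi> 0 - c / 2 * (1 - 0)\<^sup>2"
  proof (rule tendsto_lowerbound)
    show "\<forall>\<^sub>F s in at_right 0. \<phi> 1 \<le> \<phi> 0 - c / 2 * (1 - s)\<^sup>2"
      using * by (auto simp: eventually_at_right_field intro!: exI[of _ 1])
  qed simp
  then show ?thesis by simp
qed

section \<open>A fixed likelihood function\<close>

lemma inner_matrix_vector_sum: "u \<bullet> (B *v w) = (\<Sum>i\<in>UNIV. \<Sum>j\<in>UNIV. u $ i * w $ j * B $ i $ j)"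
  for B :: "real^'n^'m"
  by (simp add: inner_vec_def matrix_vector_mult_def sum_distrib_left mult_ac)

lemma tendsto_matrix_entries:
  fixes F :: "'a \<Rightarrow> real^'n^'m"
  shows "(F \<longlongrightarrow> L) net \<longleftrightarrow> (\<forall>i j. ((\<lambda>x. F x $ i $ j) \<longlongrightarrow> L $ i $ j) net)"
proof (intro iffI allI)
  assume "(F \<longlongrightarrow> L) net"
  then show "((\<lambda>x. F x $ i $ j) \<longlongrightarrow> L $ i $ j) net" for i j
    by (intro tendsto_vec_nth)
next
  assume a: "\<forall>i j. ((\<lambda>x. F x $ i $ j) \<longlongrightarrow> L $ i $ j) net"
  show "(F \<longlongrightarrow> L) net"
    by (rule vec_tendstoI, rule vec_tendstoI) (use a in blast)
qed

lemma tendsto_matrix_mult [tendsto_intros]: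
  fixes F :: "'a \<Rightarrow> real^'n^'m" and G :: "'a \<Rightarrow> real^'k^'n"
  assumes "(F \<longlongrightarrow> L) net" "(G \<longlongrightarrow> R) net"
  shows "((\<lambda>x. F x ** G x) \<longlongrightarrow> L ** R) net"
  using assms unfolding tendsto_matrix_entries matrix_matrix_mult_def
  by (auto intro!: tendsto_sum tendsto_mult)

lemma tendsto_quadratic_form [tendsto_intros]:
  fixes F :: "'a \<Rightarrow> real^'n^'m"
  assumes "(F \<longlongrightarrow> L) net"
  shows "((\<lambda>x. u \<bullet> (F x *v w)) \<longlongrightarrow> u \<bullet> (L *v w)) net"
  using assms unfolding tendsto_matrix_entries inner_matrix_vector_sum
  by (auto intro!: tendsto_sum tendsto_mult tendsto_const)

lemma transpose_sandwich:
  fixes A M :: "real^'n^'n"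
  assumes "transpose A = A" "transpose M = M"
  shows "transpose (A ** M ** A) = A ** M ** A"
  by (simp add: matrix_transpose_mul assms matrix_mul_assoc)

lemma inner_sandwich:
  fixes A M :: "real^'n::finite^'n"
  assumes "transpose A = A"
  shows "u \<bullet> ((A ** M ** A) *v w) = (A *v u) \<bullet> (M *v (A *v w))"
proof -
  have "u \<bullet> ((A ** M ** A) *v w) = u \<bullet> (A *v (M *v (A *v w)))"
    by (simp add: matrix_vector_mul_assoc matrix_mul_assoc)
  also have "\<dots> = (M *v (A *v w)) \<bullet> (A *v u)" by (rule inner_matrix_sym[OF assms])
  finally show ?thesis by (simp add: inner_commute)
qed

lemma matrix_vector_uminus: "(- B) *v u = - (B *v u)" for B :: "real^'n^'m"
  by (simp add: vec_eq_iff matrix_vector_mult_def sum_negf)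

text \<open>One realization at one stage, with all randomness frozen. \<open>B\<close> is the
  inverse of the rate matrix, \<open>\<alpha>\<close> bounds its operator norm, and
  \<open>\<theta>m\<close> may lie on the boundary. The eigenvalue bound is stated as an inequality
  of quadratic forms, which passes to limits.\<close>

locale regular_likelihood =
  fixes \<Theta> :: "(real^'p::finite) set" and A B :: "real^'p^'p" and h :: "real^'p \<Rightarrow> real"
    and \<theta>0 \<theta>m :: "real^'p" and d S \<tau> l \<alpha> :: real
  assumes open_dom: "open \<Theta>" and convex_dom: "convex \<Theta>" and \<theta>0: "\<theta>0 \<in> \<Theta>"
    and A_sym: "transpose A = A" and BA: "B ** A = mat 1" and AB: "A ** B = mat 1"
    and A_norm: "\<And>u. norm (A *v u) \<le> \<alpha> * norm u"
    and cont: "continuous_on (closure \<Theta>) h" and C3: "Ck_on 3 h \<Theta>"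
    and \<theta>m: "\<theta>m \<in> closure \<Theta>" and max: "\<And>\<theta>. \<theta> \<in> closure \<Theta> \<Longrightarrow> h \<theta> \<le> h \<theta>m"
    and d: "norm (A *v grad h \<theta>0) \<le> d"
    and S: "\<And>\<theta>. \<theta> \<in> \<Theta> \<Longrightarrow> norm (A ** hess h \<theta> ** A) \<le> S"
    and \<tau>: "\<And>\<theta> i. \<theta> \<in> \<Theta> \<Longrightarrow> norm (A ** dhess i h \<theta> ** A) \<le> \<tau>"
    and l: "l > 0" and l_le: "\<And>\<theta> u. \<theta> \<in> \<Theta> \<Longrightarrow> l * (norm u)\<^sup>2 \<le> - (u \<bullet> ((A ** hess h \<theta> ** A) *v u))"
begin

text \<open>This is \<open>Gamma_mat\<close> with the opposite sign, as it appears in Taylor's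
  formula.\<close>

definition G where "G x = A ** hess h x ** A"

lemmas dom_differentiable = Ck_on_3_differentiable[OF open_dom _ C3]
lemmas hess_sym = transpose_hess[OF open_dom _ C3]

lemma G_sym: "x \<in> \<Theta> \<Longrightarrow> transpose (G x) = G x"
  unfolding G_def by (intro transpose_sandwich A_sym hess_sym)

section \<open>Derivatives along lines\<close>

lemma DERIV_line:
  assumes "x + t *\<^sub>R v \<in> \<Theta>"
  shows "((\<lambda>t. h (x + t *\<^sub>R v)) has_real_derivative (grad h (x + t *\<^sub>R v) \<bullet> v)) (at t)"
  using DERIV_along_line[OF dom_differentiable(1)[OF assms]]
  by (simp add: grad_def inner_vec_def mult.commute)

lemma DERIV_grad_line:
  assumes "x + t *\<^sub>R v \<in> \<Theta>"
  shows "((\<lambda>t. grad h (x + t *\<^sub>R v) \<bullet> v) has_real_derivative (v \<bullet> (hess h (x + t *\<^sub>R v) *v v))) (at t)"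
proof -
  have "((\<lambda>t. \<Sum>i\<in>UNIV. pdiff i h (x + t *\<^sub>R v) * v $ i) has_real_derivative
      (\<Sum>i\<in>UNIV. (\<Sum>j\<in>UNIV. v $ j * pdiff j (pdiff i h) (x + t *\<^sub>R v)) * v $ i)) (at t)"
    by (intro DERIV_sum DERIV_cmult_right DERIV_along_line dom_differentiable assms)
  also have "(\<Sum>i\<in>UNIV. (\<Sum>j\<in>UNIV. v $ j * pdiff j (pdiff i h) (x + t *\<^sub>R v)) * v $ i)
      = v \<bullet> (hess h (x + t *\<^sub>R v) *v v)"
    unfolding inner_matrix_vector_sum sum_distrib_right
    by (subst sum.swap) (simp add: hess_def mult_ac)
  finally show ?thesis by (simp add: grad_def inner_vec_def)
qed

lemma DERIV_G_line:
  assumes "x + t *\<^sub>R v \<in> \<Theta>"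
  shows "((\<lambda>t. u \<bullet> (G (x + t *\<^sub>R v) *v w)) has_real_derivative
     (\<Sum>i\<in>UNIV. v $ i * (u \<bullet> ((A ** dhess i h (x + t *\<^sub>R v) ** A) *v w)))) (at t)"
proof -
  let ?u = "A *v u" and ?w = "A *v w" and ?y = "x + t *\<^sub>R v"
  have "((\<lambda>t. \<Sum>j\<in>UNIV. \<Sum>k\<in>UNIV. ?u $ j * ?w $ k * pdiff j (pdiff k h) (x + t *\<^sub>R v)) has_real_derivative
      (\<Sum>j\<in>UNIV. \<Sum>k\<in>UNIV. ?u $ j * ?w $ k * (\<Sum>i\<in>UNIV. v $ i * pdiff i (pdiff j (pdiff k h)) ?y))) (at t)"
    by (intro DERIV_sum DERIV_cmult DERIV_along_line dom_differentiable assms)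
  also have "(\<Sum>j\<in>UNIV. \<Sum>k\<in>UNIV. ?u $ j * ?w $ k * (\<Sum>i\<in>UNIV. v $ i * pdiff i (pdiff j (pdiff k h)) ?y))
     = (\<Sum>j\<in>UNIV. \<Sum>i\<in>UNIV. \<Sum>k\<in>UNIV. ?u $ j * ?w $ k * (v $ i * pdiff i (pdiff j (pdiff k h)) ?y))"
    unfolding sum_distrib_left by (subst (2) sum.swap) simp
  also have "\<dots> = (\<Sum>i\<in>UNIV. \<Sum>j\<in>UNIV. \<Sum>k\<in>UNIV. ?u $ j * ?w $ k * (v $ i * pdiff i (pdiff j (pdiff k h)) ?y))"
    by (rule sum.swap)
  also have "\<dots> = (\<Sum>i\<in>UNIV. v $ i * (u \<bullet> ((A ** dhess i h ?y ** A) *v w)))"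
    unfolding inner_sandwich[OF A_sym] unfolding inner_matrix_vector_sum
    by (simp add: sum_distrib_left dhess_def mult_ac)
  finally show ?thesis
    unfolding G_def inner_sandwich[OF A_sym] unfolding inner_matrix_vector_sum by (simp add: hess_def)
qed

text \<open>Each coordinate of \<open>v\<close> is bounded by \<open>norm v\<close>; the factor
  \<open>CARD('p)\<close> counts the summands.\<close>

lemma G_line_deriv_bound:
  assumes "y \<in> \<Theta>"
  shows "\<bar>\<Sum>i\<in>UNIV. v $ i * (u \<bullet> ((A ** dhess i h y ** A) *v w))\<bar> \<le> real CARD('p) * \<tau> * norm v * norm u * norm w"
proof -
  have "\<bar>\<Sum>i\<in>UNIV. v $ i * (u \<bullet> ((A ** dhess i h y ** A) *v w))\<bar>
     \<le> (\<Sum>i\<in>UNIV. \<bar>v $ i * (u \<bullet> ((A ** dhess i h y ** A) *v w))\<bar>)" by (rule sum_abs)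
  also have "\<dots> \<le> (\<Sum>i\<in>(UNIV::'p set). norm v * (\<tau> * norm u * norm w))"
  proof (rule sum_mono)
    fix i
    have "\<bar>u \<bullet> ((A ** dhess i h y ** A) *v w)\<bar> \<le> norm (A ** dhess i h y ** A) * norm u * norm w"
      by (rule quadratic_form_le_norm)
    also have "\<dots> \<le> \<tau> * norm u * norm w" by (intro mult_right_mono \<tau> assms) auto
    finally show "\<bar>v $ i * (u \<bullet> ((A ** dhess i h y ** A) *v w))\<bar> \<le> norm v * (\<tau> * norm u * norm w)"
      unfolding abs_mult by (intro mult_mono component_le_norm_cart) auto
  qed
  also have "\<dots> = real CARD('p) * \<tau> * norm v * norm u * norm w" by simp
  finally show ?thesis .
qed

lemma segment_in_dom:
  assumes "x \<in> \<Theta>" "x + v \<in> \<Theta>" "0 \<le> t" "t \<le> 1"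
  shows "x + t *\<^sub>R v \<in> \<Theta>"
proof -
  have "(1 - t) *\<^sub>R x + t *\<^sub>R (x + v) \<in> \<Theta>"
    using assms by (intro convexD_alt[OF convex_dom]) auto
  then show ?thesis by (simp add: algebra_simps)
qed

lemma taylor2_dom:
  assumes "x \<in> \<Theta>" "x + A *v u \<in> \<Theta>"
  shows "\<exists>y\<in>\<Theta>. h (x + A *v u) = h x + (A *v grad h x) \<bullet> u + u \<bullet> (G y *v u) / 2"
proof -
  let ?v = "A *v u"
  have "\<exists>t. 0 < t \<and> t < 1 \<and> h (x + 1 *\<^sub>R ?v) = h (x + 0 *\<^sub>R ?v) + grad h (x + 0 *\<^sub>R ?v) \<bullet> ?v + ?v \<bullet> (hess h (x + t *\<^sub>R ?v) *v ?v) / 2"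
    by (rule taylor2_01; intro DERIV_line DERIV_grad_line segment_in_dom assms)
  then obtain t where t: "0 < t" "t < 1" "h (x + ?v) = h x + grad h x \<bullet> ?v + ?v \<bullet> (hess h (x + t *\<^sub>R ?v) *v ?v) / 2"
    by auto
  have "grad h x \<bullet> ?v = (A *v grad h x) \<bullet> u"
    using inner_matrix_sym[OF A_sym, of u "grad h x"] by (simp add: inner_commute)
  with t show ?thesis
    by (intro bexI[of _ "x + t *\<^sub>R ?v"] segment_in_dom assms) (auto simp: G_def inner_sandwich[OF A_sym])
qed

lemma score_bound: "\<bar>(A *v grad h \<theta>0) \<bullet> u\<bar> \<le> d * norm u"
  using order_trans[OF Cauchy_Schwarz_ineq2 mult_right_mono[OF d norm_ge_zero]] .

lemma d_nonneg: "0 \<le> d" by (rule order_trans[OF norm_ge_zero d])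
lemma S_nonneg: "0 \<le> S" by (rule order_trans[OF norm_ge_zero S[OF \<theta>0]])

section \<open>Quadratic bounds at \<theta>0 and the location of the maximizer\<close>

lemma h_lower:
  assumes "\<theta>0 + A *v u \<in> \<Theta>"
  shows "h \<theta>0 - d * norm u - S * (norm u)\<^sup>2 / 2 \<le> h (\<theta>0 + A *v u)"
proof -
  obtain y where y: "y \<in> \<Theta>" "h (\<theta>0 + A *v u) = h \<theta>0 + (A *v grad h \<theta>0) \<bullet> u + u \<bullet> (G y *v u) / 2"
    using taylor2_dom[OF \<theta>0 assms] by auto
  have "\<bar>u \<bullet> (G y *v u)\<bar> \<le> norm (G y) * norm u * norm u" by (rule quadratic_form_le_norm)
  also have "\<dots> \<le> S * norm u * norm u" unfolding G_def by (intro mult_right_mono S y) auto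
  finally have "\<bar>u \<bullet> (G y *v u)\<bar> \<le> S * (norm u)\<^sup>2" by (simp add: power2_eq_square)
  with y score_bound[of u] show ?thesis by (simp add: field_simps abs_le_iff)
qed

lemma h_upper:
  assumes "\<theta>0 + A *v u \<in> \<Theta>"
  shows "h (\<theta>0 + A *v u) \<le> h \<theta>0 + d * norm u - l * (norm u)\<^sup>2 / 2"
proof -
  obtain y where y: "y \<in> \<Theta>" "h (\<theta>0 + A *v u) = h \<theta>0 + (A *v grad h \<theta>0) \<bullet> u + u \<bullet> (G y *v u) / 2"
    using taylor2_dom[OF \<theta>0 assms] by auto
  from l_le[OF y(1), of u] y score_bound[of u] show ?thesis by (simp add: G_def field_simps abs_le_iff)
qed

definition uhat where "uhat = B *v (\<theta>m - \<theta>0)"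

lemma A_B [simp]: "A *v (B *v x) = x" "B *v (A *v x) = x"
  by (simp_all add: matrix_vector_mul_assoc AB BA)

lemma \<theta>0_uhat: "\<theta>0 + A *v uhat = \<theta>m" by (simp add: uhat_def)

text \<open>Taylor's formula gives \<open>h_upper\<close> on the open domain only. Both sides are
  continuous on the closure, so the inequality persists at a maximizer on the boundary.\<close>

lemma h_max_upper: "h \<theta>m \<le> h \<theta>0 + d * norm uhat - l * (norm uhat)\<^sup>2 / 2"
proof -
  have "h \<theta>m - d * norm (B *v (\<theta>m - \<theta>0)) + l * (norm (B *v (\<theta>m - \<theta>0)))\<^sup>2 / 2 \<le> h \<theta>0"
  proof (rule continuous_le_on_closure[OF _ \<theta>m])
    have "continuous_on (closure \<Theta>) (\<lambda>x. B *v (x - \<theta>0))"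
      by (intro continuous_on_compose2[OF linear_continuous_on[OF matrix_vector_mul_bounded_linear[of B], of UNIV]])
        (auto intro!: continuous_intros)
    then show "continuous_on (closure \<Theta>) (\<lambda>x. h x - d * norm (B *v (x - \<theta>0)) + l * (norm (B *v (x - \<theta>0)))\<^sup>2 / 2)"
      by (intro continuous_intros cont) auto
    fix x assume "x \<in> \<Theta>"
    then show "h x - d * norm (B *v (x - \<theta>0)) + l * (norm (B *v (x - \<theta>0)))\<^sup>2 / 2 \<le> h \<theta>0"
      using h_upper[of "B *v (x - \<theta>0)"] by simp
  qed
  then show ?thesis by (simp add: uhat_def)
qed

text \<open>The value at the maximizer is at least \<open>h \<theta>0\<close>, so the parabola in
  \<open>h_max_upper\<close> cannot be negative at \<open>norm uhat\<close>.\<close>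

lemma uhat_bound: "norm uhat \<le> 2 * d / l"
proof (cases "norm uhat = 0")
  case False
  then have p: "norm uhat > 0" by simp
  have "\<theta>0 \<in> closure \<Theta>" using \<theta>0 closure_subset by auto
  then have "h \<theta>0 \<le> h \<theta>m" by (rule max)
  with h_max_upper have "norm uhat * (l * norm uhat) \<le> norm uhat * (2 * d)"
    by (simp add: power2_eq_square algebra_simps)
  with p have "l * norm uhat \<le> 2 * d" by (simp only: mult_le_cancel_left_pos)
  then show ?thesis using l by (simp add: field_simps)
qed (use d_nonneg l in auto)

text \<open>The summand \<open>d\<^sup>2 / (2 * l)\<close> is the maximal height of the parabola in
  \<open>h_max_upper\<close>, found by completing the square.\<close>

lemma h_max_le: "h \<theta>m \<le> h \<theta>0 + d\<^sup>2 / (2 * l)"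
proof -
  have "0 \<le> (d - l * norm uhat)\<^sup>2" by simp
  then have "d * norm uhat - l * (norm uhat)\<^sup>2 / 2 \<le> d\<^sup>2 / (2 * l)"
    using l by (simp add: field_simps power2_eq_square)
  with h_max_upper show ?thesis by simp
qed

text \<open>Strong concavity along the segment that leaves the maximizer. No derivative at the
  starting point enters, so boundary maximizers are included.\<close>

lemma h_drop:
  assumes "\<theta>m + A *v u \<in> \<Theta>"
  shows "h (\<theta>m + A *v u) \<le> h \<theta>m - l * (norm u)\<^sup>2 / 2"
proof -
  let ?v = "A *v u"
  \<comment> \<open>In a convex set, the segment from a point of the closure to an interior point is
    interior except possibly at its start.\<close>
  have inT: "\<theta>m + t *\<^sub>R ?v \<in> \<Theta>" if "0 < t" "t \<le> 1" for t
  proof -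
    have "\<theta>m - t *\<^sub>R (\<theta>m - (\<theta>m + ?v)) \<in> interior \<Theta>"
      by (rule mem_interior_closure_convex_shrink[OF convex_dom _ \<theta>m])
        (use that assms open_dom in \<open>auto simp: interior_open\<close>)
    then show ?thesis using open_dom by (simp add: interior_open algebra_simps)
  qed
  have inC: "\<theta>m + t *\<^sub>R ?v \<in> closure \<Theta>" if "0 \<le> t" "t \<le> 1" for t
    using inT[of t] \<theta>m closure_subset that by (cases "t = 0") auto
  have "h (\<theta>m + 1 *\<^sub>R ?v) \<le> h (\<theta>m + 0 *\<^sub>R ?v) - (l * (norm u)\<^sup>2) / 2"
  proof (rule strongly_concave_max_drop)
    show "continuous_on {0..1} (\<lambda>t. h (\<theta>m + t *\<^sub>R ?v))"
      by (rule continuous_on_compose2[OF cont]) (auto intro!: continuous_intros inC)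
    fix t :: real assume t: "0 < t" "t \<le> 1"
    show "((\<lambda>t. h (\<theta>m + t *\<^sub>R ?v)) has_real_derivative (grad h (\<theta>m + t *\<^sub>R ?v) \<bullet> ?v)) (at t)"
      by (intro DERIV_line inT t)
    show "((\<lambda>t. grad h (\<theta>m + t *\<^sub>R ?v) \<bullet> ?v) has_real_derivative (?v \<bullet> (hess h (\<theta>m + t *\<^sub>R ?v) *v ?v))) (at t)"
      by (intro DERIV_grad_line inT t)
    show "?v \<bullet> (hess h (\<theta>m + t *\<^sub>R ?v) *v ?v) \<le> - (l * (norm u)\<^sup>2)"
      using l_le[OF inT[OF t], of u] by (simp add: inner_sandwich[OF A_sym])
    show "h (\<theta>m + t *\<^sub>R ?v) \<le> h (\<theta>m + 0 *\<^sub>R ?v)"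
      using max[OF inC[of t]] t by simp
  qed (use l in simp)
  then show ?thesis by simp
qed

text \<open>The mean value theorem along the segment turns the bound on third derivatives into a
  Lipschitz bound, which is what extends the Hessian to the boundary.\<close>

lemma G_lipschitz:
  assumes "x \<in> \<Theta>" "y \<in> \<Theta>"
  shows "\<bar>u \<bullet> (G y *v w) - u \<bullet> (G x *v w)\<bar> \<le> real CARD('p) * \<tau> * norm (y - x) * norm u * norm w"
proof -
  let ?v = "y - x"
  have "\<exists>z>0. z < 1 \<and> u \<bullet> (G (x + 1 *\<^sub>R ?v) *v w) - u \<bullet> (G (x + 0 *\<^sub>R ?v) *v w)
    = (1 - 0) * (\<Sum>i\<in>UNIV. ?v $ i * (u \<bullet> ((A ** dhess i h (x + z *\<^sub>R ?v) ** A) *v w)))"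
  proof (rule MVT2)
    fix t :: real assume t: "0 \<le> t" "t \<le> 1"
    show "((\<lambda>t. u \<bullet> (G (x + t *\<^sub>R ?v) *v w)) has_real_derivative
      (\<Sum>i\<in>UNIV. ?v $ i * (u \<bullet> ((A ** dhess i h (x + t *\<^sub>R ?v) ** A) *v w)))) (at t)"
      by (rule DERIV_G_line, rule segment_in_dom) (use assms t in auto)
  qed simp
  then obtain z where z: "0 < z" "z < 1" "u \<bullet> (G y *v w) - u \<bullet> (G x *v w)
    = (\<Sum>i\<in>UNIV. ?v $ i * (u \<bullet> ((A ** dhess i h (x + z *\<^sub>R ?v) ** A) *v w)))" by auto
  show ?thesis
    unfolding z(3) by (rule G_line_deriv_bound) (use z assms in \<open>auto intro!: segment_in_dom\<close>)
qed

section \<open>The Hessian at the maximizer\<close>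

lemma hess_eq_G: "hess h x = B ** G x ** B"
proof -
  have "B ** G x ** B = (B ** A) ** hess h x ** (A ** B)"
    by (simp add: G_def matrix_mul_assoc)
  then show ?thesis by (simp add: AB BA)
qed

lemma at_max_nontrivial: "at \<theta>m within \<Theta> \<noteq> bot"
proof (cases "\<theta>m \<in> \<Theta>")
  case True
  then show ?thesis using open_dom by (auto simp: trivial_limit_within intro: open_imp_islimpt)
next
  case False
  then show ?thesis using \<theta>m by (auto simp: trivial_limit_within closure_def)
qed

text \<open>At a boundary point \<open>hess_cl\<close> is a \<open>Lim\<close>, which is meaningful
  only if the limit exists. The entries of \<open>G\<close> are Lipschitz, hence uniformly
  continuous, hence extend to the closure; undoing the normalization by \<open>B\<close> gives the
  limit of the Hessian.\<close>

lemma hess_tendsto_hess_cl: "(hess h \<longlongrightarrow> hess_cl \<Theta> h \<theta>m) (at \<theta>m within \<Theta>)"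
proof -
  have "\<exists>L. ((\<lambda>x. G x $ i $ j) \<longlongrightarrow> L) (at \<theta>m within \<Theta>)" for i j
  proof -
    have en: "G x $ i $ j = axis i 1 \<bullet> (G x *v axis j 1)" for x
      by (simp add: inner_axis' matrix_vector_mult_basis column_def)
    \<comment> \<open>The added one keeps the divisor in \<open>e / K\<close> positive when
      \<open>\<tau> = 0\<close>.\<close>
    define K where "K = real CARD('p) * \<tau> + 1"
    have K: "K > 0" using order_trans[OF norm_ge_zero \<tau>[OF \<theta>0]] by (auto simp: K_def intro: add_nonneg_pos)
    have lip: "dist (G x $ i $ j) (G y $ i $ j) \<le> K * dist x y" if "x \<in> \<Theta>" "y \<in> \<Theta>" for x y
    proof -
      have "dist (G x $ i $ j) (G y $ i $ j) \<le> real CARD('p) * \<tau> * dist x y"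
        using G_lipschitz[OF that(2,1), of "axis i 1" "axis j 1"] by (simp add: en dist_norm)
      also have "\<dots> \<le> K * dist x y" by (simp add: K_def mult_right_mono)
      finally show ?thesis .
    qed
    have "uniformly_continuous_on \<Theta> (\<lambda>x. G x $ i $ j)"
      unfolding uniformly_continuous_on_def
    proof (intro allI impI)
      fix e :: real assume e: "e > 0"
      show "\<exists>d>0. \<forall>x\<in>\<Theta>. \<forall>x'\<in>\<Theta>. dist x' x < d \<longrightarrow> dist (G x' $ i $ j) (G x $ i $ j) < e"
      proof (intro exI[of _ "e / K"] conjI ballI impI)
        fix x x' assume x: "x \<in> \<Theta>" "x' \<in> \<Theta>" "dist x' x < e / K"
        have "dist (G x' $ i $ j) (G x $ i $ j) \<le> K * dist x' x" using x by (intro lip)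
        also have "\<dots> < e" using x K by (simp add: field_simps)
        finally show "dist (G x' $ i $ j) (G x $ i $ j) < e" .
      qed (use e K in simp)
    qed
    from uniformly_continuous_on_extension_at_closure[OF this \<theta>m] show ?thesis by metis
  qed
  then obtain L where L: "\<And>i j. ((\<lambda>x. G x $ i $ j) \<longlongrightarrow> L i j) (at \<theta>m within \<Theta>)" by metis
  then have "(G \<longlongrightarrow> (\<chi> i j. L i j)) (at \<theta>m within \<Theta>)"
    by (simp add: tendsto_matrix_entries)
  then have "((\<lambda>x. B ** G x ** B) \<longlongrightarrow> B ** (\<chi> i j. L i j) ** B) (at \<theta>m within \<Theta>)"
    by (intro tendsto_intros)
  then have H: "(hess h \<longlongrightarrow> B ** (\<chi> i j. L i j) ** B) (at \<theta>m within \<Theta>)"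
    by (simp flip: hess_eq_G)
  show ?thesis
  proof (cases "\<theta>m \<in> \<Theta>")
    case True
    have "isCont (\<lambda>x. pdiff i (pdiff j h) x) \<theta>m" for i j
      by (intro differentiable_imp_continuous_within dom_differentiable True)
    then have "((\<lambda>x. hess h x $ i $ j) \<longlongrightarrow> hess h \<theta>m $ i $ j) (at \<theta>m)" for i j
      by (simp add: hess_def isCont_def)
    then have "(hess h \<longlongrightarrow> hess h \<theta>m) (at \<theta>m)" by (simp add: tendsto_matrix_entries)
    then show ?thesis using True by (auto simp: hess_cl_def intro: tendsto_within_subset)
  next
    case False
    then show ?thesis using H tendsto_Lim[OF at_max_nontrivial H] by (simp add: hess_cl_def)
  qed
qed

text \<open>The sequential form required for measurability of the random Hessian. Unlike the
  punctured filter, the sequence may hit \<open>\<theta>m\<close> itself when that point lies in the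
  domain, hence the case distinction.\<close>

lemma hess_seq_tendsto_hess_cl:
  assumes s: "\<And>m. s m \<in> \<Theta>" "s \<longlonglongrightarrow> \<theta>m"
  shows "(\<lambda>m. hess h (s m)) \<longlonglongrightarrow> hess_cl \<Theta> h \<theta>m"
proof (cases "\<theta>m \<in> \<Theta>")
  case True
  then have "isCont (hess h) \<theta>m"
    using hess_tendsto_hess_cl at_within_open[OF True open_dom] by (simp add: hess_cl_def isCont_def)
  from isCont_tendsto_compose[OF this s(2)] show ?thesis using True by (simp add: hess_cl_def)
next
  case False
  with s have "\<forall>m. s m \<in> \<Theta> - {\<theta>m}" by auto
  then show ?thesis
    using hess_tendsto_hess_cl s(2) unfolding tendsto_at_iff_sequentially comp_def by blast
qed

definition Ghat where "Ghat = - (A ** hess_cl \<Theta> h \<theta>m ** A)"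

lemma G_tendsto: "((\<lambda>x. - G x) \<longlongrightarrow> Ghat) (at \<theta>m within \<Theta>)"
  unfolding G_def Ghat_def by (intro tendsto_intros hess_tendsto_hess_cl)

lemma eventually_dom: "(\<And>x. x \<in> \<Theta> \<Longrightarrow> P x) \<Longrightarrow> \<forall>\<^sub>F x in at \<theta>m within \<Theta>. P x"
  by (simp add: eventually_at_filter)

text \<open>Symmetry, like the form bounds that follow, holds at every point of the domain and
  passes to the limit.\<close>

lemma Ghat_sym: "transpose Ghat = Ghat"
proof -
  have "Ghat $ i $ j = Ghat $ j $ i" for i j
  proof (rule tendsto_unique[OF at_max_nontrivial])
    show "((\<lambda>x. (- G x) $ i $ j) \<longlongrightarrow> Ghat $ i $ j) (at \<theta>m within \<Theta>)"
      using G_tendsto unfolding tendsto_matrix_entries by blast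
    have "((\<lambda>x. (- G x) $ j $ i) \<longlongrightarrow> Ghat $ j $ i) (at \<theta>m within \<Theta>)"
      using G_tendsto unfolding tendsto_matrix_entries by blast
    moreover have "\<forall>\<^sub>F x in at \<theta>m within \<Theta>. (- G x) $ j $ i = (- G x) $ i $ j"
    proof (rule eventually_dom)
      fix x assume "x \<in> \<Theta>"
      from G_sym[OF this] have "transpose (G x) $ j $ i = G x $ j $ i" by simp
      then show "(- G x) $ j $ i = (- G x) $ i $ j" by (simp add: transpose_def)
    qed
    ultimately show "((\<lambda>x. (- G x) $ i $ j) \<longlongrightarrow> Ghat $ j $ i) (at \<theta>m within \<Theta>)"
      by (rule Lim_transform_eventually)
  qed
  then show ?thesis by (simp add: transpose_def vec_eq_iff)
qed

lemma Ghat_ge: "l * (norm u)\<^sup>2 \<le> u \<bullet> (Ghat *v u)"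
proof (rule tendsto_lowerbound[OF _ _ at_max_nontrivial])
  show "((\<lambda>x. u \<bullet> ((- G x) *v u)) \<longlongrightarrow> u \<bullet> (Ghat *v u)) (at \<theta>m within \<Theta>)"
    by (intro tendsto_intros G_tendsto)
  show "\<forall>\<^sub>F x in at \<theta>m within \<Theta>. l * (norm u)\<^sup>2 \<le> u \<bullet> ((- G x) *v u)"
    by (rule eventually_dom) (use l_le in \<open>simp add: G_def matrix_vector_uminus\<close>)
qed

lemma Ghat_le: "u \<bullet> (Ghat *v u) \<le> S * (norm u)\<^sup>2"
proof (rule tendsto_upperbound[OF _ _ at_max_nontrivial])
  show "((\<lambda>x. u \<bullet> ((- G x) *v u)) \<longlongrightarrow> u \<bullet> (Ghat *v u)) (at \<theta>m within \<Theta>)"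
    by (intro tendsto_intros G_tendsto)
  show "\<forall>\<^sub>F x in at \<theta>m within \<Theta>. u \<bullet> ((- G x) *v u) \<le> S * (norm u)\<^sup>2"
  proof (rule eventually_dom)
    fix x assume x: "x \<in> \<Theta>"
    have "\<bar>u \<bullet> (G x *v u)\<bar> \<le> norm (G x) * norm u * norm u" by (rule quadratic_form_le_norm)
    also have "\<dots> \<le> S * norm u * norm u" unfolding G_def by (intro mult_right_mono S x) auto
    finally show "u \<bullet> ((- G x) *v u) \<le> S * (norm u)\<^sup>2"
      by (simp add: power2_eq_square matrix_vector_uminus abs_le_iff mult_ac)
  qed
qed

lemma Ghat_pos: "u \<noteq> 0 \<Longrightarrow> 0 < u \<bullet> (Ghat *v u)"
  using Ghat_ge[of u] l by (smt (verit) mult_pos_pos zero_less_norm_iff zero_less_power)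

lemma det_Ghat: "l ^ CARD('p) \<le> det Ghat" "det Ghat \<le> S ^ CARD('p)" "0 < det Ghat"
  using det_ge_quadratic_form[OF Ghat_sym l Ghat_ge] det_le_quadratic_form[OF Ghat_sym l Ghat_ge Ghat_le]
    pos_def_det_pos[OF Ghat_sym Ghat_pos] by auto

lemma det_A: "det A \<noteq> 0"
proof
  assume "det A = 0"
  then have "det (A ** B) = 0" by (simp add: det_mul)
  then show False by (simp add: AB)
qed

lemma det_uminus_hess_cl: "det (- hess_cl \<Theta> h \<theta>m) = det Ghat / (det A)\<^sup>2"
proof -
  have "Ghat = A ** (- hess_cl \<Theta> h \<theta>m) ** A"
    by (simp add: Ghat_def vec_eq_iff matrix_matrix_mult_def sum_negf sum_distrib_right)
  then have "det Ghat = det A * det (- hess_cl \<Theta> h \<theta>m) * det A" by (simp add: det_mul)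
  then show ?thesis using det_A by (simp add: field_simps power2_eq_square)
qed

section \<open>Expansion at an interior maximizer\<close>

lemma grad_max:
  assumes "\<theta>m \<in> \<Theta>"
  shows "grad h \<theta>m \<bullet> v = 0"
proof -
  obtain r where r: "r > 0" "ball \<theta>m r \<subseteq> \<Theta>" using open_dom assms openE by blast
  define \<delta> where "\<delta> = r / (norm v + 1)"
  have \<delta>: "\<delta> > 0" using r by (simp add: \<delta>_def add_nonneg_pos)
  have D: "((\<lambda>t. h (\<theta>m + t *\<^sub>R v)) has_real_derivative (grad h (\<theta>m + 0 *\<^sub>R v) \<bullet> v)) (at 0)"
    using assms by (intro DERIV_line) simp
  have "grad h (\<theta>m + 0 *\<^sub>R v) \<bullet> v = 0"
  proof (rule DERIV_local_max[OF D \<delta>], intro allI impI)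
    fix t :: real assume t: "\<bar>0 - t\<bar> < \<delta>"
    have "\<bar>t\<bar> * norm v \<le> \<bar>t\<bar> * (norm v + 1)" by (intro mult_left_mono) auto
    also have "\<dots> < \<delta> * (norm v + 1)" using t by (intro mult_strict_right_mono) (auto intro: add_nonneg_pos)
    also have "\<dots> = r" by (simp add: \<delta>_def add_nonneg_eq_0_iff)
    finally have "\<theta>m + t *\<^sub>R v \<in> ball \<theta>m r" by (simp add: dist_norm)
    then have "\<theta>m + t *\<^sub>R v \<in> closure \<Theta>" using r(2) closure_subset[of \<Theta>] by blast
    from max[OF this] show "h (\<theta>m + t *\<^sub>R v) \<le> h (\<theta>m + 0 *\<^sub>R v)" by simp
  qed
  then show ?thesis by simp
qed

text \<open>The linear term vanishes at an interior maximizer. Third derivatives are normalized by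
  only two factors \<open>A\<close>; the third direction remains \<open>A *v u\<close>, of norm at
  most \<open>\<alpha> * norm u\<close>, and this factor makes the remainder vanish as the rates
  do.\<close>

lemma h_quadratic_approx:
  assumes "\<theta>m \<in> \<Theta>" "\<theta>m + A *v u \<in> \<Theta>"
  shows "\<bar>h (\<theta>m + A *v u) - h \<theta>m + u \<bullet> (Ghat *v u) / 2\<bar> \<le> real CARD('p) * \<tau> * \<alpha> * (norm u) ^ 3"
proof -
  let ?v = "A *v u"
  have G0: "v \<bullet> (hess h y *v v) = u \<bullet> (G y *v u)" if "v = ?v" for v y
    by (simp add: that G_def inner_sandwich[OF A_sym])
  have "\<exists>t. 0 < t \<and> t < 1 \<and> h (\<theta>m + 1 *\<^sub>R ?v) = h (\<theta>m + 0 *\<^sub>R ?v) + grad h (\<theta>m + 0 *\<^sub>R ?v) \<bullet> ?v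
     + u \<bullet> (G (\<theta>m + 0 *\<^sub>R ?v) *v u) / 2 + (\<Sum>i\<in>UNIV. ?v $ i * (u \<bullet> ((A ** dhess i h (\<theta>m + t *\<^sub>R ?v) ** A) *v u))) / 6"
  proof (rule taylor3_01)
    fix t :: real assume t: "0 \<le> t" "t \<le> 1"
    note s = segment_in_dom[OF assms t]
    show "((\<lambda>t. h (\<theta>m + t *\<^sub>R ?v)) has_real_derivative grad h (\<theta>m + t *\<^sub>R ?v) \<bullet> ?v) (at t)"
      by (rule DERIV_line[OF s])
    show "((\<lambda>t. grad h (\<theta>m + t *\<^sub>R ?v) \<bullet> ?v) has_real_derivative u \<bullet> (G (\<theta>m + t *\<^sub>R ?v) *v u)) (at t)"
      using DERIV_grad_line[OF s] by (simp add: G0)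
    show "((\<lambda>t. u \<bullet> (G (\<theta>m + t *\<^sub>R ?v) *v u)) has_real_derivative
      (\<Sum>i\<in>UNIV. ?v $ i * (u \<bullet> ((A ** dhess i h (\<theta>m + t *\<^sub>R ?v) ** A) *v u)))) (at t)"
      by (rule DERIV_G_line[OF s])
  qed
  then obtain t where t: "0 < t" "t < 1" "h (\<theta>m + ?v) = h \<theta>m + grad h \<theta>m \<bullet> ?v
     + u \<bullet> (G \<theta>m *v u) / 2 + (\<Sum>i\<in>UNIV. ?v $ i * (u \<bullet> ((A ** dhess i h (\<theta>m + t *\<^sub>R ?v) ** A) *v u))) / 6"
    by auto
  define R where "R = (\<Sum>i\<in>UNIV. ?v $ i * (u \<bullet> ((A ** dhess i h (\<theta>m + t *\<^sub>R ?v) ** A) *v u)))"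
  have "Ghat = - G \<theta>m" using assms by (simp add: Ghat_def G_def hess_cl_def)
  then have "h (\<theta>m + ?v) - h \<theta>m + u \<bullet> (Ghat *v u) / 2 = R / 6"
    using t(3) grad_max[OF assms(1)] by (simp add: R_def matrix_vector_uminus)
  then have "\<bar>h (\<theta>m + ?v) - h \<theta>m + u \<bullet> (Ghat *v u) / 2\<bar> \<le> \<bar>R\<bar>" by simp
  also have "\<dots> \<le> real CARD('p) * \<tau> * norm ?v * norm u * norm u"
    unfolding R_def by (intro G_line_deriv_bound segment_in_dom assms) (use t in auto)
  also have "\<dots> \<le> real CARD('p) * \<tau> * (\<alpha> * norm u) * norm u * norm u"
    using order_trans[OF norm_ge_zero \<tau>[OF \<theta>0]] by (intro mult_right_mono mult_left_mono A_norm) auto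
  finally show ?thesis by (simp add: power3_eq_cube mult_ac)
qed

end

section \<open>Laplace approximation\<close>

text \<open>The difference in the theorem for a single outcome, as a function of the realized
  likelihood and its maximizer.\<close>

definition bic_gap :: "(real^'p::finite) set \<Rightarrow> (real^'p \<Rightarrow> real) \<Rightarrow> (real^'p \<Rightarrow> real) \<Rightarrow> real^'p \<Rightarrow> real" where
  "bic_gap \<Theta> h \<pi> \<theta>m = - 2 * ln (LINT \<theta>:\<Theta>|lborel. exp (h \<theta>) * \<pi> \<theta>)
     - (- 2 * h \<theta>m + ln (det (- hess_cl \<Theta> h \<theta>m)) - 2 * ln (\<pi> \<theta>m) - real CARD('p) * ln (2 * pi))"

locale regular_bayes = regular_likelihood \<Theta> A B h \<theta>0 \<theta>m d S \<tau> l \<alpha>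
  for \<Theta> :: "(real^'p::finite) set" and A B h \<theta>0 \<theta>m d S \<tau> l \<alpha> +
  fixes \<pi> :: "real^'p \<Rightarrow> real" and c1 c2 :: real
  assumes \<pi>_meas: "\<pi> \<in> borel_measurable (restrict_space borel (closure \<Theta>))"
    and c1: "c1 > 0" and \<pi>_ge: "\<And>\<theta>. \<theta> \<in> closure \<Theta> \<Longrightarrow> c1 \<le> \<pi> \<theta>" and \<pi>_le: "\<And>\<theta>. \<theta> \<in> closure \<Theta> \<Longrightarrow> \<pi> \<theta> \<le> c2"
begin

text \<open>Centring at the maximizer and dividing by \<open>exp (h \<theta>m)\<close> keeps the
  exponential factor at most one, with the Gaussian decay given by \<open>h_drop\<close>.\<close>

definition F where "F u = indicator \<Theta> (\<theta>m + A *v u) * (exp (h (\<theta>m + A *v u) - h \<theta>m) * \<pi> (\<theta>m + A *v u))"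
definition J where "J = (LINT u|lborel. F u)"

lemma dom_closure: "x \<in> \<Theta> \<Longrightarrow> x \<in> closure \<Theta>"
  using closure_subset by auto

lemma c2: "c2 > 0" "c1 \<le> c2"
  using \<pi>_ge[OF \<theta>m] \<pi>_le[OF \<theta>m] c1 by auto

lemma prior_max_pos: "\<pi> \<theta>m > 0"
  using \<pi>_ge[OF \<theta>m] c1 by simp

lemma integrand_measurable:
  assumes g: "continuous_on \<Theta> g"
  shows "(\<lambda>\<theta>. indicator \<Theta> \<theta> * (g \<theta> * \<pi> \<theta>)) \<in> borel_measurable borel"
proof -
  have "\<pi> \<in> borel_measurable (restrict_space borel \<Theta>)"
    by (rule measurable_restrict_mono[OF \<pi>_meas closure_subset])
  moreover have "g \<in> borel_measurable (restrict_space borel \<Theta>)"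
    using g by (rule borel_measurable_continuous_on_restrict)
  ultimately have "(\<lambda>\<theta>. g \<theta> * \<pi> \<theta>) \<in> borel_measurable (restrict_space borel \<Theta>)"
    by (intro borel_measurable_times)
  then show ?thesis
    using open_dom by (subst (asm) borel_measurable_restrict_space_iff) auto
qed

lemma h_cont_dom: "continuous_on \<Theta> h"
  using cont closure_subset by (rule continuous_on_subset)

lemma F_measurable [measurable]: "F \<in> borel_measurable borel"
proof -
  have [measurable]: "(\<lambda>\<theta>. indicator \<Theta> \<theta> * (exp (h \<theta> - h \<theta>m) * \<pi> \<theta>)) \<in> borel_measurable borel"
    by (intro integrand_measurable continuous_intros h_cont_dom)
  have "(\<lambda>u. (\<lambda>\<theta>. indicator \<Theta> \<theta> * (exp (h \<theta> - h \<theta>m) * \<pi> \<theta>)) (\<theta>m + A *v u)) \<in> borel_measurable borel"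
    by measurable
  then show ?thesis by (simp add: F_def[abs_def])
qed

lemma F_nonneg: "0 \<le> F u"
proof (cases "\<theta>m + A *v u \<in> \<Theta>")
  case True
  then show ?thesis using \<pi>_ge[OF dom_closure[OF True]] c1 by (simp add: F_def)
qed (simp add: F_def)

lemma F_le: "F u \<le> c2 * exp (- (l * (norm u)\<^sup>2) / 2)"
proof (cases "\<theta>m + A *v u \<in> \<Theta>")
  case True
  have "exp (h (\<theta>m + A *v u) - h \<theta>m) * \<pi> (\<theta>m + A *v u) \<le> exp (- (l * (norm u)\<^sup>2) / 2) * c2"
    using h_drop[OF True] \<pi>_ge[OF dom_closure[OF True]] c1
    by (intro mult_mono \<pi>_le dom_closure True) auto
  then show ?thesis using True by (simp add: F_def mult.commute)
next
  case False
  then show ?thesis using c2 by (simp add: F_def)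
qed

lemma gaussian_l: "has_bochner_integral lborel (\<lambda>u::real^'p. exp (- (l * (norm u)\<^sup>2) / 2)) (sqrt (2 * pi) ^ CARD('p) / sqrt (l ^ CARD('p)))"
  by (rule has_bochner_integral_gaussian_iso[OF l])

lemma F_integrable: "integrable lborel F"
proof (rule Bochner_Integration.integrable_bound)
  show "integrable lborel (\<lambda>u::real^'p. c2 * exp (- (l * (norm u)\<^sup>2) / 2))"
    using gaussian_l by (intro integrable_mult_right) (simp add: has_bochner_integral_iff)
qed (use F_nonneg F_le c2 in \<open>auto simp: abs_of_nonneg\<close>)

lemma J_le: "J \<le> c2 * (sqrt (2 * pi) ^ CARD('p) / sqrt (l ^ CARD('p)))"
proof -
  have "J \<le> (LINT u|(lborel :: (real^'p) measure). c2 * exp (- (l * (norm u)\<^sup>2) / 2))"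
    unfolding J_def using gaussian_l
    by (intro integral_mono F_integrable integrable_mult_right F_le) (simp add: has_bochner_integral_iff)
  also have "\<dots> = c2 * (sqrt (2 * pi) ^ CARD('p) / sqrt (l ^ CARD('p)))"
    using gaussian_l by (simp add: has_bochner_integral_iff)
  finally show ?thesis .
qed

text \<open>The integral is restricted to the ball around \<open>- uhat\<close>, that is, to the
  points \<open>\<theta>0 + A *v w\<close> with \<open>norm w < \<rho>\<close>, where
  \<open>h_lower\<close> applies. The summand \<open>d\<^sup>2 / (2 * l)\<close> pays for replacing
  \<open>h \<theta>0\<close> by \<open>h \<theta>m\<close>.\<close>

lemma J_ge:
  assumes \<rho>: "\<rho> > 0" and ball: "\<And>u. norm u < \<rho> \<Longrightarrow> \<theta>0 + A *v u \<in> \<Theta>"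
  shows "c1 * measure lborel (ball (0::real^'p) \<rho>) * exp (- (d * \<rho> + S * \<rho>\<^sup>2 / 2 + d\<^sup>2 / (2 * l))) \<le> J"
proof -
  define k where "k = c1 * exp (- (d * \<rho> + S * \<rho>\<^sup>2 / 2 + d\<^sup>2 / (2 * l)))"
  have "k * measure lborel (ball (0::real^'p) \<rho>) = k * measure lborel (ball (- uhat) \<rho>)"
    using \<rho> content_ball[of \<rho> "0::real^'p"] content_ball[of \<rho> "- uhat"] by simp
  also have "\<dots> = (LINT u|lborel. k * indicator (ball (- uhat) \<rho>) u)" by simp
  also have "\<dots> \<le> J"
    unfolding J_def
  proof (rule integral_mono)
    show "integrable lborel (\<lambda>u. k * indicator (ball (- uhat) \<rho>) u)"
      using emeasure_bounded_finite[OF bounded_ball, of "- uhat" \<rho>] by (intro integrable_mult_right integrable_real_indicator) auto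
    fix u show "k * indicator (ball (- uhat) \<rho>) u \<le> F u"
    proof (cases "u \<in> ball (- uhat) \<rho>")
      case True
      define w where "w = u + uhat"
      have w: "norm w < \<rho>" using True by (simp add: w_def dist_norm norm_minus_commute add.commute norm_uminus_minus)
      have eq: "\<theta>m + A *v u = \<theta>0 + A *v w"
        using \<theta>0_uhat by (simp add: w_def matrix_vector_right_distrib)
      have inT: "\<theta>m + A *v u \<in> \<Theta>" unfolding eq by (rule ball[OF w])
      have "d * norm w \<le> d * \<rho>" "S * (norm w)\<^sup>2 \<le> S * \<rho>\<^sup>2"
        using w d_nonneg S_nonneg by (auto intro!: mult_left_mono power_mono)
      then have "- (d * \<rho> + S * \<rho>\<^sup>2 / 2 + d\<^sup>2 / (2 * l)) \<le> h (\<theta>m + A *v u) - h \<theta>m"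
        using h_lower[of w] h_max_le inT unfolding eq by linarith
      then have "c1 * exp (- (d * \<rho> + S * \<rho>\<^sup>2 / 2 + d\<^sup>2 / (2 * l))) \<le> \<pi> (\<theta>m + A *v u) * exp (h (\<theta>m + A *v u) - h \<theta>m)"
        using c1 \<pi>_ge[OF dom_closure[OF inT]] by (intro mult_mono) auto
      then show ?thesis using True inT by (simp add: k_def F_def mult.commute)
    qed (simp add: F_nonneg)
  qed (rule F_integrable)
  finally show ?thesis by (simp add: k_def mult_ac)
qed

text \<open>A radius for one fixed stage, enough for positivity of \<open>J\<close>. The
  quantitative bound takes its radius as a parameter, so that one radius can serve all
  stages.\<close>

lemma ex_ball: "\<exists>\<rho>>0. \<forall>u. norm u < \<rho> \<longrightarrow> \<theta>0 + A *v u \<in> \<Theta>"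
proof -
  obtain r where r: "r > 0" "ball \<theta>0 r \<subseteq> \<Theta>" using open_dom \<theta>0 openE by blast
  define \<rho> where "\<rho> = r / (\<bar>\<alpha>\<bar> + 1)"
  have p: "\<bar>\<alpha>\<bar> + 1 > 0" by simp
  have "\<theta>0 + A *v u \<in> \<Theta>" if "norm u < \<rho>" for u
  proof -
    have "norm (A *v u) \<le> \<alpha> * norm u" by (rule A_norm)
    also have "\<dots> \<le> (\<bar>\<alpha>\<bar> + 1) * norm u" by (intro mult_right_mono) auto
    also have "\<dots> < r" using that p by (simp add: \<rho>_def field_simps)
    finally show ?thesis using r by (auto simp: subset_eq dist_norm)
  qed
  then show ?thesis using r p by (intro exI[of _ \<rho>]) (auto simp: \<rho>_def)
qed

lemma J_pos: "J > 0"
proof -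
  obtain \<rho> where \<rho>: "\<rho> > 0" "\<And>u. norm u < \<rho> \<Longrightarrow> \<theta>0 + A *v u \<in> \<Theta>" using ex_ball by blast
  have "0 < c1 * measure lborel (ball (0::real^'p) \<rho>) * exp (- (d * \<rho> + S * \<rho>\<^sup>2 / 2 + d\<^sup>2 / (2 * l)))"
    using c1 content_ball_pos[OF \<rho>(1), of "0::real^'p"] by simp
  also have "\<dots> \<le> J" by (rule J_ge[OF \<rho>])
  finally show ?thesis .
qed

lemma marginal_eq: "(LINT \<theta>:\<Theta>|lborel. exp (h \<theta>) * \<pi> \<theta>) = \<bar>det A\<bar> * exp (h \<theta>m) * J"
proof -
  have [measurable]: "(\<lambda>\<theta>. indicator \<Theta> \<theta> * (exp (h \<theta>) * \<pi> \<theta>)) \<in> borel_measurable borel"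
    by (intro integrand_measurable continuous_intros h_cont_dom)
  have "(LINT \<theta>:\<Theta>|lborel. exp (h \<theta>) * \<pi> \<theta>) = (LINT \<theta>|lborel. indicator \<Theta> \<theta> * (exp (h \<theta>) * \<pi> \<theta>))"
    by (simp add: set_lebesgue_integral_def)
  also have "\<dots> = (LINT \<theta>|density (distr lborel borel (\<lambda>u. \<theta>m + A *v u)) (\<lambda>_. ennreal \<bar>det A\<bar>). indicator \<Theta> \<theta> * (exp (h \<theta>) * \<pi> \<theta>))"
    by (subst lborel_linear[OF det_A, of \<theta>m]) simp
  also have "\<dots> = \<bar>det A\<bar> * (LINT u|lborel. indicator \<Theta> (\<theta>m + A *v u) * (exp (h (\<theta>m + A *v u)) * \<pi> (\<theta>m + A *v u)))"
    by (subst integral_density) (simp_all add: integral_distr)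
  also have "(\<lambda>u. indicator \<Theta> (\<theta>m + A *v u) * (exp (h (\<theta>m + A *v u)) * \<pi> (\<theta>m + A *v u))) = (\<lambda>u. exp (h \<theta>m) * F u)"
    by (auto simp: F_def fun_eq_iff exp_diff)
  finally show ?thesis by (simp add: J_def)
qed

lemma bic_gap_eq: "bic_gap \<Theta> h \<pi> \<theta>m = - 2 * ln J - ln (det Ghat) + 2 * ln (\<pi> \<theta>m) + real CARD('p) * ln (2 * pi)"
proof -
  have "ln (det Ghat / (det A)\<^sup>2) = ln (det Ghat) - 2 * ln \<bar>det A\<bar>"
    using det_A det_Ghat(3) ln_realpow[of "\<bar>det A\<bar>" 2] by (simp add: ln_div)
  then show ?thesis
    unfolding bic_gap_def marginal_eq det_uminus_hess_cl
    using J_pos det_A by (simp add: ln_mult)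
qed

text \<open>Lower and upper bounds for \<open>J\<close> and \<open>det Ghat\<close> are combined.
  The estimates \<open>ln S \<le> S\<close> and \<open>- ln l \<le> 1 / l\<close> turn the
  logarithms into quantities controlled by moments.\<close>

lemma bic_gap_bound:
  assumes \<rho>: "\<rho> > 0" and ball: "\<And>u. norm u < \<rho> \<Longrightarrow> \<theta>0 + A *v u \<in> \<Theta>"
  shows "\<bar>bic_gap \<Theta> h \<pi> \<theta>m\<bar> \<le> (2 * \<bar>ln (c1 * measure lborel (ball (0::real^'p) \<rho>))\<bar> + 2 * \<bar>ln c1\<bar> + 2 * \<bar>ln c2\<bar> + real CARD('p) * \<bar>ln (2 * pi)\<bar>)
     + 2 * \<rho> * d + (\<rho>\<^sup>2 + real CARD('p)) * S + d\<^sup>2 / l + real CARD('p) / l"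
proof -
  let ?V = "measure lborel (ball (0::real^'p) \<rho>)" and ?p = "real CARD('p)"
  have V: "?V > 0" by (rule content_ball_pos[OF \<rho>])
  have "ln (c1 * ?V) - (d * \<rho> + S * \<rho>\<^sup>2 / 2 + d\<^sup>2 / (2 * l)) = ln (c1 * ?V * exp (- (d * \<rho> + S * \<rho>\<^sup>2 / 2 + d\<^sup>2 / (2 * l))))"
    using c1 V by (subst ln_mult) auto
  also have "\<dots> \<le> ln J" using J_ge[OF \<rho> ball] c1 V J_pos by (subst ln_le_cancel_iff) auto
  finally have J1: "ln (c1 * ?V) - (d * \<rho> + S * \<rho>\<^sup>2 / 2 + d\<^sup>2 / (2 * l)) \<le> ln J" .
  have "ln J \<le> ln (c2 * (sqrt (2 * pi) ^ CARD('p) / sqrt (l ^ CARD('p))))"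
    using J_le J_pos order_less_le_trans[OF J_pos J_le] by (subst ln_le_cancel_iff)
  also have "\<dots> = ln c2 + ?p * ln (2 * pi) / 2 - ?p * ln l / 2"
    using c2 l by (simp add: ln_mult ln_div ln_realpow ln_sqrt field_simps)
  finally have J2: "ln J \<le> ln c2 + ?p * ln (2 * pi) / 2 - ?p * ln l / 2" .
  have Sl: "S > 0"
    using Ghat_le[of "axis undefined 1"] Ghat_ge[of "axis undefined 1"] l by simp
  have li: "- ln l \<le> 1 / l" using ln_le_minus_one[of "1 / l"] l by (simp add: ln_div)
  then have pl: "- (?p * ln l) \<le> ?p / l"
    using mult_left_mono[OF li, of ?p] by simp
  have ls: "ln S \<le> S" using ln_le_minus_one[OF Sl] by simp
  have D1: "?p * ln l \<le> ln (det Ghat)"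
    using det_Ghat l by (subst ln_realpow[symmetric]) (auto simp: ln_le_cancel_iff)
  have "ln (det Ghat) \<le> ?p * ln S"
    using det_Ghat Sl by (subst ln_realpow[symmetric]) (auto simp: ln_le_cancel_iff)
  also have "\<dots> \<le> ?p * S" by (intro mult_left_mono ls) simp
  finally have D2: "ln (det Ghat) \<le> ?p * S" .
  have P1: "ln c1 \<le> ln (\<pi> \<theta>m)" "ln (\<pi> \<theta>m) \<le> ln c2"
    using \<pi>_ge[OF \<theta>m] \<pi>_le[OF \<theta>m] c1 c2 prior_max_pos by (auto simp: ln_le_cancel_iff)
  have nn: "0 \<le> \<rho> * d" "0 \<le> \<rho>\<^sup>2 * S" "0 \<le> ?p * S" "0 \<le> d\<^sup>2 / l" "0 \<le> ?p / l"
    using d_nonneg Sl l \<rho> by simp_all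
  have abs: "?p * ln (2 * pi) \<le> ?p * \<bar>ln (2 * pi)\<bar>" "0 \<le> ?p * \<bar>ln (2 * pi)\<bar>"
    by (auto intro: mult_left_mono)
  \<comment> \<open>These identities normalize the nonlinear products, which linear arithmetic then
    treats as atoms.\<close>
  have e: "2 * (d\<^sup>2 / (2 * l)) = d\<^sup>2 / l" "2 * \<rho> * d = 2 * (\<rho> * d)"
     "(\<rho>\<^sup>2 + ?p) * S = \<rho>\<^sup>2 * S + ?p * S" "2 * (S * \<rho>\<^sup>2 / 2) = \<rho>\<^sup>2 * S" "d * \<rho> = \<rho> * d"
    by (simp_all add: algebra_simps)
  show ?thesis
    unfolding bic_gap_eq abs_le_iff e(2,3)
    using J1 J2 pl D1 D2 P1 nn abs e(1,4,5)
      abs_ge_self[of "ln (c1 * ?V)"] abs_ge_minus_self[of "ln (c1 * ?V)"] abs_ge_self[of "ln c1"] abs_ge_minus_self[of "ln c1"]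
      abs_ge_self[of "ln c2"] abs_ge_minus_self[of "ln c2"]
    by (intro conjI) linarith+
qed

end

lemma exp_diff_le_of_nonpos:
  fixes x y :: real
  assumes "x \<le> 0" "y \<le> 0"
  shows "\<bar>exp x - exp y\<bar> \<le> \<bar>x - y\<bar>"
proof -
  have *: "exp b - exp a \<le> b - a" if "a \<le> b" "b \<le> 0" for a b :: real
  proof -
    have "exp b - exp a = exp b * (1 - exp (a - b))" by (simp add: exp_diff field_simps)
    also have "1 - exp (a - b) \<le> b - a" using exp_ge_add_one_self[of "a - b"] by linarith
    then have "exp b * (1 - exp (a - b)) \<le> 1 * (b - a)"
      using that by (intro mult_mono) auto
    finally show ?thesis by simp
  qed
  show ?thesis
    using *[of x y] *[of y x] assms by (cases "x \<le> y") (auto simp: abs_if)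
qed

text \<open>The matrices \<open>Ghat\<close> need not converge, so there is no limiting Gaussian.
  Dominated convergence is therefore applied to the difference \<open>D\<close> between the
  normalized integrand and the Gaussian of the same stage, dominated by a fixed Gaussian with
  parameter \<open>1 / L\<close>.\<close>

lemma bic_gap_tendsto:
  fixes \<Theta> :: "(real^'p::finite) set" and A B :: "nat \<Rightarrow> real^'p^'p"
  assumes reg: "\<And>n. regular_bayes \<Theta> (A n) (B n) (h n) \<theta>0 (\<theta>m n) L L L (1 / L) (\<alpha> n) (\<pi> n) c1 c2"
    and \<alpha>: "\<alpha> \<longlonglongrightarrow> 0"
    and prior: "\<And>R \<epsilon>. 0 < R \<Longrightarrow> 0 < \<epsilon> \<Longrightarrow> \<forall>\<^sub>F n in sequentially. \<forall>u. norm u < R \<longrightarrow> \<theta>0 + A n *v u \<in> \<Theta> \<longrightarrow> \<bar>\<pi> n (\<theta>0 + A n *v u) - \<pi> n \<theta>0\<bar> \<le> \<epsilon>"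
  shows "(\<lambda>n. bic_gap \<Theta> (h n) (\<pi> n) (\<theta>m n)) \<longlonglongrightarrow> 0"
proof -
  interpret R: regular_bayes \<Theta> "A n" "B n" "h n" \<theta>0 "\<theta>m n" L L L "1 / L" "\<alpha> n" "\<pi> n" c1 c2 for n by (rule reg)
  have L: "L > 0" using R.l by simp
  \<comment> \<open>This is the bound \<open>2 * d / l\<close> of \<open>uhat_bound\<close> for
    \<open>d = L\<close> and \<open>l = 1 / L\<close>.\<close>
  define U where "U = 2 * L * L"
  have U: "U > 0" using L by (simp add: U_def)
  have uhat: "norm (R.uhat n) \<le> U" for n using R.uhat_bound[of n] L by (simp add: U_def)
  obtain r where r: "r > 0" "ball \<theta>0 r \<subseteq> \<Theta>" using R.open_dom R.\<theta>0 openE by blast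
  have max_eq: "\<theta>m n + A n *v u = \<theta>0 + A n *v (R.uhat n + u)" for n u
    using R.\<theta>0_uhat[of n] by (simp add: matrix_vector_right_distrib add.assoc[symmetric])
  \<comment> \<open>Normalized maximizers stay bounded while the rates vanish. The instance
    \<open>u = 0\<close> says that the maximizer is eventually interior, as
    \<open>h_quadratic_approx\<close> requires.\<close>
  have inT: "\<forall>\<^sub>F n in sequentially. \<theta>m n + A n *v u \<in> \<Theta>" for u
  proof -
    have "(\<lambda>n. \<alpha> n * (U + norm u)) \<longlonglongrightarrow> 0 * (U + norm u)" by (intro tendsto_intros \<alpha>)
    then have "(\<lambda>n. \<alpha> n * (U + norm u)) \<longlonglongrightarrow> 0" by simp
    from order_tendstoD(2)[OF this r(1)] have "\<forall>\<^sub>F n in sequentially. \<alpha> n * (U + norm u) < r" .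
    moreover have "\<forall>\<^sub>F n in sequentially. 0 \<le> \<alpha> n"
    proof (rule always_eventually, rule allI)
      fix n show "0 \<le> \<alpha> n"
        using order_trans[OF norm_ge_zero R.A_norm[of n "axis undefined 1"]] by simp
    qed
    ultimately show ?thesis
    proof eventually_elim
      case (elim n)
      have "norm (A n *v (R.uhat n + u)) \<le> \<alpha> n * norm (R.uhat n + u)" by (rule R.A_norm)
      also have "\<dots> \<le> \<alpha> n * (U + norm u)"
        using elim(2) norm_triangle_ineq[of "R.uhat n" u] uhat[of n] by (intro mult_left_mono) auto
      also have "\<dots> < r" by (rule elim(1))
      finally show ?case unfolding max_eq using r(2) by (auto simp: subset_eq dist_norm)
    qed
  qed
  define E where "E n u = exp (- (u \<bullet> (R.Ghat n *v u)) / 2)" for n u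
  define D where "D n u = R.F n u / \<pi> n (\<theta>m n) - E n u" for n u
  define C where "C = sqrt (2 * pi) ^ CARD('p)"
  have C: "C > 0" by (simp add: C_def)
  have E: "has_bochner_integral lborel (E n) (C / sqrt (det (R.Ghat n)))" for n
    unfolding E_def C_def by (rule has_bochner_integral_gaussian[OF R.Ghat_sym R.Ghat_pos])
  have ptw: "(\<lambda>n. D n u) \<longlonglongrightarrow> 0" for u
  proof (rule tendsto_norm_zero_cancel, rule tendstoI)
    fix e :: real assume e: "e > 0"
    \<comment> \<open>The prior values at \<open>\<theta>m n\<close> and at the shifted point each
      differ from the value at \<open>\<theta>0\<close> by at most \<open>\<epsilon>\<close>; after
      division by a prior value of at least \<open>c1\<close> this costs \<open>e / 2\<close>. The
      radius used below covers both \<open>R.uhat n\<close> and \<open>R.uhat n + u\<close>.\<close>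
    define \<epsilon> where "\<epsilon> = e * c1 / 4"
    have c1: "c1 > 0" "c2 > 0" using R.c1 R.c2 by auto
    have \<epsilon>: "\<epsilon> > 0" using e c1 by (simp add: \<epsilon>_def)
    let ?k = "(c2 / c1) * (real CARD('p) * L * norm u ^ 3)"
    have "(\<lambda>n. ?k * \<alpha> n) \<longlonglongrightarrow> ?k * 0" by (intro tendsto_intros \<alpha>)
    then have "(\<lambda>n. ?k * \<alpha> n) \<longlonglongrightarrow> 0" by simp
    from order_tendstoD(2)[OF this, of "e / 2"] have "\<forall>\<^sub>F n in sequentially. ?k * \<alpha> n < e / 2" using e by simp
    moreover have "\<forall>\<^sub>F n in sequentially. \<forall>w. norm w < U + norm u + 1 \<longrightarrow> \<theta>0 + A n *v w \<in> \<Theta> \<longrightarrow> \<bar>\<pi> n (\<theta>0 + A n *v w) - \<pi> n \<theta>0\<bar> \<le> \<epsilon>"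
      by (rule prior[OF _ \<epsilon>]) (use U in \<open>simp add: add_pos_nonneg\<close>)
    moreover note inT[of u] inT[of 0]
    ultimately show "\<forall>\<^sub>F n in sequentially. dist (norm (D n u)) 0 < e"
    proof (eventually_elim)
      case (elim n)
      have m1: "\<theta>m n \<in> \<Theta>" and m2: "\<theta>m n + A n *v u \<in> \<Theta>" using elim by auto
      have cl: "\<theta>m n \<in> closure \<Theta>" "\<theta>m n + A n *v u \<in> closure \<Theta>" using m1 m2 closure_subset by auto
      have P: "\<bar>\<pi> n (\<theta>0 + A n *v w) - \<pi> n \<theta>0\<bar> \<le> \<epsilon>" if "norm w < U + norm u + 1" "\<theta>0 + A n *v w \<in> \<Theta>" for w
        using elim(2) that by blast
      have P1: "\<bar>\<pi> n (\<theta>m n) - \<pi> n \<theta>0\<bar> \<le> \<epsilon>"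
        using P[of "R.uhat n"] uhat[of n] m1 R.\<theta>0_uhat[of n] norm_ge_zero[of u] by simp
      have P2: "\<bar>\<pi> n (\<theta>m n + A n *v u) - \<pi> n \<theta>0\<bar> \<le> \<epsilon>"
        unfolding max_eq
        using P[of "R.uhat n + u"] norm_triangle_ineq[of "R.uhat n" u] uhat[of n] m2 unfolding max_eq by auto
      define x where "x = h n (\<theta>m n + A n *v u) - h n (\<theta>m n)"
      define y where "y = - (u \<bullet> (R.Ghat n *v u)) / 2"
      define q where "q = \<pi> n (\<theta>m n + A n *v u) / \<pi> n (\<theta>m n)"
      have xy: "x \<le> 0" "y \<le> 0"
        using R.h_drop[OF m2] order_trans[OF _ R.Ghat_ge[of u n]] L by (auto simp: x_def y_def intro: order_trans)
      have pm: "c1 \<le> \<pi> n (\<theta>m n)" "\<pi> n (\<theta>m n + A n *v u) \<le> c2" "0 < \<pi> n (\<theta>m n + A n *v u)" "0 < \<pi> n (\<theta>m n)"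
        using R.\<pi>_le[OF cl(2), of n] less_le_trans[OF c1(1) R.\<pi>_ge[OF cl(2), of n]]
          R.\<pi>_ge[OF cl(1), of n] less_le_trans[OF c1(1) R.\<pi>_ge[OF cl(1), of n]] by auto
      have q: "0 \<le> q" "q \<le> c2 / c1"
        using pm c1 by (auto simp: q_def intro!: frac_le)
      have "\<bar>q - 1\<bar> = \<bar>\<pi> n (\<theta>m n + A n *v u) - \<pi> n (\<theta>m n)\<bar> / \<pi> n (\<theta>m n)"
      proof -
        have "q - 1 = (\<pi> n (\<theta>m n + A n *v u) - \<pi> n (\<theta>m n)) / \<pi> n (\<theta>m n)"
          using pm(4) by (simp add: q_def diff_divide_distrib)
        then show ?thesis using pm(4) by (simp add: abs_divide)
      qed
      also have "\<dots> \<le> (2 * \<epsilon>) / c1" using P1 P2 pm c1 by (intro frac_le) auto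
      also have "\<dots> = e / 2" using c1 by (simp add: \<epsilon>_def)
      finally have q1: "\<bar>q - 1\<bar> \<le> e / 2" .
      have "\<bar>x - y\<bar> \<le> real CARD('p) * L * \<alpha> n * norm u ^ 3"
        using R.h_quadratic_approx[OF m1 m2] by (simp add: x_def y_def)
      then have xyd: "\<bar>exp x - exp y\<bar> \<le> real CARD('p) * L * \<alpha> n * norm u ^ 3"
        using exp_diff_le_of_nonpos[OF xy] by simp
      have "D n u = exp x * q - exp y"
        using m2 by (simp add: D_def R.F_def E_def x_def y_def q_def)
      also have "\<dots> = (exp x - exp y) * q + exp y * (q - 1)" by (simp add: algebra_simps)
      finally have "\<bar>D n u\<bar> \<le> \<bar>exp x - exp y\<bar> * q + exp y * \<bar>q - 1\<bar>"
        using q by (simp add: abs_mult abs_triangle_ineq order_trans[OF abs_triangle_ineq])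
      also have "\<dots> \<le> (real CARD('p) * L * \<alpha> n * norm u ^ 3) * (c2 / c1) + 1 * (e / 2)"
        using xy q by (intro add_mono mult_mono xyd q q1 order_trans[OF abs_ge_zero xyd]) auto
      also have "\<dots> = ?k * \<alpha> n + e / 2" by (simp add: mult_ac)
      also have "\<dots> < e" using elim(1) by linarith
      finally show ?case by simp
    qed
  qed
  have "(\<lambda>n. LINT u|lborel. D n u) \<longlonglongrightarrow> (LINT u|(lborel :: (real^'p) measure). 0)"
  proof (rule integral_dominated_convergence)
    have "has_bochner_integral lborel (\<lambda>u::real^'p. exp (- (1 / L * (norm u)\<^sup>2) / 2)) (sqrt (2 * pi) ^ CARD('p) / sqrt ((1 / L) ^ CARD('p)))"
      by (rule R.gaussian_l)
    then show "integrable lborel (\<lambda>u::real^'p. (c2 / c1 + 1) * exp (- (1 / L * (norm u)\<^sup>2) / 2))"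
      by (intro integrable_mult_right) (simp add: has_bochner_integral_iff)
    show "D n \<in> borel_measurable lborel" for n
      using R.F_measurable[of n] E[of n] unfolding D_def[abs_def] by (auto simp: has_bochner_integral_iff intro!: borel_measurable_diff borel_measurable_divide)
    show "AE u in lborel. norm (D n u) \<le> (c2 / c1 + 1) * exp (- (1 / L * (norm u)\<^sup>2) / 2)" for n
    proof (rule AE_I2)
      fix u :: "real^'p"
      have c1: "c1 > 0" "c2 > 0" using R.c1 R.c2 by auto
      have "R.F n u / \<pi> n (\<theta>m n) \<le> (c2 * exp (- (1 / L * (norm u)\<^sup>2) / 2)) / c1"
        using R.F_le[of n u] R.F_nonneg[of n u] R.\<pi>_ge[OF R.\<theta>m] c1 by (intro frac_le) auto
      moreover have "E n u \<le> exp (- (1 / L * (norm u)\<^sup>2) / 2)"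
        using R.Ghat_ge[of u n] by (simp add: E_def)
      moreover have "0 \<le> R.F n u / \<pi> n (\<theta>m n)" "0 \<le> E n u"
        using R.F_nonneg[of n u] R.prior_max_pos[of n] by (auto simp: E_def)
      ultimately show "norm (D n u) \<le> (c2 / c1 + 1) * exp (- (1 / L * (norm u)\<^sup>2) / 2)"
        by (simp add: D_def abs_le_iff algebra_simps)
    qed
  qed (use ptw in auto)
  then have ID: "(\<lambda>n. LINT u|lborel. D n u) \<longlonglongrightarrow> 0" by simp
  have IDeq: "(LINT u|lborel. D n u) = R.J n / \<pi> n (\<theta>m n) - C / sqrt (det (R.Ghat n))" for n
    using E[of n] R.F_integrable[of n] unfolding D_def[abs_def]
    by (simp add: has_bochner_integral_iff R.J_def)
  \<comment> \<open>The ratio of \<open>J\<close> to its Laplace approximation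
    \<open>\<pi> n (\<theta>m n) * C / sqrt (det (R.Ghat n))\<close>. It tends to one because the
    determinants are bounded by a power of \<open>L\<close>.\<close>
  define \<rho> where "\<rho> n = 1 + (LINT u|lborel. D n u) * sqrt (det (R.Ghat n)) / C" for n
  have \<rho>eq: "\<rho> n = R.J n * sqrt (det (R.Ghat n)) / (\<pi> n (\<theta>m n) * C)" for n
    using R.det_Ghat(3)[of n] C R.prior_max_pos[of n] unfolding \<rho>_def IDeq by (simp add: field_simps)
  have gap: "bic_gap \<Theta> (h n) (\<pi> n) (\<theta>m n) = - 2 * ln (\<rho> n)" for n
  proof -
    have "ln (\<rho> n) = ln (R.J n) + ln (det (R.Ghat n)) / 2 - ln (\<pi> n (\<theta>m n)) - real CARD('p) * ln (2 * pi) / 2"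
      unfolding \<rho>eq using R.det_Ghat(3)[of n] C R.prior_max_pos[of n] R.J_pos[of n]
      by (simp add: ln_mult ln_div ln_sqrt ln_realpow C_def)
    then show ?thesis by (simp add: R.bic_gap_eq)
  qed
  have "(\<lambda>n. (LINT u|lborel. D n u) * sqrt (det (R.Ghat n)) / C) \<longlonglongrightarrow> 0"
  proof (rule Lim_null_comparison)
    show "\<forall>\<^sub>F n in sequentially. norm ((LINT u|lborel. D n u) * sqrt (det (R.Ghat n)) / C) \<le> \<bar>LINT u|lborel. D n u\<bar> * sqrt (L ^ CARD('p)) / C"
    proof (rule always_eventually, rule allI)
      fix n
      have "\<bar>LINT u|lborel. D n u\<bar> * sqrt (det (R.Ghat n)) \<le> \<bar>LINT u|lborel. D n u\<bar> * sqrt (L ^ CARD('p))"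
        using R.det_Ghat(2)[of n] by (intro mult_left_mono) auto
      then show "norm ((LINT u|lborel. D n u) * sqrt (det (R.Ghat n)) / C) \<le> \<bar>LINT u|lborel. D n u\<bar> * sqrt (L ^ CARD('p)) / C"
        using C R.det_Ghat(3)[of n] by (simp add: abs_mult divide_right_mono)
    qed
    have "(\<lambda>n. \<bar>LINT u|lborel. D n u\<bar> * sqrt (L ^ CARD('p)) / C) \<longlonglongrightarrow> 0 * sqrt (L ^ CARD('p)) / C"
      using C by (intro tendsto_intros tendsto_rabs_zero ID) auto
    then show "(\<lambda>n. \<bar>LINT u|lborel. D n u\<bar> * sqrt (L ^ CARD('p)) / C) \<longlonglongrightarrow> 0" by simp
  qed
  then have "\<rho> \<longlonglongrightarrow> 1 + 0" unfolding \<rho>_def[abs_def] by (intro tendsto_intros)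
  then have "(\<lambda>n. - 2 * ln (\<rho> n)) \<longlonglongrightarrow> - 2 * ln (1 + 0)" by (intro tendsto_intros) auto
  then show ?thesis by (simp add: gap)
qed

text \<open>If uniformity failed, a bad likelihood would exist at some stage
  \<open>f N \<ge> N\<close> for every \<open>N\<close>. These form a sequence, and the rates and
  priors along \<open>f\<close> still satisfy the hypotheses of the preceding limit theorem.\<close>

lemma bic_gap_uniform:
  fixes \<Theta> :: "(real^'p::finite) set" and A B :: "nat \<Rightarrow> real^'p^'p"
  assumes \<alpha>: "\<alpha> \<longlonglongrightarrow> 0"
    and prior: "\<And>R \<epsilon>. 0 < R \<Longrightarrow> 0 < \<epsilon> \<Longrightarrow> \<forall>\<^sub>F n in sequentially. \<forall>u. norm u < R \<longrightarrow> \<theta>0 + A n *v u \<in> \<Theta> \<longrightarrow> \<bar>\<pi> n (\<theta>0 + A n *v u) - \<pi> n \<theta>0\<bar> \<le> \<epsilon>"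
    and e: "e > 0"
  shows "\<exists>N. \<forall>n\<ge>N. \<forall>h \<theta>m. regular_bayes \<Theta> (A n) (B n) h \<theta>0 \<theta>m L L L (1 / L) (\<alpha> n) (\<pi> n) c1 c2
     \<longrightarrow> \<bar>bic_gap \<Theta> h (\<pi> n) \<theta>m\<bar> \<le> e"
proof (rule ccontr)
  assume "\<not> ?thesis"
  then have "\<forall>N. \<exists>n h \<theta>m. n \<ge> N \<and> regular_bayes \<Theta> (A n) (B n) h \<theta>0 \<theta>m L L L (1 / L) (\<alpha> n) (\<pi> n) c1 c2
     \<and> \<not> \<bar>bic_gap \<Theta> h (\<pi> n) \<theta>m\<bar> \<le> e" by blast
  then obtain f h \<theta>m where f: "\<And>N. f N \<ge> N"
    and reg: "\<And>N. regular_bayes \<Theta> (A (f N)) (B (f N)) (h N) \<theta>0 (\<theta>m N) L L L (1 / L) (\<alpha> (f N)) (\<pi> (f N)) c1 c2"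
    and bad: "\<And>N. \<not> \<bar>bic_gap \<Theta> (h N) (\<pi> (f N)) (\<theta>m N)\<bar> \<le> e" by metis
  have lim: "filterlim f sequentially sequentially"
    by (rule filterlim_at_top_mono[OF filterlim_ident]) (simp add: f)
  have "(\<lambda>N. bic_gap \<Theta> (h N) (\<pi> (f N)) (\<theta>m N)) \<longlonglongrightarrow> 0"
  proof (rule bic_gap_tendsto[OF reg])
    show "(\<lambda>n. \<alpha> (f n)) \<longlonglongrightarrow> 0" by (rule filterlim_compose[OF \<alpha> lim])
    fix R \<epsilon> :: real assume "0 < R" "0 < \<epsilon>"
    from filterlim_iff[THEN iffD1, OF lim, rule_format, OF prior[OF this]]
    show "\<forall>\<^sub>F n in sequentially. \<forall>u. norm u < R \<longrightarrow> \<theta>0 + A (f n) *v u \<in> \<Theta> \<longrightarrow> \<bar>\<pi> (f n) (\<theta>0 + A (f n) *v u) - \<pi> (f n) \<theta>0\<bar> \<le> \<epsilon>" .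
  qed
  from tendstoD[OF this e] obtain N where "\<bar>bic_gap \<Theta> (h N) (\<pi> (f N)) (\<theta>m N)\<bar> < e"
    by (auto simp: eventually_sequentially)
  with bad[of N] show False by simp
qed

section \<open>Measurability\<close>

text \<open>Preimages under the two functions differ by a subset of a null set, which is measurable
  by completeness.\<close>

lemma (in complete_measure) borel_measurable_AE_eq:
  assumes g: "g \<in> M \<rightarrow>\<^sub>M N" and AE: "AE x in M. f x = g x" and f: "f \<in> space M \<rightarrow> space N"
  shows "f \<in> M \<rightarrow>\<^sub>M N"
proof (rule measurableI)
  fix X assume "X \<in> sets N"
  then have "g -` X \<inter> space M \<in> sets M" using g by (rule measurable_sets[rotated])
  moreover have "AE x in M. x \<in> g -` X \<inter> space M \<longleftrightarrow> x \<in> f -` X \<inter> space M"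
    using AE by eventually_elim auto
  ultimately show "f -` X \<inter> space M \<in> sets M"
    by (elim in_sets_AE[rotated]) auto
qed (use f in auto)

text \<open>An open set meets every ball around a point of its closure in a nonempty open set, which
  a countable dense set of the whole space must hit.\<close>

lemma open_countable_dense:
  fixes S :: "'a::{metric_space, second_countable_topology} set"
  assumes "open S"
  obtains T where "countable T" "T \<subseteq> S" "\<And>x e. x \<in> closure S \<Longrightarrow> 0 < e \<Longrightarrow> \<exists>d\<in>T. dist x d < e"
proof -
  obtain Q :: "'a set" where Q: "countable Q" "\<And>X. open X \<Longrightarrow> X \<noteq> {} \<Longrightarrow> \<exists>d\<in>Q. d \<in> X"
    using countable_dense_setE by blast
  have "\<exists>d\<in>Q \<inter> S. dist x d < e" if xe: "x \<in> closure S" "0 < e" for x e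
  proof -
    obtain y where "y \<in> S" "dist y x < e" using xe by (auto simp: closure_approachable)
    then have "S \<inter> ball x e \<noteq> {}" by (auto simp: dist_commute)
    then show ?thesis using Q(2)[of "S \<inter> ball x e"] assms by auto
  qed
  with Q(1) show ?thesis by (intro that[of "Q \<inter> S"]) auto
qed

text \<open>The random point is approximated by points from a countable dense set, chosen by a
  measurable rule.\<close>

lemma borel_measurable_random_evaluation:
  fixes F :: "'x \<Rightarrow> 'a::{metric_space, second_countable_topology} \<Rightarrow> 'b::metric_space"
  assumes S: "open S"
    and F: "\<And>d. d \<in> S \<Longrightarrow> (\<lambda>x. F x d) \<in> borel_measurable N"
    and \<psi> [measurable]: "\<psi> \<in> borel_measurable N" and \<psi>S: "\<And>x. x \<in> space N \<Longrightarrow> \<psi> x \<in> closure S"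
    and lim: "\<And>x s. x \<in> space N \<Longrightarrow> (\<And>m. s m \<in> S) \<Longrightarrow> s \<longlonglongrightarrow> \<psi> x \<Longrightarrow> (\<lambda>m. F x (s m)) \<longlonglongrightarrow> L x"
  shows "L \<in> borel_measurable N"
proof (cases "space N = {}")
  case True
  then show ?thesis by (simp add: measurable_def)
next
  case False
  obtain T where T: "countable T" "T \<subseteq> S" "\<And>x e. x \<in> closure S \<Longrightarrow> 0 < e \<Longrightarrow> \<exists>d\<in>T. dist x d < e"
    using open_countable_dense[OF S] by metis
  obtain x0 where "x0 \<in> space N" using False by auto
  then have "T \<noteq> {}" using T(3)[OF \<psi>S, of x0 1] by auto
  define t where "t = from_nat_into T"
  have t: "t k \<in> S" for k
    using from_nat_into[OF \<open>T \<noteq> {}\<close>] T(2) by (auto simp: t_def)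
  \<comment> \<open>The first listed point within \<open>1 / (real m + 1)\<close> of the random
    point; a least index with a measurable condition is a measurable integer.\<close>
  define k where "k m x = (LEAST k. dist (\<psi> x) (t k) < 1 / (real m + 1))" for m x
  have [measurable]: "k m \<in> measurable N (count_space UNIV)" for m
    unfolding k_def[abs_def] by measurable
  have kd: "dist (\<psi> x) (t (k m x)) < 1 / (real m + 1)" if x: "x \<in> space N" for m x
  proof -
    obtain d where d: "d \<in> T" "dist (\<psi> x) d < 1 / (real m + 1)"
      using T(3)[OF \<psi>S[OF x], of "1 / (real m + 1)"] by auto
    then have "\<exists>k. dist (\<psi> x) (t k) < 1 / (real m + 1)"
      using from_nat_into_surj[OF T(1) d(1)] by (auto simp: t_def)
    then show ?thesis unfolding k_def by (rule LeastI_ex)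
  qed
  show ?thesis
  proof (rule borel_measurable_LIMSEQ_metric)
    show "(\<lambda>x. F x (t (k m x))) \<in> borel_measurable N" for m
      by (rule measurable_compose_countable[of "\<lambda>k x. F x (t k)" N borel "k m"]) (auto intro: F t)
    fix x assume x: "x \<in> space N"
    show "(\<lambda>m. F x (t (k m x))) \<longlonglongrightarrow> L x"
    proof (rule lim[OF x t])
      have "(\<lambda>m. dist (t (k m x)) (\<psi> x)) \<longlonglongrightarrow> 0"
      proof (rule Lim_null_comparison)
        show "\<forall>\<^sub>F m in sequentially. norm (dist (t (k m x)) (\<psi> x)) \<le> 1 / (real m + 1)"
          by (intro always_eventually allI) (use kd[OF x] in \<open>simp add: dist_commute less_imp_le\<close>)
        show "(\<lambda>m. 1 / (real m + 1)) \<longlonglongrightarrow> 0"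
          using LIMSEQ_inverse_real_of_nat by (simp add: inverse_eq_divide add.commute)
      qed
      then show "(\<lambda>m. t (k m x)) \<longlonglongrightarrow> \<psi> x" by (rule tendsto_dist_iff[THEN iffD2])
    qed
  qed
qed

text \<open>A limit of difference quotients along one fixed sequence of steps. The steps
  \<open>r / (real m + 2)\<close> are below the radius \<open>r\<close> already for
  \<open>m = 0\<close>. Repeated application reaches the third derivatives.\<close>

lemma borel_measurable_pdiff:
  fixes F :: "'x \<Rightarrow> real^'n::finite \<Rightarrow> real"
  assumes S: "open S" "\<theta> \<in> S" and F: "\<And>y. y \<in> S \<Longrightarrow> (\<lambda>x. F x y) \<in> borel_measurable N"
    and diff: "\<And>x. x \<in> space N \<Longrightarrow> F x differentiable (at \<theta>)"
  shows "(\<lambda>x. pdiff i (F x) \<theta>) \<in> borel_measurable N"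
proof -
  obtain r where r: "r > 0" "ball \<theta> r \<subseteq> S" using S openE by blast
  define e where "e m = r / (real m + 2)" for m
  have e: "0 < e m" "e m < r" for m
  proof -
    show "0 < e m" using r by (simp add: e_def)
    have "r * 1 < r * (real m + 2)" using r by (intro mult_strict_left_mono) auto
    then show "e m < r" by (simp add: e_def divide_less_eq)
  qed
  have e0: "e \<longlonglongrightarrow> 0"
  proof -
    have "(\<lambda>m. r * inverse (real (Suc (m + 1)))) \<longlonglongrightarrow> r * 0"
      by (intro tendsto_mult_left LIMSEQ_ignore_initial_segment[OF LIMSEQ_inverse_real_of_nat])
    moreover have "(\<lambda>m. r * inverse (real (Suc (m + 1)))) = e"
      by (simp add: e_def fun_eq_iff divide_inverse add.commute)
    ultimately show ?thesis by simp
  qed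
  have inS: "\<theta> + e m *\<^sub>R axis i 1 \<in> S" for m
    using e[of m] r(2) by (auto simp: subset_eq dist_norm)
  show ?thesis
  proof (rule borel_measurable_LIMSEQ_real)
    show "(\<lambda>x. (F x (\<theta> + e m *\<^sub>R axis i 1) - F x \<theta>) / e m) \<in> borel_measurable N" for m
      using F[OF inS[of m]] F[OF S(2)] by measurable
    fix x assume "x \<in> space N"
    from DERIV_along_axis[of "F x" \<theta> 0 i] diff[OF this]
    have "((\<lambda>t. F x (\<theta> + t *\<^sub>R axis i 1)) has_real_derivative pdiff i (F x) \<theta>) (at 0)" by simp
    then have "((\<lambda>h. (F x (\<theta> + h *\<^sub>R axis i 1) - F x \<theta>) / h) \<longlongrightarrow> pdiff i (F x) \<theta>) (at 0)"
      by (simp add: DERIV_def)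
    moreover have "filterlim e (at 0) sequentially"
    proof -
      have "e m \<noteq> 0" for m using e(1)[of m] by simp
      then show ?thesis using e0 by (simp add: filterlim_at)
    qed
    ultimately show "(\<lambda>m. (F x (\<theta> + e m *\<^sub>R axis i 1) - F x \<theta>) / e m) \<longlonglongrightarrow> pdiff i (F x) \<theta>"
      by (rule filterlim_compose[where f = e])
  qed
qed

lemma borel_measurable_vec_nthI:
  fixes f :: "'x \<Rightarrow> real^'n::finite"
  assumes "\<And>i. (\<lambda>x. f x $ i) \<in> borel_measurable N"
  shows "f \<in> borel_measurable N"
  by (subst borel_measurable_euclidean_space) (auto simp: Basis_vec_def inner_axis assms)

lemma borel_measurable_matrix_nthI:
  fixes f :: "'x \<Rightarrow> real^'n::finite^'m::finite"
  assumes "\<And>i j. (\<lambda>x. f x $ i $ j) \<in> borel_measurable N"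
  shows "f \<in> borel_measurable N"
  by (subst borel_measurable_euclidean_space) (auto simp: Basis_vec_def inner_axis assms)

lemma borel_measurable_matrix_nth:
  fixes f :: "'x \<Rightarrow> real^'n::finite^'m::finite"
  assumes "f \<in> borel_measurable N"
  shows "(\<lambda>x. f x $ i $ j) \<in> borel_measurable N"
proof -
  have "(\<lambda>x. f x \<bullet> axis i (axis j 1)) \<in> borel_measurable N"
    using assms by measurable
  then show ?thesis by (simp add: inner_axis)
qed

lemma borel_measurable_matrix_mult:
  fixes f :: "'x \<Rightarrow> real^'n::finite^'m::finite" and g :: "'x \<Rightarrow> real^'k::finite^'n"
  assumes "f \<in> borel_measurable N" "g \<in> borel_measurable N"
  shows "(\<lambda>x. f x ** g x) \<in> borel_measurable N"
  by (rule borel_measurable_matrix_nthI)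
    (simp add: matrix_matrix_mult_def borel_measurable_sum borel_measurable_times borel_measurable_matrix_nth assms)

lemma borel_measurable_det:
  fixes f :: "'x \<Rightarrow> real^'n::finite^'n"
  assumes "f \<in> borel_measurable N"
  shows "(\<lambda>x. det (f x)) \<in> borel_measurable N"
  unfolding det_def
  by (intro borel_measurable_sum borel_measurable_times borel_measurable_prod borel_measurable_const
      borel_measurable_matrix_nth assms)

text \<open>By the variational characterization, the set where the smallest eigenvalue is at least
  \<open>c\<close> is the preimage of a closed set of matrices.\<close>

lemma borel_measurable_lambda_min:
  fixes f :: "'x \<Rightarrow> real^'n::finite^'n"
  assumes f: "f \<in> borel_measurable N" and sym: "\<And>x. x \<in> space N \<Longrightarrow> transpose (f x) = f x"
  shows "(\<lambda>x. lambda_min (f x)) \<in> borel_measurable N"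
  unfolding borel_measurable_iff_ge
proof
  fix c :: real
  define K where "K = {B :: real^'n^'n. \<forall>v. c * (norm v)\<^sup>2 \<le> v \<bullet> (B *v v)}"
  have "closed K"
    unfolding K_def inner_matrix_vector_sum
    by (intro closed_Collect_all closed_Collect_le continuous_intros)
  then have "f -` K \<inter> space N \<in> sets N" by (intro measurable_sets[OF f]) auto
  also have "f -` K \<inter> space N = {x \<in> space N. c \<le> lambda_min (f x)}"
  proof safe
    fix x assume "x \<in> space N" "f x \<in> K"
    then show "c \<le> lambda_min (f x)" by (intro lambda_min_greatest[OF sym]) (auto simp: K_def)
  next
    fix x assume x: "x \<in> space N" "c \<le> lambda_min (f x)"
    have "c * (norm v)\<^sup>2 \<le> v \<bullet> (f x *v v)" for v
      using mult_right_mono[OF x(2), of "(norm v)\<^sup>2"] lambda_min_quadratic_form[OF sym[OF x(1)], of v] by simp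
    then show "x \<in> f -` K" by (simp add: K_def)
  qed
  finally show "{x \<in> space N. c \<le> lambda_min (f x)} \<in> sets N" .
qed

lemma borel_measurable_neg_powr [measurable]: "(\<lambda>x. neg_powr x q) \<in> borel_measurable borel"
  unfolding neg_powr_def by measurable

section \<open>Convergence in mean\<close>

text \<open>Carries the bounds supplied by suprema over a countable dense set back to the whole
  domain.\<close>

lemma le_on_open_if_le_on_dense:
  fixes f :: "'a::metric_space \<Rightarrow> real"
  assumes S: "open S" and f: "continuous_on S f" and D: "\<And>x e. x \<in> S \<Longrightarrow> 0 < e \<Longrightarrow> \<exists>d\<in>D. dist x d < e"
    and le: "\<And>d. d \<in> D \<Longrightarrow> f d \<le> b" and x: "x \<in> S"
  shows "f x \<le> b"
proof (rule ccontr)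
  assume n: "\<not> f x \<le> b"
  have "isCont f x" using f S x by (simp add: continuous_on_eq_continuous_at)
  moreover have "0 < f x - b" using n by simp
  ultimately obtain e where e: "e > 0" "\<And>y. dist y x < e \<Longrightarrow> dist (f y) (f x) < f x - b"
    unfolding continuous_at_eps_delta by blast
  obtain d where d: "d \<in> D" "dist x d < e" using D[OF x e(1)] by auto
  show False using e(2)[of d] le[OF d(1)] d(2) by (auto simp: dist_commute dist_real_def)
qed

lemma le_powr_root:
  fixes y :: real
  assumes "0 \<le> y" "y powr r \<le> x" "r > 0"
  shows "y \<le> x powr (1 / r)"
proof -
  have "y = (y powr r) powr (1 / r)" using assms by (simp add: powr_powr)
  also have "\<dots> \<le> x powr (1 / r)" using assms by (intro powr_mono2) auto
  finally show ?thesis .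
qed

lemma powr_root_ge:
  fixes y :: real
  assumes "0 < y" "y powr (- q) \<le> x" "q > 0"
  shows "x powr (- 1 / q) \<le> y"
proof -
  have "x powr (- 1 / q) \<le> (y powr (- q)) powr (- 1 / q)"
    using assms by (intro powr_mono2') auto
  also have "\<dots> = y" using assms by (simp add: powr_powr)
  finally show ?thesis .
qed

text \<open>The conditions in pointwise form: path properties hold on all of \<open>space P\<close>,
  which the theorem arranges by modifying the data on a null set. From (B1) the moment of order 12
  is kept, from (B3) some exponent \<open>q \<ge> 3\<close>, and the radius \<open>\<rho>\<close> is
  common to all stages.\<close>

locale qb_core = prob_space P + complete_measure P
  for P :: "'w measure" +
  fixes \<Theta> :: "(real^'p::finite) set" and \<theta>0 :: "real^'p" and H :: "nat \<Rightarrow> 'w \<Rightarrow> real^'p \<Rightarrow> real"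
    and \<theta>hat :: "nat \<Rightarrow> 'w \<Rightarrow> real^'p" and \<pi> :: "nat \<Rightarrow> real^'p \<Rightarrow> real" and A B :: "nat \<Rightarrow> real^'p^'p"
    and \<alpha> :: "nat \<Rightarrow> real" and c1 c2 \<rho> q C :: real
  assumes open_dom: "open \<Theta>" and convex_dom: "convex \<Theta>" and \<theta>0: "\<theta>0 \<in> \<Theta>"
    and A_sym: "\<And>n. transpose (A n) = A n" and BA: "\<And>n. B n ** A n = mat 1" and AB: "\<And>n. A n ** B n = mat 1"
    and A_norm: "\<And>n u. norm (A n *v u) \<le> \<alpha> n * norm u" and \<alpha>: "\<alpha> \<longlonglongrightarrow> 0"
    and \<rho>: "\<rho> > 0" and ball: "\<And>n u. norm u < \<rho> \<Longrightarrow> \<theta>0 + A n *v u \<in> \<Theta>"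
    and H_meas: "\<And>n \<theta>. \<theta> \<in> \<Theta> \<Longrightarrow> (\<lambda>\<omega>. H n \<omega> \<theta>) \<in> borel_measurable P"
    and H_cont: "\<And>n \<omega>. \<omega> \<in> space P \<Longrightarrow> continuous_on (closure \<Theta>) (H n \<omega>)"
    and H_C3: "\<And>n \<omega>. \<omega> \<in> space P \<Longrightarrow> Ck_on 3 (H n \<omega>) \<Theta>"
    and \<theta>hat_meas: "\<And>n. \<theta>hat n \<in> borel_measurable P"
    and \<theta>hat_in: "\<And>n \<omega>. \<omega> \<in> space P \<Longrightarrow> \<theta>hat n \<omega> \<in> closure \<Theta>"
    and \<theta>hat_max: "\<And>n \<omega> \<theta>. \<omega> \<in> space P \<Longrightarrow> \<theta> \<in> closure \<Theta> \<Longrightarrow> H n \<omega> \<theta> \<le> H n \<omega> (\<theta>hat n \<omega>)"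
    and \<pi>_meas: "\<And>n. \<pi> n \<in> borel_measurable (restrict_space borel (closure \<Theta>))"
    and c1: "c1 > 0" and \<pi>_ge: "\<And>n \<theta>. \<theta> \<in> closure \<Theta> \<Longrightarrow> c1 \<le> \<pi> n \<theta>" and \<pi>_le: "\<And>n \<theta>. \<theta> \<in> closure \<Theta> \<Longrightarrow> \<pi> n \<theta> \<le> c2"
    and prior: "\<And>R \<epsilon>. 0 < R \<Longrightarrow> 0 < \<epsilon> \<Longrightarrow> \<forall>\<^sub>F n in sequentially. \<forall>u. norm u < R \<longrightarrow> \<theta>0 + A n *v u \<in> \<Theta> \<longrightarrow> \<bar>\<pi> n (\<theta>0 + A n *v u) - \<pi> n \<theta>0\<bar> \<le> \<epsilon>"
    and q: "q \<ge> 3" and C: "C \<ge> 0"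
    and B1: "\<And>n. (\<integral>\<^sup>+\<omega>. ennreal (norm (Delta A H \<theta>0 n \<omega>) powr 12)
         + (SUP \<theta>\<in>\<Theta>. ennreal (norm (Gamma_mat A H n \<omega> \<theta>) powr 12))
         + (\<Sum>i\<in>UNIV. SUP \<theta>\<in>\<Theta>. ennreal (norm (A n ** dhess i (H n \<omega>) \<theta> ** A n) powr 12)) \<partial>P) \<le> ennreal C"
    and B3: "\<forall>\<^sub>F n in sequentially. (\<integral>\<^sup>+\<omega>. (SUP \<theta>\<in>\<Theta>. neg_powr (lambda_min (Gamma_mat A H n \<omega> \<theta>)) q) \<partial>P) \<le> ennreal C"
begin

text \<open>Suprema over this countable set are measurable, in contrast to arbitrary suprema over
  the domain.\<close>

definition "D = (SOME T. countable T \<and> T \<subseteq> \<Theta> \<and> (\<forall>x\<in>closure \<Theta>. \<forall>e>0. \<exists>d\<in>T. dist x d < e))"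

lemma D: "countable D" "D \<subseteq> \<Theta>" "\<And>x e. x \<in> \<Theta> \<Longrightarrow> 0 < e \<Longrightarrow> \<exists>d\<in>D. dist x d < e"
proof -
  obtain T where "countable T" "T \<subseteq> \<Theta>" "\<And>x e. x \<in> closure \<Theta> \<Longrightarrow> 0 < e \<Longrightarrow> \<exists>d\<in>T. dist x d < e"
    using open_countable_dense[OF open_dom] by metis
  then have "\<exists>T. countable T \<and> T \<subseteq> \<Theta> \<and> (\<forall>x\<in>closure \<Theta>. \<forall>e>0. \<exists>d\<in>T. dist x d < e)" by blast
  from someI_ex[OF this, folded D_def] show "countable D" "D \<subseteq> \<Theta>" "\<And>x e. x \<in> \<Theta> \<Longrightarrow> 0 < e \<Longrightarrow> \<exists>d\<in>D. dist x d < e"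
    using closure_subset by blast+
qed

text \<open>A single random variable that controls the score, the derivatives of order two and three and
  the inverse of the smallest eigenvalue; it is integrable, uniformly in \<open>n\<close>.\<close>

definition X1 :: "nat \<Rightarrow> 'w \<Rightarrow> ennreal" where
  "X1 n \<omega> = ennreal (norm (Delta A H \<theta>0 n \<omega>) powr 12)
         + (SUP \<theta>\<in>D. ennreal (norm (Gamma_mat A H n \<omega> \<theta>) powr 12))
         + (\<Sum>i\<in>UNIV. SUP \<theta>\<in>D. ennreal (norm (A n ** dhess i (H n \<omega>) \<theta> ** A n) powr 12))"

definition X2 :: "nat \<Rightarrow> 'w \<Rightarrow> ennreal" where
  "X2 n \<omega> = (SUP \<theta>\<in>D. neg_powr (lambda_min (Gamma_mat A H n \<omega> \<theta>)) q)"

text \<open>The summand one ensures that finite values are at least one, so that their powers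
  increase with the exponent.\<close>

definition X :: "nat \<Rightarrow> 'w \<Rightarrow> ennreal" where "X n \<omega> = 1 + (X1 n \<omega> + X2 n \<omega>)"

section \<open>Measurability and moments of the dominating variable\<close>

lemma pdiff_measurable:
  assumes "\<theta> \<in> \<Theta>"
  shows pdiff1_measurable: "(\<lambda>\<omega>. pdiff i (H n \<omega>) \<theta>) \<in> borel_measurable P"
    and pdiff2_measurable: "(\<lambda>\<omega>. pdiff i (pdiff j (H n \<omega>)) \<theta>) \<in> borel_measurable P"
    and pdiff3_measurable: "(\<lambda>\<omega>. pdiff i (pdiff j (pdiff k (H n \<omega>))) \<theta>) \<in> borel_measurable P"
proof -
  note d = Ck_on_3_differentiable[OF open_dom _ H_C3]
  have 1: "(\<lambda>\<omega>. pdiff i (H n \<omega>) \<theta>) \<in> borel_measurable P" if "\<theta> \<in> \<Theta>" for \<theta> i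
    by (rule borel_measurable_pdiff[OF open_dom that H_meas]) (auto intro: d(1)[OF that])
  have 2: "(\<lambda>\<omega>. pdiff i (pdiff j (H n \<omega>)) \<theta>) \<in> borel_measurable P" if "\<theta> \<in> \<Theta>" for \<theta> i j
    by (rule borel_measurable_pdiff[OF open_dom that 1]) (auto intro: d(2)[OF that])
  show "(\<lambda>\<omega>. pdiff i (H n \<omega>) \<theta>) \<in> borel_measurable P" "(\<lambda>\<omega>. pdiff i (pdiff j (H n \<omega>)) \<theta>) \<in> borel_measurable P"
    using 1 2 assms by auto
  show "(\<lambda>\<omega>. pdiff i (pdiff j (pdiff k (H n \<omega>))) \<theta>) \<in> borel_measurable P"
    by (rule borel_measurable_pdiff[OF open_dom assms 2]) (auto intro: d(3)[OF assms])
qed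

lemma hess_measurable: "\<theta> \<in> \<Theta> \<Longrightarrow> (\<lambda>\<omega>. hess (H n \<omega>) \<theta>) \<in> borel_measurable P"
  by (rule borel_measurable_matrix_nthI) (simp add: hess_def pdiff2_measurable)

lemma dhess_measurable: "\<theta> \<in> \<Theta> \<Longrightarrow> (\<lambda>\<omega>. dhess i (H n \<omega>) \<theta>) \<in> borel_measurable P"
  by (rule borel_measurable_matrix_nthI) (simp add: dhess_def pdiff3_measurable)

lemma Gamma_measurable: "\<theta> \<in> \<Theta> \<Longrightarrow> (\<lambda>\<omega>. Gamma_mat A H n \<omega> \<theta>) \<in> borel_measurable P"
  unfolding Gamma_mat_def
  by (intro borel_measurable_uminus borel_measurable_matrix_mult hess_measurable borel_measurable_const)

lemma Delta_measurable: "(\<lambda>\<omega>. Delta A H \<theta>0 n \<omega>) \<in> borel_measurable P"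
proof -
  have "(\<lambda>\<omega>. grad (H n \<omega>) \<theta>0) \<in> borel_measurable P"
    by (rule borel_measurable_vec_nthI) (simp add: grad_def pdiff1_measurable \<theta>0)
  then show ?thesis unfolding Delta_def by measurable
qed

lemma Gamma_sym: "\<omega> \<in> space P \<Longrightarrow> \<theta> \<in> \<Theta> \<Longrightarrow> transpose (Gamma_mat A H n \<omega> \<theta>) = Gamma_mat A H n \<omega> \<theta>"
  using transpose_sandwich[OF A_sym transpose_hess[OF open_dom _ H_C3]]
  by (simp add: Gamma_mat_def transpose_def vec_eq_iff)

lemma X1_measurable: "X1 n \<in> borel_measurable P"
  unfolding X1_def[abs_def]
proof (intro borel_measurable_add borel_measurable_SUP borel_measurable_sum D)
  show "(\<lambda>\<omega>. ennreal (norm (Delta A H \<theta>0 n \<omega>) powr 12)) \<in> borel_measurable P"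
    using Delta_measurable by measurable
  fix \<theta> assume "\<theta> \<in> D"
  then have \<theta>: "\<theta> \<in> \<Theta>" using D by auto
  show "(\<lambda>\<omega>. ennreal (norm (Gamma_mat A H n \<omega> \<theta>) powr 12)) \<in> borel_measurable P"
    using Gamma_measurable[OF \<theta>] by measurable
  fix i
  have "(\<lambda>\<omega>. A n ** dhess i (H n \<omega>) \<theta> ** A n) \<in> borel_measurable P"
    by (intro borel_measurable_matrix_mult dhess_measurable \<theta> borel_measurable_const)
  then show "(\<lambda>\<omega>. ennreal (norm (A n ** dhess i (H n \<omega>) \<theta> ** A n) powr 12)) \<in> borel_measurable P"
    by measurable
qed

lemma X2_measurable: "X2 n \<in> borel_measurable P"
  unfolding X2_def[abs_def]
proof (intro borel_measurable_SUP D)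
  fix \<theta> assume "\<theta> \<in> D"
  then have \<theta>: "\<theta> \<in> \<Theta>" using D by auto
  have "(\<lambda>\<omega>. lambda_min (Gamma_mat A H n \<omega> \<theta>)) \<in> borel_measurable P"
    by (intro borel_measurable_lambda_min Gamma_measurable \<theta> Gamma_sym)
  then show "(\<lambda>\<omega>. neg_powr (lambda_min (Gamma_mat A H n \<omega> \<theta>)) q) \<in> borel_measurable P"
    by measurable
qed

lemma X_measurable: "X n \<in> borel_measurable P"
  unfolding X_def[abs_def] using X1_measurable X2_measurable by measurable

text \<open>Suprema over \<open>D\<close> lie below those over the domain, and monotonicity of the
  nonnegative integral asks for no measurability of the larger function. The bound is eventual
  because (B3) concerns a limit superior.\<close>

lemma X_integral: "\<forall>\<^sub>F n in sequentially. (\<integral>\<^sup>+\<omega>. X n \<omega> \<partial>P) \<le> ennreal (1 + 2 * C)"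
  using B3
proof eventually_elim
  case (elim n)
  have SUP_D: "(SUP \<theta>\<in>D. f \<theta>) \<le> (SUP \<theta>\<in>\<Theta>. f \<theta>)" for f :: "real^'p \<Rightarrow> ennreal"
    using D(2) by (intro SUP_subset_mono) auto
  have "(\<integral>\<^sup>+\<omega>. X1 n \<omega> \<partial>P) \<le> ennreal C"
    by (rule order_trans[OF nn_integral_mono B1]) (auto simp: X1_def intro!: add_mono sum_mono SUP_D)
  moreover have "(\<integral>\<^sup>+\<omega>. X2 n \<omega> \<partial>P) \<le> ennreal C"
    by (rule order_trans[OF nn_integral_mono elim]) (auto simp: X2_def intro!: SUP_D)
  moreover have "(\<integral>\<^sup>+\<omega>. X n \<omega> \<partial>P) = 1 + ((\<integral>\<^sup>+\<omega>. X1 n \<omega> \<partial>P) + (\<integral>\<^sup>+\<omega>. X2 n \<omega> \<partial>P))"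
    unfolding X_def using X1_measurable X2_measurable
    by (simp add: nn_integral_add emeasure_space_1)
  ultimately have "(\<integral>\<^sup>+\<omega>. X n \<omega> \<partial>P) \<le> 1 + (ennreal C + ennreal C)"
    by (auto intro!: add_mono)
  also have "\<dots> = ennreal (1 + 2 * C)"
  proof -
    have "ennreal C + ennreal C = ennreal (C + C)" by (rule ennreal_plus[symmetric]) (use C in auto)
    moreover have "ennreal 1 + ennreal (C + C) = ennreal (1 + (C + C))" by (rule ennreal_plus[symmetric]) (use C in auto)
    ultimately show ?thesis by (simp only: ennreal_1 mult_2)
  qed
  finally show ?case .
qed

text \<open>Bounds on \<open>D\<close> are extracted from \<open>X\<close> by taking roots and
  extended to the domain by continuity. The slack in \<open>d\<close>, \<open>S\<close>,
  \<open>\<tau>\<close> and \<open>l\<close> allows two uses: exact powers of \<open>x\<close> for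
  the growth bound, and one common bound for the uniform limit.\<close>

lemma regular:
  assumes \<omega>: "\<omega> \<in> space P" and X: "X n \<omega> \<le> ennreal x" and x: "0 \<le> x"
    and b: "x powr (1 / 12) \<le> d" "x powr (1 / 12) \<le> S" "x powr (1 / 12) \<le> \<tau>"
    and l: "0 < l" "l \<le> x powr (- 1 / q)"
  shows "regular_bayes \<Theta> (A n) (B n) (H n \<omega>) \<theta>0 (\<theta>hat n \<omega>) d S \<tau> l (\<alpha> n) (\<pi> n) c1 c2"
proof -
  have XX: "X1 n \<omega> \<le> ennreal x" "X2 n \<omega> \<le> ennreal x"
  proof -
    have "X1 n \<omega> \<le> X n \<omega>" unfolding X_def by (simp add: add.left_commute[of 1 "X1 n \<omega>"])
    then show "X1 n \<omega> \<le> ennreal x" using X by (rule order_trans)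
    have "X2 n \<omega> \<le> X n \<omega>" unfolding X_def by (metis add.assoc add.commute le_iff_add)
    then show "X2 n \<omega> \<le> ennreal x" using X by (rule order_trans)
  qed
  have root: "y \<le> x powr (1 / 12)" if "ennreal (y powr 12) \<le> X1 n \<omega>" "0 \<le> y" for y
  proof -
    have "ennreal (y powr 12) \<le> ennreal x" using that(1) XX(1) by (rule order_trans)
    then have "y powr 12 \<le> x" using x by simp
    from le_powr_root[OF that(2) this] show ?thesis by simp
  qed
  note diff = Ck_on_3_differentiable[OF open_dom _ H_C3[OF \<omega>]]
  have c2: "continuous_on \<Theta> (pdiff i (pdiff j (H n \<omega>)))" for i j
    by (intro differentiable_imp_continuous_on) (use diff(3) open_dom in \<open>auto simp: differentiable_on_eq_differentiable_at\<close>)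
  have c3: "continuous_on \<Theta> (pdiff i (pdiff j (pdiff k (H n \<omega>))))" for i j k
    by (rule Ck_on_3_continuous[OF open_dom \<theta>0 H_C3[OF \<omega>]])
  have ch: "continuous_on \<Theta> (\<lambda>\<theta>. A n ** hess (H n \<omega>) \<theta> ** A n)"
    unfolding continuous_on_def
    by (intro ballI tendsto_intros) (use c2 in \<open>auto simp: tendsto_matrix_entries hess_def continuous_on_def\<close>)
  have cd: "continuous_on \<Theta> (\<lambda>\<theta>. A n ** dhess i (H n \<omega>) \<theta> ** A n)" for i
    unfolding continuous_on_def
    by (intro ballI tendsto_intros) (use c3 in \<open>auto simp: tendsto_matrix_entries dhess_def continuous_on_def\<close>)
  show ?thesis
  proof unfold_locales
    show "norm (A n *v grad (H n \<omega>) \<theta>0) \<le> d"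
      by (rule order_trans[OF root b(1)]) (auto simp: X1_def Delta_def add.assoc)
    fix \<theta> assume \<theta>: "\<theta> \<in> \<Theta>"
    show "norm (A n ** hess (H n \<omega>) \<theta> ** A n) \<le> S"
    proof (rule order_trans[OF le_on_open_if_le_on_dense[OF open_dom _ D(3) _ \<theta>] b(2)])
      show "continuous_on \<Theta> (\<lambda>\<theta>. norm (A n ** hess (H n \<omega>) \<theta> ** A n))" by (intro continuous_intros ch)
      fix d assume d: "d \<in> D"
      have "ennreal (norm (Gamma_mat A H n \<omega> d) powr 12) \<le> (SUP \<theta>\<in>D. ennreal (norm (Gamma_mat A H n \<omega> \<theta>) powr 12))"
        using d by (rule SUP_upper)
      also have "\<dots> \<le> X1 n \<omega>" unfolding X1_def by (simp add: add.assoc add.left_commute[of _ "Sup _"])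
      finally show "norm (A n ** hess (H n \<omega>) d ** A n) \<le> x powr (1 / 12)"
        by (intro root) (auto simp: Gamma_mat_def)
    qed auto
    fix i
    show "norm (A n ** dhess i (H n \<omega>) \<theta> ** A n) \<le> \<tau>"
    proof (rule order_trans[OF le_on_open_if_le_on_dense[OF open_dom _ D(3) _ \<theta>] b(3)])
      show "continuous_on \<Theta> (\<lambda>\<theta>. norm (A n ** dhess i (H n \<omega>) \<theta> ** A n))" by (intro continuous_intros cd)
      fix d assume d: "d \<in> D"
      have "ennreal (norm (A n ** dhess i (H n \<omega>) d ** A n) powr 12) \<le> (SUP \<theta>\<in>D. ennreal (norm (A n ** dhess i (H n \<omega>) \<theta> ** A n) powr 12))"
        using d by (rule SUP_upper)
      also have "\<dots> \<le> (\<Sum>i\<in>UNIV. SUP \<theta>\<in>D. ennreal (norm (A n ** dhess i (H n \<omega>) \<theta> ** A n) powr 12))"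
        by (rule member_le_sum) auto
      also have "\<dots> \<le> X1 n \<omega>" unfolding X1_def by (simp add: add.commute)
      finally show "norm (A n ** dhess i (H n \<omega>) d ** A n) \<le> x powr (1 / 12)"
        by (intro root) auto
    qed auto
  next
    fix \<theta> u assume \<theta>: "\<theta> \<in> \<Theta>"
    have "l * (norm u)\<^sup>2 + u \<bullet> ((A n ** hess (H n \<omega>) \<theta> ** A n) *v u) \<le> 0"
    proof (rule le_on_open_if_le_on_dense[OF open_dom _ D(3) _ \<theta>])
      show "continuous_on \<Theta> (\<lambda>\<theta>. l * (norm u)\<^sup>2 + u \<bullet> ((A n ** hess (H n \<omega>) \<theta> ** A n) *v u))"
        using ch unfolding continuous_on_def by (auto intro!: tendsto_add tendsto_const tendsto_quadratic_form)
      fix d assume d: "d \<in> D"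
      let ?m = "lambda_min (Gamma_mat A H n \<omega> d)"
      have "neg_powr ?m q \<le> X2 n \<omega>" unfolding X2_def using d by (rule SUP_upper)
      then have le: "neg_powr ?m q \<le> ennreal x" using XX(2) by (rule order_trans)
      \<comment> \<open>A finite value of \<open>neg_powr\<close> excludes nonpositive
        eigenvalues.\<close>
      then have m: "?m > 0" by (auto simp: neg_powr_def top_unique split: if_splits)
      with le x have "?m powr (- q) \<le> x" by (simp add: neg_powr_def)
      from powr_root_ge[OF m this] q have "x powr (- 1 / q) \<le> ?m" by simp
      then have "l * (norm u)\<^sup>2 \<le> ?m * (norm u)\<^sup>2" using l(2) by (intro mult_right_mono) auto
      also have "\<dots> \<le> u \<bullet> (Gamma_mat A H n \<omega> d *v u)"
        by (rule lambda_min_quadratic_form[OF Gamma_sym[OF \<omega>]]) (use d D in auto)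
      finally show "l * (norm u)\<^sup>2 + u \<bullet> ((A n ** hess (H n \<omega>) d ** A n) *v u) \<le> 0"
        by (simp add: Gamma_mat_def matrix_vector_uminus)
    qed auto
    then show "l * (norm u)\<^sup>2 \<le> - (u \<bullet> ((A n ** hess (H n \<omega>) \<theta> ** A n) *v u))" by simp
  qed (use open_dom convex_dom \<theta>0 A_sym BA AB A_norm H_cont[OF \<omega>] H_C3[OF \<omega>] \<theta>hat_in[OF \<omega>] \<theta>hat_max[OF \<omega>] \<pi>_meas c1 \<pi>_ge \<pi>_le l(1) in auto)
qed

definition gap where "gap n \<omega> = bic_gap \<Theta> (H n \<omega>) (\<pi> n) (\<theta>hat n \<omega>)"

lemma X_cases:
  assumes "X n \<omega> < \<infinity>"
  obtains x where "1 \<le> x" "X n \<omega> = ennreal x"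
proof -
  have "1 \<le> X n \<omega>" unfolding X_def by simp
  moreover obtain x where x: "0 \<le> x" "X n \<omega> = ennreal x" using assms by (cases "X n \<omega>") auto
  ultimately have "ennreal 1 \<le> ennreal x" by simp
  then show ?thesis using x by (intro that[of x]) (auto simp: ennreal_le_iff)
qed

lemma regular_canonical:
  assumes "\<omega> \<in> space P" "X n \<omega> = ennreal x" "1 \<le> x"
  shows "regular_bayes \<Theta> (A n) (B n) (H n \<omega>) \<theta>0 (\<theta>hat n \<omega>) (x powr (1 / 12)) (x powr (1 / 12)) (x powr (1 / 12)) (x powr (- 1 / q)) (\<alpha> n) (\<pi> n) c1 c2"
  using assms by (intro regular[of \<omega> n x]) auto

text \<open>The coefficients of \<open>bic_gap_bound\<close> added up, each factor having been
  replaced by \<open>sqrt x\<close>; the isolated one belongs to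
  \<open>d\<^sup>2 / l\<close>.\<close>

definition "K = (2 * \<bar>ln (c1 * measure lborel (ball (0::real^'p) \<rho>))\<bar> + 2 * \<bar>ln c1\<bar> + 2 * \<bar>ln c2\<bar> + real CARD('p) * \<bar>ln (2 * pi)\<bar>)
     + 2 * \<rho> + (\<rho>\<^sup>2 + real CARD('p)) + 1 + real CARD('p)"

lemma K_pos: "K > 0"
  unfolding K_def using \<rho> by (intro add_nonneg_pos add_pos_nonneg) auto

lemma gap_bound:
  assumes \<omega>: "\<omega> \<in> space P" "X n \<omega> = ennreal x" and x: "1 \<le> x"
  shows "\<bar>gap n \<omega>\<bar> \<le> K * sqrt x"
proof -
  interpret regular_bayes \<Theta> "A n" "B n" "H n \<omega>" \<theta>0 "\<theta>hat n \<omega>" "x powr (1 / 12)" "x powr (1 / 12)" "x powr (1 / 12)" "x powr (- 1 / q)" "\<alpha> n" "\<pi> n" c1 c2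
    by (rule regular_canonical[OF \<omega> x])
  let ?p = "real CARD('p)"
  define k where "k = 2 * \<bar>ln (c1 * measure lborel (ball (0::real^'p) \<rho>))\<bar> + 2 * \<bar>ln c1\<bar> + 2 * \<bar>ln c2\<bar> + ?p * \<bar>ln (2 * pi)\<bar>"
  have k: "0 \<le> k" unfolding k_def by (intro add_nonneg_nonneg mult_nonneg_nonneg) auto
  have q3: "1 / q \<le> 1 / 3" using q by (intro divide_left_mono) auto
  have half: "x powr e \<le> sqrt x" if "e \<le> 1 / 2" for e
    using powr_mono[OF that x] powr_half_sqrt[of x] x by simp
  have s1: "1 \<le> sqrt x" using x by simp
  have b: "x powr (1 / 12) \<le> sqrt x" by (rule half) simp
  have i: "1 / x powr (- 1 / q) = x powr (1 / q)" 
    using powr_minus[of x "1 / q"] by (simp add: divide_inverse)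
  have li: "1 / x powr (- 1 / q) \<le> sqrt x" unfolding i by (rule half) (use q3 in simp)
  \<comment> \<open>The critical term: its exponent \<open>1 / 12 + 1 / 12 + 1 / q\<close> is at
    most one half exactly when \<open>q \<ge> 3\<close>.\<close>
  have "(x powr (1 / 12))\<^sup>2 / x powr (- 1 / q) = x powr (1 / 12) * x powr (1 / 12) * x powr (1 / q)"
    unfolding power2_eq_square i[symmetric] by (simp only: times_divide_eq_right mult_1_right)
  also have "\<dots> = x powr (1 / 12 + 1 / 12 + 1 / q)" by (simp only: powr_add)
  also have "\<dots> \<le> sqrt x" by (rule half) (use q3 in simp)
  finally have dl: "(x powr (1 / 12))\<^sup>2 / x powr (- 1 / q) \<le> sqrt x" .
  have "\<bar>gap n \<omega>\<bar> \<le> k + 2 * \<rho> * x powr (1 / 12) + (\<rho>\<^sup>2 + ?p) * x powr (1 / 12)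
      + (x powr (1 / 12))\<^sup>2 / x powr (- 1 / q) + ?p / x powr (- 1 / q)"
    unfolding gap_def k_def by (rule bic_gap_bound[OF \<rho> ball])
  also have "\<dots> \<le> k * sqrt x + 2 * \<rho> * sqrt x + (\<rho>\<^sup>2 + ?p) * sqrt x + 1 * sqrt x + ?p * sqrt x"
  proof -
    have "k * 1 \<le> k * sqrt x" by (intro mult_left_mono s1 k)
    moreover have "2 * \<rho> * x powr (1 / 12) \<le> 2 * \<rho> * sqrt x" using \<rho> by (intro mult_left_mono b) auto
    moreover have "(\<rho>\<^sup>2 + ?p) * x powr (1 / 12) \<le> (\<rho>\<^sup>2 + ?p) * sqrt x" by (intro mult_left_mono b) auto
    moreover have "?p / x powr (- 1 / q) \<le> ?p * sqrt x"
      using mult_left_mono[OF li, of ?p] by (simp only: times_divide_eq_right mult_1_right of_nat_0_le_iff)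
    ultimately show ?thesis using dl by linarith
  qed
  also have "\<dots> = K * sqrt x" by (simp only: K_def k_def distrib_right)
  finally show ?thesis .
qed

text \<open>Stated pointwise with extended values: where \<open>X\<close> is infinite the right-hand
  side is infinite too, so no exceptional outcomes have to be removed before integrating.\<close>

lemma gap_split:
  assumes m: "1 \<le> m" and e: "0 < e"
  shows "\<forall>\<^sub>F n in sequentially. \<forall>\<omega>\<in>space P. ennreal \<bar>gap n \<omega>\<bar> \<le> ennreal e + ennreal (K / sqrt m) * X n \<omega>"
proof -
  obtain N where N: "\<And>n h \<theta>m. n \<ge> N \<Longrightarrow> regular_bayes \<Theta> (A n) (B n) h \<theta>0 \<theta>m m m m (1 / m) (\<alpha> n) (\<pi> n) c1 c2
     \<Longrightarrow> \<bar>bic_gap \<Theta> h (\<pi> n) \<theta>m\<bar> \<le> e"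
    using bic_gap_uniform[OF \<alpha> prior e, of B m c1 c2] by metis
  define k where "k = K / sqrt m"
  have k: "k > 0" using K_pos m by (simp add: k_def)
  have "ennreal \<bar>gap n \<omega>\<bar> \<le> ennreal e + ennreal k * X n \<omega>" if n: "n \<ge> N" and \<omega>: "\<omega> \<in> space P" for n \<omega>
  proof (cases "X n \<omega> < \<infinity>")
    case True
    then obtain x where x: "1 \<le> x" "X n \<omega> = ennreal x" by (rule X_cases)
    have "ennreal k * X n \<omega> = ennreal (k * x)"
      unfolding x(2) by (rule ennreal_mult[symmetric]) (use k x in auto)
    then have rhs: "ennreal e + ennreal k * X n \<omega> = ennreal (e + k * x)"
      using ennreal_plus[of e "k * x"] x e k by simp
    have pos: "0 \<le> k * x" using k x by simp
    have "\<bar>gap n \<omega>\<bar> \<le> e + k * x"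
    proof (cases "x \<le> m")
      case True
      have b: "x powr (1 / 12) \<le> m"
        using powr_mono[of "1 / 12" 1 x] x True by simp
      \<comment> \<open>For \<open>1 \<le> x \<le> m\<close> and \<open>q \<ge> 1\<close>, the
        eigenvalue bound \<open>x powr (- 1 / q)\<close> is at least \<open>1 / x\<close>; so
        \<open>m\<close> and \<open>1 / m\<close> serve all these outcomes at once.\<close>
      have "1 / m \<le> 1 / x" using x True by (intro divide_left_mono) auto
      also have "\<dots> = x powr (- 1)" using x by (simp add: powr_minus_divide)
      also have "\<dots> \<le> x powr (- 1 / q)" using q x by (intro powr_mono) auto
      finally have l: "1 / m \<le> x powr (- 1 / q)" .
      have "\<bar>gap n \<omega>\<bar> \<le> e"
        unfolding gap_def by (rule N[OF n regular[OF \<omega>, of n x]]) (use x b l m in auto)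
      then show ?thesis using pos by simp
    next
      case False
      have s: "sqrt m \<le> sqrt x" "0 < sqrt m" "0 < sqrt x" using False m x by auto
      have "\<bar>gap n \<omega>\<bar> \<le> K * sqrt x" by (rule gap_bound[OF \<omega> x(2,1)])
      also have "\<dots> = K * (x / sqrt x)" using x by (simp add: real_div_sqrt)
      also have "\<dots> \<le> K * (x / sqrt m)" using s K_pos x by (intro mult_left_mono divide_left_mono) auto
      also have "\<dots> = k * x" by (simp add: k_def)
      finally show ?thesis using e by simp
    qed
    then show ?thesis unfolding rhs by (rule ennreal_leI)
  next
    case False
    then have "X n \<omega> = \<infinity>" by (simp add: less_top[symmetric])
    then show ?thesis using k by (simp add: ennreal_mult_top)
  qed
  then show ?thesis unfolding k_def eventually_sequentially by blast
qed

text \<open>Each ingredient is the evaluation of a continuous random function at a random point. For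
  the marginal likelihood the same lemma is used on the product space, with the second coordinate as
  the point, which gives joint measurability and then Fubini measurability.\<close>

lemma gap_measurable: "\<forall>\<^sub>F n in sequentially. gap n \<in> borel_measurable P"
  using X_integral
proof eventually_elim
  case (elim n)
  note [measurable] = X_measurable \<theta>hat_meas
  have AE: "AE \<omega> in P. X n \<omega> < \<infinity>"
    using nn_integral_noteq_infinite[OF X_measurable, of n] le_less_trans[OF elim ennreal_less_top] by (simp add: less_top)
  have Hm: "(\<lambda>\<omega>. H n \<omega> (\<theta>hat n \<omega>)) \<in> borel_measurable P"
  proof (rule borel_measurable_random_evaluation[OF open_dom H_meas \<theta>hat_meas \<theta>hat_in])
    fix \<omega> s assume \<omega>: "\<omega> \<in> space P" and s: "\<And>m. s m \<in> \<Theta>" "s \<longlonglongrightarrow> \<theta>hat n \<omega>"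
    show "(\<lambda>m. H n \<omega> (s m)) \<longlonglongrightarrow> H n \<omega> (\<theta>hat n \<omega>)"
      by (rule continuous_on_tendsto_compose[OF H_cont[OF \<omega>] s(2) \<theta>hat_in[OF \<omega>]])
        (auto intro!: always_eventually subsetD[OF closure_subset] s(1))
  qed
  have pm: "(\<lambda>\<omega>. \<pi> n (\<theta>hat n \<omega>)) \<in> borel_measurable P"
    by (rule measurable_compose[OF _ \<pi>_meas]) (auto intro!: measurable_restrict_space2 \<theta>hat_in)
  \<comment> \<open>Where \<open>X\<close> is infinite, the limit behind \<open>hess_cl\<close> may
    fail to exist; this null set is set to zero here and restored by completeness. The evaluation
    lemma only asks for limits along sequences in the domain, so a boundary value that is itself a
    limit is admissible.\<close>
  define Y where "Y \<omega> = (if X n \<omega> < \<infinity> then hess_cl \<Theta> (H n \<omega>) (\<theta>hat n \<omega>) else 0)" for \<omega>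
  have Ym: "Y \<in> borel_measurable P"
  proof (rule borel_measurable_random_evaluation[OF open_dom _ \<theta>hat_meas \<theta>hat_in])
    show "(\<lambda>\<omega>. if X n \<omega> < \<infinity> then hess (H n \<omega>) d else 0) \<in> borel_measurable P" if "d \<in> \<Theta>" for d
      using hess_measurable[OF that, of n] by measurable
    fix \<omega> s assume \<omega>: "\<omega> \<in> space P" and s: "\<And>m. s m \<in> \<Theta>" "s \<longlonglongrightarrow> \<theta>hat n \<omega>"
    show "(\<lambda>m. if X n \<omega> < \<infinity> then hess (H n \<omega>) (s m) else 0) \<longlonglongrightarrow> Y \<omega>"
    proof (cases "X n \<omega> < \<infinity>")
      case True
      then obtain x where x: "1 \<le> x" "X n \<omega> = ennreal x" by (rule X_cases)
      interpret regular_bayes \<Theta> "A n" "B n" "H n \<omega>" \<theta>0 "\<theta>hat n \<omega>" "x powr (1 / 12)" "x powr (1 / 12)" "x powr (1 / 12)" "x powr (- 1 / q)" "\<alpha> n" "\<pi> n" c1 c2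
        by (rule regular_canonical[OF \<omega> x(2,1)])
      show ?thesis using hess_seq_tendsto_hess_cl[OF s] True by (simp add: Y_def)
    qed (simp add: Y_def)
  qed
  have "(\<lambda>\<omega>. hess_cl \<Theta> (H n \<omega>) (\<theta>hat n \<omega>)) \<in> borel_measurable P"
    by (rule borel_measurable_AE_eq[OF Ym]) (use AE in \<open>auto simp: Y_def elim: eventually_mono\<close>)
  then have dm: "(\<lambda>\<omega>. det (- hess_cl \<Theta> (H n \<omega>) (\<theta>hat n \<omega>))) \<in> borel_measurable P"
    by (intro borel_measurable_det borel_measurable_uminus)
  \<comment> \<open>Points outside the domain are moved to \<open>\<theta>0\<close>, so that the
    evaluation lemma applies; the indicator in the integrand removes their contribution.\<close>
  have Hj: "(\<lambda>z. H n (fst z) (if snd z \<in> \<Theta> then snd z else \<theta>0)) \<in> borel_measurable (P \<Otimes>\<^sub>M lborel)"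
  proof (rule borel_measurable_random_evaluation[OF open_dom])
    fix d assume "d \<in> \<Theta>"
    from measurable_compose[OF measurable_fst H_meas[OF this]]
    show "(\<lambda>z. H n (fst z) d) \<in> borel_measurable (P \<Otimes>\<^sub>M lborel)" .
  next
    have [measurable]: "\<Theta> \<in> sets borel" using open_dom by simp
    show "(\<lambda>z. if snd z \<in> \<Theta> then snd z else \<theta>0) \<in> borel_measurable (P \<Otimes>\<^sub>M lborel)" by measurable
  next
    fix z s assume z: "z \<in> space (P \<Otimes>\<^sub>M (lborel :: (real^'p) measure))" and s: "\<And>m. s m \<in> \<Theta>" "s \<longlonglongrightarrow> (if snd z \<in> \<Theta> then snd z else \<theta>0)"
    have "fst z \<in> space P" using z by (auto simp: space_pair_measure)
    then show "(\<lambda>m. H n (fst z) (s m)) \<longlonglongrightarrow> H n (fst z) (if snd z \<in> \<Theta> then snd z else \<theta>0)"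
      by (intro continuous_on_tendsto_compose[OF H_cont s(2)])
        (auto intro!: always_eventually subsetD[OF closure_subset] s(1) \<theta>0)
  qed (auto intro!: subsetD[OF closure_subset] \<theta>0)
  have pj: "(\<lambda>\<theta>. indicator \<Theta> \<theta> * \<pi> n \<theta>) \<in> borel_measurable borel"
  proof -
    have "\<pi> n \<in> borel_measurable (restrict_space borel \<Theta>)"
      by (rule measurable_restrict_mono[OF \<pi>_meas closure_subset])
    then show ?thesis using open_dom by (subst (asm) borel_measurable_restrict_space_iff) auto
  qed
  have qm: "(\<lambda>\<omega>. LINT \<theta>:\<Theta>|lborel. exp (H n \<omega> \<theta>) * \<pi> n \<theta>) \<in> borel_measurable P"
    unfolding set_lebesgue_integral_def
  proof (rule lborel.borel_measurable_lebesgue_integral)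
    have "(\<lambda>z. exp (H n (fst z) (if snd z \<in> \<Theta> then snd z else \<theta>0)) * (indicator \<Theta> (snd z) * \<pi> n (snd z))) \<in> borel_measurable (P \<Otimes>\<^sub>M lborel)"
      using Hj measurable_compose[OF measurable_snd[of P lborel], of "\<lambda>\<theta>. indicator \<Theta> \<theta> * \<pi> n \<theta>" borel] pj by measurable
    also have "(\<lambda>z. exp (H n (fst z) (if snd z \<in> \<Theta> then snd z else \<theta>0)) * (indicator \<Theta> (snd z) * \<pi> n (snd z)))
      = (\<lambda>(\<omega>, \<theta>). indicat_real \<Theta> \<theta> *\<^sub>R (exp (H n \<omega> \<theta>) * \<pi> n \<theta>))"
      by (auto simp: fun_eq_iff indicator_def)
    finally show "(\<lambda>(\<omega>, \<theta>). indicat_real \<Theta> \<theta> *\<^sub>R (exp (H n \<omega> \<theta>) * \<pi> n \<theta>)) \<in> borel_measurable (P \<Otimes>\<^sub>M lborel)" .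
  qed
  show ?case
    unfolding gap_def[abs_def] bic_gap_def using Hm pm dm qm by measurable
qed

lemma gap_nn_integral:
  assumes e: "e > 0"
  shows "\<forall>\<^sub>F n in sequentially. (\<integral>\<^sup>+\<omega>. ennreal \<bar>gap n \<omega>\<bar> \<partial>P) \<le> ennreal e"
proof -
  \<comment> \<open>Chosen so that \<open>K * (1 + 2 * C) / sqrt m \<le> e / 2\<close>, where
    \<open>1 + 2 * C\<close> bounds the expectation of \<open>X\<close>; the maximum supplies
    \<open>1 \<le> m\<close> for \<open>gap_split\<close>.\<close>
  define m where "m = max 1 ((2 * K * (1 + 2 * C) / e)\<^sup>2)"
  have m: "1 \<le> m" by (simp add: m_def)
  have "2 * K * (1 + 2 * C) / e \<le> sqrt m"
    by (rule real_le_rsqrt) (simp add: m_def)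
  then have "2 * K * (1 + 2 * C) \<le> sqrt m * e" using e by (simp add: divide_le_eq)
  then have "K * (1 + 2 * C) / sqrt m \<le> e / 2"
    using m by (subst pos_divide_le_eq) (simp_all add: algebra_simps)
  define k where "k = K / sqrt m"
  have k: "0 \<le> k" using K_pos m by (simp add: k_def)
  have Km: "k * (1 + 2 * C) \<le> e / 2"
    using \<open>K * (1 + 2 * C) / sqrt m \<le> e / 2\<close> by (simp add: k_def)
  show ?thesis
    using gap_split[OF m half_gt_zero[OF e], folded k_def] X_integral
  proof (eventually_elim)
    case (elim n)
    have "(\<integral>\<^sup>+\<omega>. ennreal \<bar>gap n \<omega>\<bar> \<partial>P) \<le> (\<integral>\<^sup>+\<omega>. ennreal (e / 2) + ennreal (k) * X n \<omega> \<partial>P)"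
      by (rule nn_integral_mono) (use elim e in auto)
    also have "\<dots> = ennreal (e / 2) + ennreal (k) * (\<integral>\<^sup>+\<omega>. X n \<omega> \<partial>P)"
      using X_measurable by (simp add: nn_integral_add nn_integral_cmult emeasure_space_1)
    also have "\<dots> \<le> ennreal (e / 2) + ennreal (k) * ennreal (1 + 2 * C)"
      by (intro add_left_mono mult_left_mono elim) auto
    also have "\<dots> = ennreal (e / 2 + k * (1 + 2 * C))"
    proof -
      have "ennreal k * ennreal (1 + 2 * C) = ennreal (k * (1 + 2 * C))"
        by (rule ennreal_mult[symmetric]) (use k C in auto)
      moreover have "ennreal (e / 2) + ennreal (k * (1 + 2 * C)) = ennreal (e / 2 + k * (1 + 2 * C))"
        by (rule ennreal_plus[symmetric]) (use e k C in auto)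
      ultimately show ?thesis by (simp only:)
    qed
    also have "\<dots> \<le> ennreal e" using Km by (intro ennreal_leI) simp
    finally show ?case .
  qed
qed

lemma gap_integrable: "\<forall>\<^sub>F n in sequentially. integrable P (gap n)"
  using gap_measurable gap_nn_integral[of 1, simplified]
  by eventually_elim (auto intro!: integrableI_bounded elim: le_less_trans[OF _ ennreal_one_less_top])

lemma gap_L1: "(\<lambda>n. \<integral>\<omega>. \<bar>gap n \<omega>\<bar> \<partial>P) \<longlonglongrightarrow> 0"
proof (rule tendstoI)
  fix e :: real assume e: "e > 0"
  show "\<forall>\<^sub>F n in sequentially. dist (\<integral>\<omega>. \<bar>gap n \<omega>\<bar> \<partial>P) 0 < e"
    using gap_integrable gap_nn_integral[of "e / 2", OF half_gt_zero[OF e]]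
  proof eventually_elim
    case (elim n)
    have "ennreal (\<integral>\<omega>. \<bar>gap n \<omega>\<bar> \<partial>P) = (\<integral>\<^sup>+\<omega>. ennreal \<bar>gap n \<omega>\<bar> \<partial>P)"
      using elim(1) by (intro nn_integral_eq_integral[symmetric]) auto
    also note elim(2)
    finally have "(\<integral>\<omega>. \<bar>gap n \<omega>\<bar> \<partial>P) \<le> e / 2" using e by (simp add: ennreal_le_iff)
    moreover have "0 \<le> (\<integral>\<omega>. \<bar>gap n \<omega>\<bar> \<partial>P)" by simp
    ultimately show ?case using e by simp
  qed
qed

end

section \<open>The theorem\<close>

text \<open>Each \<open>T k\<close> is open only relative to its coordinate subspace. The block
  projection maps into this subspace, so the preimage of \<open>T k\<close> is the preimage of a
  genuinely open set.\<close>

lemma product_domain_open_convex: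
  assumes "product_domain blk K T \<Theta>"
  shows "open \<Theta>" "convex \<Theta>"
proof -
  have lin: "linear (block_proj blk k)" for k
    by (rule linearI) (auto simp: block_proj_def vec_eq_iff)
  have T: "openin (top_of_set (block_space blk k)) (T k)" "convex (T k)" if "k \<in> {1..K}" for k
    using assms that by (auto simp: product_domain_def)
  have \<Theta>: "\<Theta> = (\<Inter>k\<in>{1..K}. block_proj blk k -` T k)"
    using assms by (auto simp: product_domain_def)
  have "open (block_proj blk k -` T k)" if k: "k \<in> {1..K}" for k
  proof -
    obtain U where U: "open U" "T k = block_space blk k \<inter> U"
      using T(1)[OF k] by (auto simp: openin_open)
    have "block_proj blk k -` T k = block_proj blk k -` U"
      unfolding U(2) by (auto simp: block_space_def block_proj_def)
    moreover have "continuous_on UNIV (block_proj blk k)"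
      using lin[of k] by (intro linear_continuous_on) (simp add: linear_conv_bounded_linear)
    ultimately show ?thesis using U(1) by (simp add: open_vimage)
  qed
  then show "open \<Theta>" unfolding \<Theta> by (intro open_INT) auto
  show "convex \<Theta>"
    unfolding \<Theta> by (intro convex_INT convex_linear_vimage lin T)
qed

lemma diagonal_matrix_vector:
  "(\<chi> i j. if i = j then f i else 0) *v u = (\<chi> i. f i * u $ i)" for u :: "real^'n::finite"
proof -
  have "(\<Sum>j\<in>UNIV. (if i = j then f i else 0) * u $ j) = (\<Sum>j\<in>UNIV. if j = i then f i * u $ i else 0)" for i
    by (rule sum.cong) auto
  then show ?thesis by (simp add: matrix_vector_mult_def vec_eq_iff)
qed

lemma diagonal_matrix_inverse:
  fixes f :: "'n::finite \<Rightarrow> real"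
  assumes "\<And>i. f i \<noteq> 0"
  shows "(\<chi> i j. if i = j then f i else 0) ** (\<chi> i j. if i = j then 1 / f i else 0) = mat 1"
    and "(\<chi> i j. if i = j then 1 / f i else 0) ** (\<chi> i j. if i = j then f i else 0) = mat 1"
  by (subst matrix_eq, simp add: matrix_vector_mul_assoc[symmetric] diagonal_matrix_vector assms vec_eq_iff)+

theorem theorem3p15:
  fixes M :: "'w measure"
    and blk :: "'p::finite \<Rightarrow> nat" and K :: nat
    and T :: "nat \<Rightarrow> (real^'p) set" and \<Theta> :: "(real^'p) set" and \<theta>0 :: "real^'p"
    and H :: "nat \<Rightarrow> 'w \<Rightarrow> real^'p \<Rightarrow> real"
    and \<theta>hat :: "nat \<Rightarrow> 'w \<Rightarrow> real^'p"
    and \<pi> :: "nat \<Rightarrow> real^'p \<Rightarrow> real"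
    and a :: "nat \<Rightarrow> nat \<Rightarrow> real^'p \<Rightarrow> real"
    and A :: "nat \<Rightarrow> real^'p^'p"
    and P :: "'w measure"
  assumes "prob_space M"
    and P_eq: "P = completion M"
    and "product_domain blk K T \<Theta>"
    and "\<theta>0 \<in> \<Theta>"
    and "quasi_loglik M \<Theta> H"
    and "is_qmle M \<Theta> H \<theta>hat"
    and "prior_density \<Theta> \<pi>"
    and "rates K \<Theta> \<theta>0 a"
    and A_eq: "A = rate_matrix blk a \<theta>0"
    and A3: "cond_A3 P A \<Theta> H \<theta>0"
    and B1: "cond_B1 P A \<Theta> H \<theta>0"
    and B2: "cond_B2 A \<Theta> \<pi> \<theta>0"
    and B3: "cond_B3 P A \<Theta> H \<theta>0"
    and B4: "cond_B4 P A \<theta>hat \<theta>0"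
    and "\<And>k. k \<in> {1..K} \<Longrightarrow>
           conv_in_prob P (\<lambda>n \<omega>. ln (a k n (\<theta>hat n \<omega>)) - ln (a k n \<theta>0)) (\<lambda>_. 0)"
  shows "(\<forall>\<^sub>F n in sequentially. integrable P
            (\<lambda>\<omega>. - 2 * ln (quasi_marginal \<Theta> H \<pi> n \<omega>) - QBIC_sharp \<Theta> H \<pi> \<theta>hat n \<omega>))
       \<and> (\<lambda>n. \<integral>\<omega>. \<bar>- 2 * ln (quasi_marginal \<Theta> H \<pi> n \<omega>) - QBIC_sharp \<Theta> H \<pi> \<theta>hat n \<omega>\<bar> \<partial>P)
            \<longlonglongrightarrow> 0
       \<and> (\<lambda>n. \<integral>\<omega>. QBIC_sharp \<Theta> H \<pi> \<theta>hat n \<omega> + 2 * ln (quasi_marginal \<Theta> H \<pi> n \<omega>) \<partial>P)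
            \<longlonglongrightarrow> 0"
proof -
  note dom = product_domain_open_convex[OF \<open>product_domain blk K T \<Theta>\<close>]
  have blk: "blk i \<in> {1..K}" for i
    using \<open>product_domain blk K T \<Theta>\<close> unfolding product_domain_def by blast
  have \<theta>0_cl: "\<theta>0 \<in> closure \<Theta>" using \<open>\<theta>0 \<in> \<Theta>\<close> closure_subset by auto
  interpret M: prob_space M by fact
  interpret P: prob_space P
    unfolding P_eq by (rule M.prob_space_completion)
  interpret PC: complete_measure P
    unfolding P_eq by (rule completion.complete_measure_axioms)

  \<comment> \<open>The rate matrix\<close>
  have a_pos: "0 < a k n \<theta>0" and a_dec: "decseq (\<lambda>n. a k n \<theta>0)" and a_lim: "(\<lambda>n. a k n \<theta>0) \<longlonglongrightarrow> 0" if "k \<in> {1..K}" for k n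
    using \<open>rates K \<Theta> \<theta>0 a\<close> that \<theta>0_cl by (auto simp: rates_def)
  \<comment> \<open>The sum dominates every rate and is itself decreasing with limit zero.\<close>
  define \<alpha> where "\<alpha> n = (\<Sum>k\<in>{1..K}. a k n \<theta>0)" for n
  have \<alpha>0: "\<alpha> \<longlonglongrightarrow> 0"
    unfolding \<alpha>_def[abs_def] by (rule tendsto_null_sum) (rule a_lim)
  have a_le: "a (blk i) n \<theta>0 \<le> \<alpha> n" for i n
    unfolding \<alpha>_def by (rule member_le_sum[of "blk i" "{1..K}" "\<lambda>k. a k n \<theta>0"]) (use blk a_pos in \<open>auto intro: less_imp_le\<close>)
  have \<alpha>_pos: "0 < \<alpha> n" for n by (rule less_le_trans[OF a_pos[OF blk] a_le])
  have \<alpha>_dec: "\<alpha> n \<le> \<alpha> 0" for n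
    unfolding \<alpha>_def by (rule sum_mono) (use a_dec in \<open>auto simp: decseq_def\<close>)
  define B where "B n = (\<chi> i j. if i = j then 1 / a (blk i) n \<theta>0 else (0::real))" for n
  have A: "A n = (\<chi> i j. if i = j then a (blk i) n \<theta>0 else 0)" for n
    by (simp add: A_eq rate_matrix_def)
  have A_inv: "B n ** A n = mat 1" "A n ** B n = mat 1" for n
    unfolding A B_def by (rule diagonal_matrix_inverse; use a_pos[OF blk] in \<open>metis less_irrefl\<close>)+
  have A_sym: "transpose (A n) = A n" for n
    by (auto simp: A transpose_def vec_eq_iff)
  have A_norm: "norm (A n *v u) \<le> \<alpha> n * norm u" for n u
  proof -
    have "norm (A n *v u) \<le> norm (\<alpha> n *\<^sub>R u)"
    proof (rule norm_le_componentwise_cart)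
      fix i
      have "\<bar>a (blk i) n \<theta>0\<bar> \<le> \<bar>\<alpha> n\<bar>"
      proof -
        have "0 < a (blk i) n \<theta>0" by (rule a_pos[OF blk])
        moreover have "a (blk i) n \<theta>0 \<le> \<alpha> n" by (rule a_le)
        ultimately show ?thesis by simp
      qed
      then show "norm ((A n *v u) $ i) \<le> norm ((\<alpha> n *\<^sub>R u) $ i)"
        unfolding A diagonal_matrix_vector by (simp add: abs_mult mult_right_mono)
    qed
    also have "\<dots> = \<alpha> n * norm u" using \<alpha>_pos[of n] by simp
    finally show ?thesis .
  qed
  obtain r where r: "r > 0" "ball \<theta>0 r \<subseteq> \<Theta>" using dom(1) \<open>\<theta>0 \<in> \<Theta>\<close> openE by blast
  \<comment> \<open>The rates decrease, so the radius obtained for stage zero works at every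
    stage.\<close>
  define \<rho> where "\<rho> = r / \<alpha> 0"
  have \<rho>: "\<rho> > 0" using r \<alpha>_pos by (simp add: \<rho>_def)
  have ball: "\<theta>0 + A n *v u \<in> \<Theta>" if u: "norm u < \<rho>" for n u
  proof -
    have "norm (A n *v u) \<le> \<alpha> n * norm u" by (rule A_norm)
    also have "\<dots> \<le> \<alpha> 0 * norm u" by (intro mult_right_mono \<alpha>_dec) simp
    also have "\<dots> < r" using u \<alpha>_pos[of 0] by (simp add: \<rho>_def field_simps)
    finally show ?thesis using r by (auto simp: subset_eq dist_norm)
  qed

  \<comment> \<open>Uniform bounds for the prior\<close>
  obtain c1 where c1: "c1 > 0" "\<And>n \<theta>. \<theta> \<in> closure \<Theta> \<Longrightarrow> c1 \<le> \<pi> n \<theta>"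
  proof -
    \<comment> \<open>Capping at one turns the extended infimum into a finite constant.\<close>
    define I where "I = min 1 (INF n. INF \<theta>\<in>closure \<Theta>. ennreal (\<pi> n \<theta>))"
    have "0 < I" "I \<le> 1" using B2 by (auto simp: I_def cond_B2_def)
    then obtain c where c: "0 \<le> c" "I = ennreal c" by (cases I) (auto simp: top_unique)
    have "c \<le> \<pi> n \<theta>" if "\<theta> \<in> closure \<Theta>" for n \<theta>
    proof -
      have "I \<le> (INF n. INF \<theta>\<in>closure \<Theta>. ennreal (\<pi> n \<theta>))" unfolding I_def by simp
      also have "\<dots> \<le> (INF \<theta>\<in>closure \<Theta>. ennreal (\<pi> n \<theta>))" by (rule INF_lower) simp
      also have "\<dots> \<le> ennreal (\<pi> n \<theta>)" using that by (rule INF_lower)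
      finally have "ennreal c \<le> ennreal (\<pi> n \<theta>)" by (simp add: c)
      moreover have "0 < \<pi> n \<theta>" using \<open>prior_density \<Theta> \<pi>\<close> that by (auto simp: prior_density_def)
      ultimately show ?thesis by simp
    qed
    then show thesis using that[of c] \<open>0 < I\<close> c by simp
  qed
  obtain c2 where c2: "\<And>n \<theta>. \<theta> \<in> closure \<Theta> \<Longrightarrow> \<pi> n \<theta> \<le> c2"
  proof -
    define I where "I = (SUP n. SUP \<theta>\<in>closure \<Theta>. ennreal (\<pi> n \<theta>))"
    have "I < \<infinity>" using B2 by (simp add: I_def cond_B2_def)
    then obtain c where c: "0 \<le> c" "I = ennreal c" by (cases I) auto
    have "\<pi> n \<theta> \<le> c" if "\<theta> \<in> closure \<Theta>" for n \<theta>
    proof -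
      have "ennreal (\<pi> n \<theta>) \<le> (SUP \<theta>\<in>closure \<Theta>. ennreal (\<pi> n \<theta>))" using that by (rule SUP_upper)
      also have "\<dots> \<le> I" unfolding I_def by (rule SUP_upper) simp
      finally show ?thesis using c by simp
    qed
    then show thesis by (rule that)
  qed
  have prior: "\<forall>\<^sub>F n in sequentially. \<forall>u. norm u < R \<longrightarrow> \<theta>0 + A n *v u \<in> \<Theta> \<longrightarrow> \<bar>\<pi> n (\<theta>0 + A n *v u) - \<pi> n \<theta>0\<bar> \<le> \<epsilon>"
    if "0 < R" "0 < \<epsilon>" for R \<epsilon>
  proof -
    let ?s = "\<lambda>n. SUP u\<in>local_space A \<Theta> \<theta>0 n \<inter> {u. norm u < R}. ennreal \<bar>\<pi> n (\<theta>0 + A n *v u) - \<pi> n \<theta>0\<bar>"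
    have "?s \<longlonglongrightarrow> 0" using B2 that by (simp add: cond_B2_def)
    from order_tendstoD(2)[OF this, of "ennreal \<epsilon>"] that have "\<forall>\<^sub>F n in sequentially. ?s n < ennreal \<epsilon>" by simp
    then show ?thesis
    proof eventually_elim
      case (elim n)
      show ?case
      proof (intro allI impI)
        fix u assume "norm u < R" "\<theta>0 + A n *v u \<in> \<Theta>"
        then have "ennreal \<bar>\<pi> n (\<theta>0 + A n *v u) - \<pi> n \<theta>0\<bar> \<le> ?s n"
          by (intro SUP_upper) (auto simp: local_space_def)
        also note elim
        finally show "\<bar>\<pi> n (\<theta>0 + A n *v u) - \<pi> n \<theta>0\<bar> \<le> \<epsilon>"
          using that by (auto simp: ennreal_less_iff)
      qed
    qed
  qed

  \<comment> \<open>Modification on a null set\<close>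
  define Gd where "Gd = {\<omega> \<in> space P. \<forall>n. continuous_on (closure \<Theta>) (H n \<omega>) \<and> Ck_on 3 (H n \<omega>) \<Theta>
      \<and> is_arg_max (H n \<omega>) (\<lambda>\<theta>. \<theta> \<in> closure \<Theta>) (\<theta>hat n \<omega>)}"
  have "AE \<omega> in P. \<forall>n. continuous_on (closure \<Theta>) (H n \<omega>) \<and> Ck_on 3 (H n \<omega>) \<Theta>
      \<and> is_arg_max (H n \<omega>) (\<lambda>\<theta>. \<theta> \<in> closure \<Theta>) (\<theta>hat n \<omega>)"
  proof (subst AE_all_countable, rule allI)
    fix n
    have "AE \<omega> in P. continuous_on (closure \<Theta>) (H n \<omega>)" "AE \<omega> in P. Ck_on 3 (H n \<omega>) \<Theta>"
      "AE \<omega> in P. is_arg_max (H n \<omega>) (\<lambda>\<theta>. \<theta> \<in> closure \<Theta>) (\<theta>hat n \<omega>)"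
      using \<open>quasi_loglik M \<Theta> H\<close> \<open>is_qmle M \<Theta> H \<theta>hat\<close> B1
      unfolding quasi_loglik_def is_qmle_def cond_B1_def P_eq by (blast intro: AE_completion)+
    then show "AE \<omega> in P. continuous_on (closure \<Theta>) (H n \<omega>) \<and> Ck_on 3 (H n \<omega>) \<Theta>
      \<and> is_arg_max (H n \<omega>) (\<lambda>\<theta>. \<theta> \<in> closure \<Theta>) (\<theta>hat n \<omega>)" by eventually_elim auto
  qed
  then have AE_Gd: "AE \<omega> in P. \<omega> \<in> Gd" using AE_space by eventually_elim (auto simp: Gd_def)
  \<comment> \<open>The complement of \<open>Gd\<close> is contained in a null set, so completeness
    makes \<open>Gd\<close> measurable.\<close>
  have Gd_sets [measurable]: "Gd \<in> sets P"
  proof (rule PC.in_sets_AE)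
    show "AE \<omega> in P. \<omega> \<in> space P \<longleftrightarrow> \<omega> \<in> Gd"
      using AE_Gd AE_space by eventually_elim auto
  qed (auto simp: Gd_def)
  \<comment> \<open>Off \<open>Gd\<close> the likelihood becomes zero, which is smooth and is
    maximized at \<open>\<theta>0\<close>, so the path properties hold for every outcome.\<close>
  define H' where "H' n \<omega> = (if \<omega> \<in> Gd then H n \<omega> else (\<lambda>_. 0))" for n \<omega>
  define \<theta>hat' where "\<theta>hat' n \<omega> = (if \<omega> \<in> Gd then \<theta>hat n \<omega> else \<theta>0)" for n \<omega>
  have AE_H: "AE \<omega> in P. \<forall>n. H' n \<omega> = H n \<omega>" and AE_\<theta>: "AE \<omega> in P. \<forall>n. \<theta>hat' n \<omega> = \<theta>hat n \<omega>"
    using AE_Gd by (auto simp: H'_def \<theta>hat'_def elim: eventually_mono)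

  \<comment> \<open>Moment bounds for the modified likelihood\<close>
  define f where "f H n \<omega> = ennreal (norm (Delta A H \<theta>0 n \<omega>) powr 12)
         + (SUP \<theta>\<in>\<Theta>. ennreal (norm (Gamma_mat A H n \<omega> \<theta>) powr 12))
         + (\<Sum>i\<in>UNIV. SUP \<theta>\<in>\<Theta>. ennreal (norm (A n ** dhess i (H n \<omega>) \<theta> ** A n) powr 12))" for H n and \<omega> :: 'w
  define g where "g H q n \<omega> = (SUP \<theta>\<in>\<Theta>. neg_powr (lambda_min (Gamma_mat A H n \<omega> \<theta>)) q)" for H q n and \<omega> :: 'w
  \<comment> \<open>The suprema range over the whole domain, so measurability of \<open>f\<close> is
    not established; nonnegative integrals of almost everywhere equal functions agree
    regardless.\<close>
  have f_eq: "(\<integral>\<^sup>+\<omega>. f H' n \<omega> \<partial>P) = (\<integral>\<^sup>+\<omega>. f H n \<omega> \<partial>P)" for n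
    by (rule nn_integral_cong_AE) (use AE_H in \<open>auto simp: f_def Delta_def Gamma_mat_def elim: eventually_mono\<close>)
  have g_eq: "(\<integral>\<^sup>+\<omega>. g H' q n \<omega> \<partial>P) = (\<integral>\<^sup>+\<omega>. g H q n \<omega> \<partial>P)" for q n
    by (rule nn_integral_cong_AE) (use AE_H in \<open>auto simp: g_def Gamma_mat_def elim: eventually_mono\<close>)
  have "(SUP n. \<integral>\<^sup>+\<omega>. f H n \<omega> \<partial>P) < \<infinity>" using B1 unfolding cond_B1_def f_def by (auto dest: spec[of _ 12])
  then obtain C1 where C1: "0 \<le> C1" "(SUP n. \<integral>\<^sup>+\<omega>. f H n \<omega> \<partial>P) = ennreal C1" by (cases "SUP n. \<integral>\<^sup>+\<omega>. f H n \<omega> \<partial>P") auto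
  obtain q where q: "3 * real CARD('p) < q" "limsup (\<lambda>n. \<integral>\<^sup>+\<omega>. g H q n \<omega> \<partial>P) < \<infinity>"
    using B3 unfolding cond_B3_def g_def by blast
  obtain C3 where C3: "0 \<le> C3" "limsup (\<lambda>n. \<integral>\<^sup>+\<omega>. g H q n \<omega> \<partial>P) = ennreal C3"
    using q(2) by (cases "limsup (\<lambda>n. \<integral>\<^sup>+\<omega>. g H q n \<omega> \<partial>P)") auto
  have "limsup (\<lambda>n. \<integral>\<^sup>+\<omega>. g H q n \<omega> \<partial>P) < ennreal (C3 + 1)" unfolding C3(2) using C3(1) by (simp add: ennreal_less_iff)
  from Limsup_lessD[OF this] have C3': "\<forall>\<^sub>F n in sequentially. (\<integral>\<^sup>+\<omega>. g H q n \<omega> \<partial>P) < ennreal (C3 + 1)" .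
  define C where "C = max C1 (C3 + 1)"

  \<comment> \<open>Verification of the pointwise conditions\<close>
  interpret core: qb_core P \<Theta> \<theta>0 H' \<theta>hat' \<pi> A B \<alpha> c1 c2 \<rho> q C
  proof
    show "open \<Theta>" "convex \<Theta>" "\<theta>0 \<in> \<Theta>" by fact+
    show "transpose (A n) = A n" "B n ** A n = mat 1" "A n ** B n = mat 1" "norm (A n *v u) \<le> \<alpha> n * norm u" for n u
      by (rule A_sym A_inv A_norm)+
    show "\<alpha> \<longlonglongrightarrow> 0" "\<rho> > 0" "c1 > 0" by fact+
    show "\<theta>0 + A n *v u \<in> \<Theta>" if "norm u < \<rho>" for n u using that by (rule ball)
    show "(\<lambda>\<omega>. H' n \<omega> \<theta>) \<in> borel_measurable P" if "\<theta> \<in> \<Theta>" for n \<theta>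
    proof -
      have "(\<lambda>\<omega>. H n \<omega> \<theta>) \<in> borel_measurable P"
        using \<open>quasi_loglik M \<Theta> H\<close> that by (auto simp: quasi_loglik_def P_eq intro: measurable_completion)
      then have "(\<lambda>\<omega>. if \<omega> \<in> Gd then H n \<omega> \<theta> else 0) \<in> borel_measurable P" by measurable
      moreover have "(\<lambda>\<omega>. if \<omega> \<in> Gd then H n \<omega> \<theta> else 0) = (\<lambda>\<omega>. H' n \<omega> \<theta>)" by (auto simp: H'_def)
      ultimately show ?thesis by simp
    qed
    show "\<theta>hat' n \<in> borel_measurable P" for n
    proof -
      have "\<theta>hat n \<in> borel_measurable P"
        using \<open>is_qmle M \<Theta> H \<theta>hat\<close> by (auto simp: is_qmle_def P_eq intro: measurable_completion)
      then show ?thesis unfolding \<theta>hat'_def[abs_def] by measurable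
    qed
    show "continuous_on (closure \<Theta>) (H' n \<omega>)" "Ck_on 3 (H' n \<omega>) \<Theta>" for n \<omega>
      by (auto simp: H'_def Gd_def)
    show "\<theta>hat' n \<omega> \<in> closure \<Theta>" for n \<omega>
      using \<theta>0_cl by (auto simp: \<theta>hat'_def Gd_def is_arg_max_def)
    show "H' n \<omega> \<theta> \<le> H' n \<omega> (\<theta>hat' n \<omega>)" if "\<theta> \<in> closure \<Theta>" for n \<omega> \<theta>
      using that by (auto simp: H'_def \<theta>hat'_def Gd_def is_arg_max_def not_less)
    show "\<pi> n \<in> borel_measurable (restrict_space borel (closure \<Theta>))" for n
      using \<open>prior_density \<Theta> \<pi>\<close> by (simp add: prior_density_def)
    show "c1 \<le> \<pi> n \<theta>" "\<pi> n \<theta> \<le> c2" if "\<theta> \<in> closure \<Theta>" for n \<theta>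
      using c1(2) c2 that by auto
    show "\<forall>\<^sub>F n in sequentially. \<forall>u. norm u < R \<longrightarrow> \<theta>0 + A n *v u \<in> \<Theta> \<longrightarrow> \<bar>\<pi> n (\<theta>0 + A n *v u) - \<pi> n \<theta>0\<bar> \<le> \<epsilon>"
      if "0 < R" "0 < \<epsilon>" for R \<epsilon> using that by (rule prior)
    have "1 \<le> real CARD('p)" using zero_less_card_finite[where 'a='p] by linarith
    then show "3 \<le> q" using q(1) by linarith
    show "0 \<le> C" using C1(1) by (simp add: C_def)
    have "(\<integral>\<^sup>+\<omega>. f H' n \<omega> \<partial>P) \<le> ennreal C" for n
    proof -
      have "(\<integral>\<^sup>+\<omega>. f H' n \<omega> \<partial>P) \<le> (SUP n. \<integral>\<^sup>+\<omega>. f H n \<omega> \<partial>P)" unfolding f_eq by (rule SUP_upper) simp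
      also have "\<dots> \<le> ennreal C" unfolding C1(2) C_def by (rule ennreal_leI) simp
      finally show ?thesis .
    qed
    then show "(\<integral>\<^sup>+\<omega>. ennreal (norm (Delta A H' \<theta>0 n \<omega>) powr 12)
         + (SUP \<theta>\<in>\<Theta>. ennreal (norm (Gamma_mat A H' n \<omega> \<theta>) powr 12))
         + (\<Sum>i\<in>UNIV. SUP \<theta>\<in>\<Theta>. ennreal (norm (A n ** dhess i (H' n \<omega>) \<theta> ** A n) powr 12)) \<partial>P) \<le> ennreal C" for n
      unfolding f_def .
    have "\<forall>\<^sub>F n in sequentially. (\<integral>\<^sup>+\<omega>. g H' q n \<omega> \<partial>P) \<le> ennreal C"
      unfolding g_eq using C3'
    proof eventually_elim
      case (elim n)
      have "ennreal (C3 + 1) \<le> ennreal C" unfolding C_def by (rule ennreal_leI) simp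
      with elim show ?case by simp
    qed
    then show "\<forall>\<^sub>F n in sequentially. (\<integral>\<^sup>+\<omega>. (SUP \<theta>\<in>\<Theta>. neg_powr (lambda_min (Gamma_mat A H' n \<omega> \<theta>)) q) \<partial>P) \<le> ennreal C"
      unfolding g_def .
  qed

  \<comment> \<open>Return to the original likelihood and estimator\<close>
  define Y where "Y n \<omega> = - 2 * ln (quasi_marginal \<Theta> H \<pi> n \<omega>) - QBIC_sharp \<Theta> H \<pi> \<theta>hat n \<omega>" for n \<omega>
  have Y_gap: "AE \<omega> in P. Y n \<omega> = core.gap n \<omega>" for n
    using AE_H AE_\<theta>
    by eventually_elim (simp add: Y_def core.gap_def bic_gap_def quasi_marginal_def QBIC_sharp_def)
  have int: "\<forall>\<^sub>F n in sequentially. integrable P (Y n) \<and> (\<integral>\<omega>. \<bar>Y n \<omega>\<bar> \<partial>P) = (\<integral>\<omega>. \<bar>core.gap n \<omega>\<bar> \<partial>P)"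
    using core.gap_integrable
  proof eventually_elim
    case (elim n)
    have g: "core.gap n \<in> borel_measurable P" using elim by auto
    have Y: "Y n \<in> borel_measurable P"
      by (rule PC.borel_measurable_AE_eq[OF g Y_gap]) simp
    have "integrable P (Y n)" using integrable_cong_AE[OF Y g Y_gap] elim by simp
    moreover have "(\<integral>\<omega>. \<bar>Y n \<omega>\<bar> \<partial>P) = (\<integral>\<omega>. \<bar>core.gap n \<omega>\<bar> \<partial>P)"
      by (rule integral_cong_AE) (use Y g Y_gap[of n] in \<open>auto elim: eventually_mono\<close>)
    ultimately show ?case by simp
  qed
  have 1: "\<forall>\<^sub>F n in sequentially. integrable P (Y n)" using int by eventually_elim simp
  have 2: "(\<lambda>n. \<integral>\<omega>. \<bar>Y n \<omega>\<bar> \<partial>P) \<longlonglongrightarrow> 0"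
    by (rule Lim_transform_eventually[OF core.gap_L1]) (use int in eventually_elim, simp)
  have "(\<lambda>n. \<integral>\<omega>. - Y n \<omega> \<partial>P) \<longlonglongrightarrow> 0"
  proof (rule Lim_null_comparison[OF _ 2])
    show "\<forall>\<^sub>F n in sequentially. norm (\<integral>\<omega>. - Y n \<omega> \<partial>P) \<le> (\<integral>\<omega>. \<bar>Y n \<omega>\<bar> \<partial>P)"
      using integral_abs_bound[of P] by (intro always_eventually allI) simp
  qed
  moreover have "- Y n \<omega> = QBIC_sharp \<Theta> H \<pi> \<theta>hat n \<omega> + 2 * ln (quasi_marginal \<Theta> H \<pi> n \<omega>)" for n \<omega>
    by (simp add: Y_def)
  ultimately show ?thesis using 1 2 unfolding Y_def[abs_def] by simp
qed

end
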